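(* Let $n\ge 1$ and let $\Omega\subset\mathbb{R}^n$ be a bounded domain with smooth boundary. Let $u$ be a regular or weak (mild) solution, with initial data $(u_0,u_1)$, of the problem $$\begin{cases}\partial_t^2 u-\Delta u-\|\nabla u_t(t)\|_{L^2(\Omega)}^2\,\Delta u_t=0 & \text{in }\Omega\times\mathbb{R}_+,\\ u=0 & \text{on }\partial\Omega\times\mathbb{R}_+,\\ u(x,0)=u_0(x),\quad \partial_t u(x,0)=u_1(x), & x\in\Omega,\end{cases}$$ and let $$E_u^w(t)=\frac12\|u_t(t)\|_{L^2(\Omega)}^2+\frac12\|\nabla u(t)\|_{L^2(\Omega)}^2,\qquad t\ge0,$$ be its weak energy. Then there exists a constant $C>0$ such that $$E_u^w(t)\le E_u^w(0)\,\frac{2C}{C+t}\qquad\text{for all } t\ge C.$$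
   Context: Here $\Delta$ acts in the sense of distributions and $\mathbb{R}_+=[0,\infty)$. Let $\mathcal{H}=H_0^1(\Omega)\times L^2(\Omega)$ with inner product $\langle (u_1,v_1),(u_2,v_2)\rangle_{\mathcal{H}}=(\nabla u_1,\nabla u_2)_{L^2(\Omega)}+(v_1,v_2)_{L^2(\Omega)}$. Define the nonlinear operator $$D(A)=\{(u,v)\in\mathcal{H}: v\in H_0^1(\Omega)\text{ and }\Delta u+\|\nabla v\|_{L^2(\Omega)}^2\Delta v\in L^2(\Omega)\},\qquad A(u,v)=\left(v,\ \Delta u+\|\nabla v\|_{L^2(\Omega)}^2\Delta v\right).$$ The problem is understood as $\frac{dU}{dt}=AU$, $U(0)=U_0=(u_0,u_1)$, for $U=(u,u_t)$. Regular solution: a solution $U=(u,u_t)$ of this Cauchy problem with $U_0\in D(A)$. Weak (mild) solution: the operator $A$ is $m$-dissipative, i.e. $\langle AU-AV,U-V\rangle_{\mathcal{H}}\le 0$ for all $U,V\in D(A)$ and $R(I-\alpha A)=\mathcal{H}$ for all $\alpha>0$. For $\alpha>0$ put $J_\alpha=(I-\alpha A)^{-1}:\mathcal{H}\to D(A)$ and let $A_\alpha=\alpha^{-1}(J_\alpha-I)$ be the Yosida operator, which is Lipschitz continuous on $\mathcal{H}$. Let $T_\alpha(t)U_0$ be the unique $C^1([0,\infty);\mathcal{H})$ solution of $\frac{dU}{dt}=A_\alpha U$, $U(0)=U_0$. The weak (mild) solution with initial datum $U_0\in\overline{D(A)}=\mathcal{H}$ is $U(t)=(u(t),u_t(t))=\lim_{\alpha\to0^+}T_\alpha(t)U_0$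 (limit in $\mathcal{H}$), $t\ge0$. The constant $C$ is allowed to depend on the solution. *)

theory Defs
  imports "HOL-Analysis.Analysis"
begin

section \<open>Smooth functions and smooth domains\<close>

primrec C_k :: "nat \<Rightarrow> (real^'n \<Rightarrow> real) \<Rightarrow> bool" where
  "C_k 0 f \<longleftrightarrow> continuous_on UNIV f"
| "C_k (Suc k) f \<longleftrightarrow> (\<forall>x. f differentiable (at x)) \<and>
     (\<forall>h. C_k k (\<lambda>x. frechet_derivative f (at x) h))"

definition smooth :: "(real^'n \<Rightarrow> real) \<Rightarrow> bool" where
  "smooth f \<longleftrightarrow> (\<forall>k. C_k k f)"

text \<open>Near every boundary point, and after possibly relabelling and reflecting the coordinate
  axes, the set is the region above the graph of a smooth function \<open>\<gamma>\<close> of the other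
  \<open>n - 1\<close> coordinates. As the dimension is a type, \<open>\<gamma>\<close> is a function on the whole
  space that does not depend on the \<open>k\<close>-th coordinate; \<open>\<sigma> = -1\<close> is the reflection.\<close>

definition smooth_boundary :: "(real^'n) set \<Rightarrow> bool" where
  "smooth_boundary \<Omega> \<longleftrightarrow>
     (\<forall>p \<in> frontier \<Omega>. \<exists>r>0. \<exists>k. \<exists>\<sigma>\<in>{-1, 1}. \<exists>\<gamma>.
        smooth \<gamma> \<and> (\<forall>x t. \<gamma> (x + t *\<^sub>R axis k 1) = \<gamma> x) \<and>
        \<Omega> \<inter> ball p r = {x \<in> ball p r. \<sigma> * x $ k > \<gamma> x})"

definition bounded_smooth_domain :: "(real^'n) set \<Rightarrow> bool" where
  "bounded_smooth_domain \<Omega> \<longleftrightarrow>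
     open \<Omega> \<and> connected \<Omega> \<and> \<Omega> \<noteq> {} \<and> bounded \<Omega> \<and> smooth_boundary \<Omega>"


section \<open>Lebesgue and Sobolev spaces\<close>

text \<open>Elements of the function spaces are represented by functions on the whole of
  \<open>real^'n\<close>, of which only the values on \<open>\<Omega>\<close> matter, and only up to null sets.\<close>

definition L2_space :: "(real^'n) set \<Rightarrow> (real^'n \<Rightarrow> 'b::euclidean_space) set" where
  "L2_space \<Omega> = {f \<in> borel_measurable (lebesgue_on \<Omega>).
     integrable (lebesgue_on \<Omega>) (\<lambda>x. (norm (f x))\<^sup>2)}"

definition L2_inner ::
  "(real^'n) set \<Rightarrow> (real^'n \<Rightarrow> 'b::euclidean_space) \<Rightarrow> (real^'n \<Rightarrow> 'b) \<Rightarrow> real" where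
  "L2_inner \<Omega> f g = (LINT x|lebesgue_on \<Omega>. f x \<bullet> g x)"

definition L2_norm :: "(real^'n) set \<Rightarrow> (real^'n \<Rightarrow> 'b::euclidean_space) \<Rightarrow> real" where
  "L2_norm \<Omega> f = sqrt (L2_inner \<Omega> f f)"

definition test_functions :: "(real^'n) set \<Rightarrow> (real^'n \<Rightarrow> real) set" where
  "test_functions \<Omega> = {\<phi>. smooth \<phi> \<and> compact (closure {x. \<phi> x \<noteq> 0}) \<and>
     closure {x. \<phi> x \<noteq> 0} \<subseteq> \<Omega>}"

definition partial :: "'n \<Rightarrow> (real^'n \<Rightarrow> real) \<Rightarrow> real^'n \<Rightarrow> real" where
  "partial i \<phi> x = frechet_derivative \<phi> (at x) (axis i 1)"

definition laplacian :: "(real^'n \<Rightarrow> real) \<Rightarrow> real^'n \<Rightarrow> real" where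
  "laplacian \<phi> x = (\<Sum>i\<in>UNIV. partial i (partial i \<phi>) x)"

definition weak_gradient ::
  "(real^'n) set \<Rightarrow> (real^'n \<Rightarrow> real) \<Rightarrow> (real^'n \<Rightarrow> real^'n) \<Rightarrow> bool" where
  "weak_gradient \<Omega> u g \<longleftrightarrow> g \<in> L2_space \<Omega> \<and>
     (\<forall>\<phi>\<in>test_functions \<Omega>. \<forall>i.
        (LINT x|lebesgue_on \<Omega>. u x * partial i \<phi> x) = - (LINT x|lebesgue_on \<Omega>. g x $ i * \<phi> x))"

definition H1_space :: "(real^'n) set \<Rightarrow> (real^'n \<Rightarrow> real) set" where
  "H1_space \<Omega> = {u \<in> L2_space \<Omega>. \<exists>g. weak_gradient \<Omega> u g}"

definition grad :: "(real^'n) set \<Rightarrow> (real^'n \<Rightarrow> real) \<Rightarrow> real^'n \<Rightarrow> real^'n" where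
  "grad \<Omega> u = (SOME g. weak_gradient \<Omega> u g)"

definition H1_norm :: "(real^'n) set \<Rightarrow> (real^'n \<Rightarrow> real) \<Rightarrow> real" where
  "H1_norm \<Omega> u = sqrt ((L2_norm \<Omega> u)\<^sup>2 + (L2_norm \<Omega> (grad \<Omega> u))\<^sup>2)"

definition H01_space :: "(real^'n) set \<Rightarrow> (real^'n \<Rightarrow> real) set" where
  "H01_space \<Omega> = {u \<in> H1_space \<Omega>. \<exists>\<phi>. (\<forall>k::nat. \<phi> k \<in> test_functions \<Omega>) \<and>
     (\<lambda>k. H1_norm \<Omega> (\<lambda>x. \<phi> k x - u x)) \<longlonglongrightarrow> 0}"


section \<open>The energy space\<close>

type_synonym 'n state = "(real^'n \<Rightarrow> real) \<times> (real^'n \<Rightarrow> real)"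

definition H_space :: "(real^'n) set \<Rightarrow> 'n state set" where
  "H_space \<Omega> = H01_space \<Omega> \<times> L2_space \<Omega>"

definition H_inner :: "(real^'n) set \<Rightarrow> 'n state \<Rightarrow> 'n state \<Rightarrow> real" where
  "H_inner \<Omega> U V =
     L2_inner \<Omega> (grad \<Omega> (fst U)) (grad \<Omega> (fst V)) + L2_inner \<Omega> (snd U) (snd V)"

definition H_norm :: "(real^'n) set \<Rightarrow> 'n state \<Rightarrow> real" where
  "H_norm \<Omega> U = sqrt (H_inner \<Omega> U U)"

definition H_eq :: "(real^'n) set \<Rightarrow> 'n state \<Rightarrow> 'n state \<Rightarrow> bool" where
  "H_eq \<Omega> U V \<longleftrightarrow> (AE x in lebesgue_on \<Omega>. fst U x = fst V x \<and> snd U x = snd V x)"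

definition scale :: "real \<Rightarrow> 'n state \<Rightarrow> 'n state" where
  "scale a U = ((\<lambda>x. a * fst U x), (\<lambda>x. a * snd U x))"

definition diff :: "'n state \<Rightarrow> 'n state \<Rightarrow> 'n state" where
  "diff U V = ((\<lambda>x. fst U x - fst V x), (\<lambda>x. snd U x - snd V x))"

definition H_tendsto ::
  "(real^'n) set \<Rightarrow> ('a \<Rightarrow> 'n state) \<Rightarrow> 'n state \<Rightarrow> 'a filter \<Rightarrow> bool" where
  "H_tendsto \<Omega> W L F \<longleftrightarrow> ((\<lambda>s. H_norm \<Omega> (diff (W s) L)) \<longlongrightarrow> 0) F"

text \<open>Curves in the energy space are parametrised by \<open>{0..}\<close>; at \<open>t = 0\<close> continuity
  and the derivative are one-sided.\<close>

definition H_continuous :: "(real^'n) set \<Rightarrow> (real \<Rightarrow> 'n state) \<Rightarrow> bool" where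
  "H_continuous \<Omega> W \<longleftrightarrow>
     (\<forall>t\<ge>0. W t \<in> H_space \<Omega> \<and> H_tendsto \<Omega> W (W t) (at t within {0..}))"

definition H_has_derivative ::
  "(real^'n) set \<Rightarrow> (real \<Rightarrow> 'n state) \<Rightarrow> 'n state \<Rightarrow> real \<Rightarrow> bool" where
  "H_has_derivative \<Omega> W D t \<longleftrightarrow> D \<in> H_space \<Omega> \<and>
     H_tendsto \<Omega> (\<lambda>s. scale (1 / (s - t)) (diff (W s) (W t))) D (at t within {0..})"

definition H_absolutely_continuous_on ::
  "(real^'n) set \<Rightarrow> real \<Rightarrow> real \<Rightarrow> (real \<Rightarrow> 'n state) \<Rightarrow> bool" where
  "H_absolutely_continuous_on \<Omega> a b W \<longleftrightarrow>
     (\<forall>\<epsilon>>0. \<exists>\<delta>>0. \<forall>(m::nat) l r.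
        (\<forall>i<m. a \<le> l i \<and> l i \<le> r i \<and> r i \<le> b) \<and>
        (\<forall>i<m. \<forall>j<m. i \<noteq> j \<longrightarrow> r i \<le> l j \<or> r j \<le> l i) \<and>
        (\<Sum>i<m. r i - l i) < \<delta> \<longrightarrow>
        (\<Sum>i<m. H_norm \<Omega> (diff (W (r i)) (W (l i)))) < \<epsilon>)"


section \<open>The nonlinear operator and its Yosida regularisation\<close>

text \<open>\<open>A_value \<Omega> U f\<close> says that the distribution \<open>\<Delta>u + \<parallel>\<nabla>v\<parallel>\<^sup>2 \<Delta>v\<close>, for \<open>U = (u, v)\<close>,
  is (represented by) the square-integrable function \<open>f\<close>.\<close>

definition A_value :: "(real^'n) set \<Rightarrow> 'n state \<Rightarrow> (real^'n \<Rightarrow> real) \<Rightarrow> bool" where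
  "A_value \<Omega> U f \<longleftrightarrow> f \<in> L2_space \<Omega> \<and>
     (\<forall>\<phi>\<in>test_functions \<Omega>.
        (LINT x|lebesgue_on \<Omega>. fst U x * laplacian \<phi> x) +
        (L2_norm \<Omega> (grad \<Omega> (snd U)))\<^sup>2 * (LINT x|lebesgue_on \<Omega>. snd U x * laplacian \<phi> x) =
        (LINT x|lebesgue_on \<Omega>. f x * \<phi> x))"

definition dom_A :: "(real^'n) set \<Rightarrow> 'n state set" where
  "dom_A \<Omega> = {U \<in> H_space \<Omega>. snd U \<in> H01_space \<Omega> \<and> (\<exists>f. A_value \<Omega> U f)}"

definition op_A :: "(real^'n) set \<Rightarrow> 'n state \<Rightarrow> 'n state" where
  "op_A \<Omega> U = (snd U, SOME f. A_value \<Omega> U f)"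

text \<open>The resolvent \<open>J\<^sub>\<alpha> = (I - \<alpha>A)\<^sup>-\<^sup>1\<close> is the inverse of a relation and the Yosida operator is
  \<open>A\<^sub>\<alpha> = (J\<^sub>\<alpha> - I) / \<alpha>\<close>. Both are given by their graphs: \<open>resolvent \<Omega> \<alpha> F V\<close> is \<open>V = J\<^sub>\<alpha> F\<close>
  and \<open>yosida \<Omega> \<alpha> F G\<close> is \<open>G = A\<^sub>\<alpha> F\<close>.\<close>

definition resolvent :: "(real^'n) set \<Rightarrow> real \<Rightarrow> 'n state \<Rightarrow> 'n state \<Rightarrow> bool" where
  "resolvent \<Omega> \<alpha> F V \<longleftrightarrow> F \<in> H_space \<Omega> \<and> V \<in> dom_A \<Omega> \<and>
     H_eq \<Omega> (diff V (scale \<alpha> (op_A \<Omega> V))) F"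

definition yosida :: "(real^'n) set \<Rightarrow> real \<Rightarrow> 'n state \<Rightarrow> 'n state \<Rightarrow> bool" where
  "yosida \<Omega> \<alpha> F G \<longleftrightarrow> G \<in> H_space \<Omega> \<and>
     (\<exists>V. resolvent \<Omega> \<alpha> F V \<and> H_eq \<Omega> G (scale (1 / \<alpha>) (diff V F)))"

text \<open>\<open>W\<close> is the continuously differentiable solution \<open>t \<mapsto> T\<^sub>\<alpha>(t) U0\<close> of
  \<open>dW/dt = A\<^sub>\<alpha> W\<close>, \<open>W(0) = U0\<close>.\<close>

definition yosida_solution ::
  "(real^'n) set \<Rightarrow> real \<Rightarrow> 'n state \<Rightarrow> (real \<Rightarrow> 'n state) \<Rightarrow> bool" where
  "yosida_solution \<Omega> \<alpha> U0 W \<longleftrightarrow>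
     H_continuous \<Omega> W \<and> H_eq \<Omega> (W 0) U0 \<and>
     (\<exists>D. H_continuous \<Omega> D \<and>
        (\<forall>t\<ge>0. H_has_derivative \<Omega> W (D t) t \<and> yosida \<Omega> \<alpha> (W t) (D t)))"


section \<open>Solutions of the damped wave equation\<close>

text \<open>Strong solutions in the sense of nonlinear semigroup theory: solutions starting in the
  domain of \<open>A\<close> are in general differentiable only almost everywhere in time.\<close>

definition regular_solution ::
  "(real^'n) set \<Rightarrow> 'n state \<Rightarrow> (real \<Rightarrow> 'n state) \<Rightarrow> bool" where
  "regular_solution \<Omega> U0 U \<longleftrightarrow>
     U0 \<in> dom_A \<Omega> \<and> H_eq \<Omega> (U 0) U0 \<and> H_continuous \<Omega> U \<and>
     (\<forall>a b. 0 < a \<and> a \<le> b \<longrightarrow> H_absolutely_continuous_on \<Omega> a b U) \<and>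
     (AE t in lebesgue_on {0..}. U t \<in> dom_A \<Omega> \<and> H_has_derivative \<Omega> U (op_A \<Omega> (U t)) t)"

definition mild_solution ::
  "(real^'n) set \<Rightarrow> 'n state \<Rightarrow> (real \<Rightarrow> 'n state) \<Rightarrow> bool" where
  "mild_solution \<Omega> U0 U \<longleftrightarrow> U0 \<in> H_space \<Omega> \<and>
     (\<exists>T. (\<forall>\<alpha>>0. yosida_solution \<Omega> \<alpha> U0 (T \<alpha>)) \<and>
        (\<forall>t\<ge>0. U t \<in> H_space \<Omega> \<and> H_tendsto \<Omega> (\<lambda>\<alpha>. T \<alpha> t) (U t) (at_right 0)))"

definition weak_energy ::
  "(real^'n) set \<Rightarrow> (real \<Rightarrow> real^'n \<Rightarrow> real) \<Rightarrow> (real \<Rightarrow> real^'n \<Rightarrow> real) \<Rightarrow> real \<Rightarrow> real" where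
  "weak_energy \<Omega> u ut t =
     1 / 2 * (L2_norm \<Omega> (ut t))\<^sup>2 + 1 / 2 * (L2_norm \<Omega> (grad \<Omega> (u t)))\<^sup>2"

end

theory Submission
  imports Defs "HOL-Computational_Algebra.Polynomial"
begin

text \<open>Let \<open>U = (u, v)\<close> with \<open>v = u_t\<close>, let \<open>a = \<parallel>\<nabla>v\<parallel>\<close> and let \<open>e = \<parallel>\<nabla>u\<parallel>\<^sup>2 + \<parallel>v\<parallel>\<^sup>2\<close>, which is twice the
energy. Pairing \<open>dU/dt = AU\<close> with \<open>U\<close> gives \<open>e' = - 2 a^4\<close>: the damping is quartic in \<open>\<nabla>v\<close>, so only
algebraic decay can be expected. To see the potential energy as well, the equation is multiplied by
\<open>u\<close>: for \<open>P = \<integral> u v\<close> and \<open>p = (\<nabla>u, \<nabla>v)\<close>,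
\<open>P' = \<parallel>v\<parallel>\<^sup>2 - \<parallel>\<nabla>u\<parallel>\<^sup>2 - a\<^sup>2 p = - e + 2 \<parallel>v\<parallel>\<^sup>2 - a\<^sup>2 p\<close>.
By the Poincare inequality \<open>\<parallel>v\<parallel> \<le> c a\<close>. After multiplication by \<open>e\<close>, Young's inequality turns
all the terms with \<open>a\<close> into a part of \<open>e\<^sup>2\<close> and a multiple of the dissipation \<open>a^4\<close>, so that
\<open>e P' \<le> - (3/8) e\<^sup>2 + K a^4\<close>. For small \<open>\<epsilon>\<close> the functional \<open>F = e (1 + \<epsilon> P)\<close> therefore lies
between \<open>e / 2\<close> and \<open>3 e / 2\<close> and satisfies \<open>F' \<le> - (\<epsilon> / 6) F\<^sup>2\<close>. Hence \<open>1 / F\<close> grows at least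
linearly and \<open>e(t) \<le> \<kappa> / t\<close>; the constant of the theorem is \<open>C = \<kappa> / E(0)\<close>
if \<open>E(0) > 0\<close>, and otherwise the energy vanishes for all times.

Regular solutions and Yosida approximations are treated together. If \<open>W' = A\<^sub>\<alpha> W\<close> and \<open>V = J\<^sub>\<alpha> W\<close>,
then \<open>W' = AV\<close> and \<open>W = V - \<alpha> AV\<close>, and a regular solution is the case \<open>\<alpha> = 0\<close>, \<open>V = W\<close>
(\<open>approximate_solution\<close>). The computation above acquires extra terms, but also the extra dissipation
\<open>\<alpha> \<parallel>AV\<parallel>\<^sup>2\<close>, since \<open>e' = - 2 (a^4 + \<alpha> \<parallel>AV\<parallel>\<^sup>2)\<close>, and it absorbs them (\<open>op_A_energy_identities\<close>,
\<open>energy_multiplier_inequality\<close>, \<open>Lyapunov_inequality\<close>). The constants depend on the initial energy and on \<open>c\<close>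
but not on \<open>\<alpha> \<in> [0, 1]\<close>, so that the bound passes to the limit \<open>\<alpha> \<rightarrow> 0\<close> for mild solutions.

As a regular solution has a derivative only almost everywhere in time, the differential inequality for \<open>1 / F\<close>
is integrated with the help of absolute continuity (\<open>absolutely_continuous_growth\<close>).

The duality pairings above need some facts on Sobolev functions. Weak gradients are unique, because smooth
bumps approximate indicators of boxes (\<open>orthogonal_to_test_functions_imp_zero\<close>); the classical gradient
of a test function is its weak gradient, because Lebesgue measure is translation invariant
(\<open>integral_partial_eq_0\<close>); and the definition of \<open>A\<close> by test functions extends by density to all functions in the
closure of the test functions (\<open>A_value_weak_form\<close>), in particular to \<open>u\<close> and \<open>v\<close> themselves.\<close>

section \<open>Smooth functions\<close>

lemma C_k_SucI:
  assumes "\<And>x. (f has_derivative f' x) (at x)" and "\<And>h. C_k k (\<lambda>x. f' x h)"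
  shows "C_k (Suc k) f"
proof -
  have "frechet_derivative f (at x) = f' x" for x
    using frechet_derivative_at[OF assms(1)[of x]] by simp
  with assms show ?thesis
    unfolding C_k.simps by (auto simp: differentiable_def)
qed

lemma C_k_has_derivative:
  assumes "C_k (Suc k) f"
  shows "(f has_derivative frechet_derivative f (at x)) (at x)"
  using assms by (simp add: frechet_derivative_works)

lemma C_k_Suc_imp: "C_k (Suc k) f \<Longrightarrow> C_k k f"
proof (induction k arbitrary: f)
  case 0
  then show ?case
    by (auto intro!: continuous_at_imp_continuous_on differentiable_imp_continuous_within)
next
  case (Suc k)
  then show ?case by (simp only: C_k.simps) blast
qed

lemma C_k_const: "C_k k (\<lambda>x. c)"
proof (induction k arbitrary: c)
  case (Suc k)
  show ?case
    by (rule C_k_SucI[where f' = "\<lambda>x h. 0"]) (auto intro: Suc)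
qed auto

lemma C_k_add: "C_k k f \<Longrightarrow> C_k k g \<Longrightarrow> C_k k (\<lambda>x. f x + g x)"
proof (induction k arbitrary: f g)
  case 0
  then show ?case by (auto intro: continuous_intros)
next
  case (Suc k)
  show ?case
  proof (rule C_k_SucI)
    show "((\<lambda>x. f x + g x) has_derivative
        (\<lambda>h. frechet_derivative f (at x) h + frechet_derivative g (at x) h)) (at x)" for x
      by (rule has_derivative_add[OF C_k_has_derivative[OF Suc.prems(1)] C_k_has_derivative[OF Suc.prems(2)]])
  qed (use Suc in auto)
qed

lemma C_k_mult: "C_k k f \<Longrightarrow> C_k k g \<Longrightarrow> C_k k (\<lambda>x. f x * g x)"
proof (induction k arbitrary: f g)
  case 0
  then show ?case by (auto intro: continuous_intros)
next
  case (Suc k)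
  show ?case
  proof (rule C_k_SucI)
    show "((\<lambda>x. f x * g x) has_derivative
        (\<lambda>h. f x * frechet_derivative g (at x) h + frechet_derivative f (at x) h * g x)) (at x)" for x
      by (rule has_derivative_mult[OF C_k_has_derivative[OF Suc.prems(1)] C_k_has_derivative[OF Suc.prems(2)]])
    show "C_k k (\<lambda>x. f x * frechet_derivative g (at x) h + frechet_derivative f (at x) h * g x)" for h
      using C_k_Suc_imp[OF Suc.prems(1)] C_k_Suc_imp[OF Suc.prems(2)] Suc.prems
      by (intro C_k_add Suc.IH) (simp_all only: C_k.simps)
  qed
qed

lemma C_k_prod:
  assumes "finite I" and "\<And>i. i \<in> I \<Longrightarrow> C_k k (f i)"
  shows "C_k k (\<lambda>x. \<Prod>i\<in>I. f i x)"
  using assms by (induction I rule: finite_induct) (simp_all add: C_k_const C_k_mult)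

lemma C_k_component: "C_k k (\<lambda>x :: real^'n. x $ i)"
proof (cases k)
  case (Suc m)
  have "((\<lambda>x. x $ i) has_derivative (\<lambda>h. h $ i)) (at x)" for x :: "real^'n"
    by (rule bounded_linear_imp_has_derivative) (rule bounded_linear_vec_nth)
  then show ?thesis
    unfolding Suc by (rule C_k_SucI) (rule C_k_const)
qed (auto intro: continuous_intros)

lemma smooth_const: "smooth (\<lambda>x. c)"
  and smooth_add: "smooth f \<Longrightarrow> smooth g \<Longrightarrow> smooth (\<lambda>x. f x + g x)"
  and smooth_mult: "smooth f \<Longrightarrow> smooth g \<Longrightarrow> smooth (\<lambda>x. f x * g x)"
  and smooth_component: "smooth (\<lambda>x. x $ i)"
  by (auto simp: smooth_def intro: C_k_const C_k_add C_k_mult C_k_component)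

lemma smooth_prod:
  "finite I \<Longrightarrow> (\<And>i. i \<in> I \<Longrightarrow> smooth (f i)) \<Longrightarrow> smooth (\<lambda>x. \<Prod>i\<in>I. f i x)"
  by (auto simp: smooth_def intro: C_k_prod)

lemma smooth_has_derivative:
  "smooth f \<Longrightarrow> (f has_derivative frechet_derivative f (at x)) (at x)"
  unfolding smooth_def by (blast intro: C_k_has_derivative[of 0])

lemma smooth_continuous: "smooth f \<Longrightarrow> continuous_on S f"
  unfolding smooth_def by (metis C_k.simps(1) continuous_on_subset subset_UNIV)

lemma smooth_partial: "smooth f \<Longrightarrow> smooth (partial i f)"
proof -
  assume f: "smooth f"
  have "C_k k (\<lambda>x. frechet_derivative f (at x) (axis i 1))" for k
    using f[unfolded smooth_def, rule_format, of "Suc k"] by simp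
  then show ?thesis
    by (simp add: smooth_def partial_def[abs_def])
qed

lemma partial_mult:
  assumes "smooth f" "smooth g"
  shows "partial i (\<lambda>x. f x * g x) x = f x * partial i g x + partial i f x * g x"
  unfolding partial_def
  using frechet_derivative_at[OF has_derivative_mult[OF smooth_has_derivative smooth_has_derivative],
      OF assms, of x, symmetric]
  by simp

lemma partial_component: "partial i (\<lambda>x :: real^'n. x $ i) x = 1"
proof -
  have "((\<lambda>x. x $ i) has_derivative (\<lambda>h. h $ i)) (at x)" for x :: "real^'n"
    by (rule bounded_linear_imp_has_derivative) (rule bounded_linear_vec_nth)
  from frechet_derivative_at[OF this, of x, symmetric] show ?thesis
    by (simp add: partial_def axis_def)
qed

section \<open>Bump functions and test functions\<close>

text \<open>The functions \<open>p(1/y) exp(-1/y)\<close> with a polynomial \<open>p\<close>, extended by \<open>0\<close>. Allowing all \<open>p\<close> makes the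
family closed under differentiation, so that smoothness is one induction.\<close>

definition flat_exp :: "real poly \<Rightarrow> real \<Rightarrow> real" where
  "flat_exp p y = (if y > 0 then poly p (1 / y) * exp (- (1 / y)) else 0)"

lemma tendsto_poly_exp: "((\<lambda>z. poly p z * exp (- z)) \<longlongrightarrow> 0) (at_top :: real filter)"
proof -
  have "((\<lambda>z::real. \<Sum>i\<le>degree p. coeff p i * (z ^ i / exp z)) \<longlongrightarrow> (\<Sum>i\<le>degree p. coeff p i * 0)) at_top"
    by (intro tendsto_intros tendsto_power_div_exp_0)
  then show ?thesis
    by (simp add: poly_altdef sum_distrib_right exp_minus divide_inverse mult.assoc)
qed

text \<open>The polynomial \<open>y\<^sup>2 (p - p')\<close> comes from \<open>(1/y)' = - 1/y\<^sup>2\<close>; at \<open>0\<close> the exponential beats every power of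
\<open>1/y\<close>.\<close>

lemma flat_exp_has_derivative:
  "(flat_exp p has_real_derivative flat_exp ([:0, 0, 1:] * (p - pderiv p)) y) (at y)"
proof (cases y "0 :: real" rule: linorder_cases)
  case less
  have "((\<lambda>y. 0) has_real_derivative 0) (at y)" by simp
  then have "(flat_exp p has_real_derivative 0) (at y)"
    by (rule has_field_derivative_transform_within_open[where S = "{..<0}"])
       (use less in \<open>auto simp: flat_exp_def\<close>)
  then show ?thesis using less by (simp add: flat_exp_def)
next
  case greater
  have "((\<lambda>y. poly p (1 / y) * exp (- (1 / y))) has_real_derivative
     (poly (pderiv p) (1 / y) * (- (1 / y\<^sup>2))) * exp (- (1 / y))
      + poly p (1 / y) * (exp (- (1 / y)) * (1 / y\<^sup>2))) (at y)"
    using greater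
    by (auto intro!: derivative_eq_intros poly_DERIV[THEN DERIV_chain2]
        simp: power2_eq_square divide_simps)
  then have "(flat_exp p has_real_derivative 
     (poly (pderiv p) (1 / y) * (- (1 / y\<^sup>2))) * exp (- (1 / y))
      + poly p (1 / y) * (exp (- (1 / y)) * (1 / y\<^sup>2))) (at y)"
    by (rule has_field_derivative_transform_within_open[where S = "{0<..}"])
       (use greater in \<open>auto simp: flat_exp_def\<close>)
  moreover have "(poly (pderiv p) (1 / y) * (- (1 / y\<^sup>2))) * exp (- (1 / y))
      + poly p (1 / y) * (exp (- (1 / y)) * (1 / y\<^sup>2)) = flat_exp ([:0, 0, 1:] * (p - pderiv p)) y"
    using greater by (simp add: flat_exp_def field_simps power2_eq_square)
  ultimately show ?thesis by simp
next
  case equal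
  have "((\<lambda>h. flat_exp p h / h) \<longlongrightarrow> 0) (at 0)"
    unfolding filterlim_at_split
  proof
    show "((\<lambda>h. flat_exp p h / h) \<longlongrightarrow> 0) (at_left 0)"
      by (rule tendsto_eventually) (auto simp: flat_exp_def eventually_at_filter)
    have "((\<lambda>h. poly ([:0, 1:] * p) (inverse h) * exp (- inverse h)) \<longlongrightarrow> 0) (at_right (0::real))"
      by (rule filterlim_compose[OF tendsto_poly_exp filterlim_inverse_at_top_right])
    then show "((\<lambda>h. flat_exp p h / h) \<longlongrightarrow> 0) (at_right 0)"
      by (rule Lim_transform_eventually) (auto simp: flat_exp_def eventually_at_filter field_simps)
  qed
  then show ?thesis
    unfolding has_field_derivative_iff by (simp add: equal flat_exp_def)
qed

lemma smooth_flat_exp: "smooth (\<lambda>x. flat_exp p (s * x $ i + b))"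
proof -
  (* the factor c is there to absorb the constants of the chain rule *)
  have "C_k k (\<lambda>x. c * flat_exp p (s * x $ i + b))" for k p c
  proof (induction k arbitrary: p c)
    case 0
    have "continuous_on UNIV (flat_exp p)"
      by (rule DERIV_continuous_on) (rule DERIV_subset[OF flat_exp_has_derivative subset_UNIV])
    then have "continuous_on UNIV (\<lambda>x::real^'a. flat_exp p (s * x $ i + b))"
      by (rule continuous_on_compose2) (auto intro!: continuous_intros)
    then show ?case by (auto intro: continuous_intros)
  next
    case (Suc k)
    let ?q = "[:0, 0, 1:] * (p - pderiv p)"
    show ?case
    proof (rule C_k_SucI)
      fix x :: "real^'a"
      have lin: "((\<lambda>x. s * x $ i + b) has_derivative (\<lambda>h. s * h $ i)) (at x)"
        by (auto intro!: derivative_eq_intros bounded_linear_imp_has_derivative bounded_linear_vec_nth)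
      have "((\<lambda>x. flat_exp p (s * x $ i + b)) has_derivative (\<lambda>h. flat_exp ?q (s * x $ i + b) * (s * h $ i))) (at x)"
        using has_derivative_compose[OF lin flat_exp_has_derivative[unfolded has_field_derivative_def]] by simp
      then show "((\<lambda>x. c * flat_exp p (s * x $ i + b)) has_derivative 
          (\<lambda>h. (c * s * h $ i) * flat_exp ?q (s * x $ i + b))) (at x)"
        by (auto intro!: derivative_eq_intros simp: algebra_simps)
    qed (rule Suc)
  qed
  from this[of _ 1] show ?thesis by (simp add: smooth_def)
qed

text \<open>Since \<open>exp (- 1 / (m y)) \<longrightarrow> 1\<close> for every \<open>y > 0\<close>, dilating the one-sided bump by \<open>m = 1, 2, ...\<close> makes the
products converge to the indicator of the box while their supports stay in it.\<close>

definition box_bump :: "real^'n \<Rightarrow> real^'n \<Rightarrow> nat \<Rightarrow> real^'n \<Rightarrow> real" where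
  "box_bump a b m x =
     (\<Prod>i\<in>UNIV. flat_exp 1 (real (Suc m) * x $ i + - real (Suc m) * a $ i) *
                flat_exp 1 (- real (Suc m) * x $ i + real (Suc m) * b $ i))"

lemma flat_exp_one: "flat_exp 1 y = (if y > 0 then exp (- (1 / y)) else 0)"
  by (simp add: flat_exp_def)

lemma smooth_box_bump: "smooth (box_bump a b m)"
  unfolding box_bump_def[abs_def] by (intro smooth_prod smooth_mult smooth_flat_exp finite)

lemma box_bump_outside: "x \<notin> box a b \<Longrightarrow> box_bump a b m x = 0"
proof -
  assume "x \<notin> box a b"
  then obtain i where "\<not> (a $ i < x $ i \<and> x $ i < b $ i)" by (auto simp: mem_box_cart)
  then have "\<not> (real (Suc m) * (x $ i - a $ i) > 0 \<and> real (Suc m) * (b $ i - x $ i) > 0)"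
    by (simp add: zero_less_mult_iff)
  then have "flat_exp 1 (real (Suc m) * x $ i + - real (Suc m) * a $ i) *
                flat_exp 1 (- real (Suc m) * x $ i + real (Suc m) * b $ i) = 0"
    by (auto simp: flat_exp_one algebra_simps)
  then show ?thesis
    unfolding box_bump_def by (intro prod_zero) auto
qed

lemma box_bump_bound: "0 \<le> box_bump a b m x \<and> box_bump a b m x \<le> 1"
  unfolding box_bump_def
  by (intro conjI prod_nonneg prod_le_1 ballI mult_nonneg_nonneg mult_le_one) (auto simp: flat_exp_one)

lemma box_bump_tendsto: "(\<lambda>m. box_bump a b m x) \<longlonglongrightarrow> indicator (box a b) x"
proof (cases "x \<in> box a b")
  case True
  have *: "(\<lambda>m. flat_exp 1 (real (Suc m) * y)) \<longlonglongrightarrow> 1" if "y > 0" for y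
  proof -
    have "(\<lambda>m. exp (- (inverse (real (Suc m)) / y))) \<longlonglongrightarrow> exp (- (0 / y))"
      by (intro tendsto_intros LIMSEQ_inverse_real_of_nat) (use that in auto)
    moreover have "flat_exp 1 (real (Suc m) * y) = exp (- (inverse (real (Suc m)) / y))" for m
      using that by (simp add: flat_exp_one zero_less_mult_iff divide_simps)
    ultimately show ?thesis by simp
  qed
  have "(\<lambda>m. \<Prod>i\<in>UNIV. flat_exp 1 (real (Suc m) * (x $ i - a $ i)) * flat_exp 1 (real (Suc m) * (b $ i - x $ i)))
    \<longlonglongrightarrow> (\<Prod>i\<in>(UNIV :: 'a set). 1 * 1)"
    using True by (intro tendsto_intros *) (auto simp: mem_box_cart)
  then show ?thesis
    using True by (simp add: box_bump_def algebra_simps)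
next
  case False
  then show ?thesis by (simp add: box_bump_outside)
qed

lemma test_functionsI:
  assumes "smooth \<phi>" and "compact K" and "K \<subseteq> \<Omega>" and "\<And>x. x \<notin> K \<Longrightarrow> \<phi> x = 0"
  shows "\<phi> \<in> test_functions \<Omega>"
proof -
  have "closure {x. \<phi> x \<noteq> 0} \<subseteq> K"
    by (rule closure_minimal) (use assms compact_imp_closed in auto)
  moreover have "compact (closure {x. \<phi> x \<noteq> 0})"
    using assms(2) closed_closure compact_Int_closed[of K "closure {x. \<phi> x \<noteq> 0}"] calculation
    by (simp add: Int_absorb1)
  ultimately show ?thesis
    using assms unfolding test_functions_def by auto
qed

lemma test_functionsE:
  assumes "\<phi> \<in> test_functions \<Omega>"
  obtains K where "smooth \<phi>" and "compact K" and "K \<subseteq> \<Omega>" and "\<And>x. x \<notin> K \<Longrightarrow> \<phi> x = 0"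
proof (rule that[of "closure {x. \<phi> x \<noteq> 0}"])
  show "\<phi> x = 0" if "x \<notin> closure {x. \<phi> x \<noteq> 0}" for x
    using that closure_subset[of "{x. \<phi> x \<noteq> 0}"] by blast
qed (use assms in \<open>simp_all add: test_functions_def\<close>)

lemma box_bump_test: "cbox a b \<subseteq> \<Omega> \<Longrightarrow> box_bump a b m \<in> test_functions \<Omega>"
  by (rule test_functionsI[of _ "cbox a b"])
     (use box_subset_cbox[of a b] in \<open>auto intro!: smooth_box_bump box_bump_outside\<close>)

lemma test_functions_mult:
  assumes "\<phi> \<in> test_functions \<Omega>" and "smooth f"
  shows "(\<lambda>x. f x * \<phi> x) \<in> test_functions \<Omega>"
proof -
  obtain K where "smooth \<phi>" "compact K" "K \<subseteq> \<Omega>" "\<And>x. x \<notin> K \<Longrightarrow> \<phi> x = 0"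
    using test_functionsE[OF assms(1)] by metis
  then show ?thesis
    by (intro test_functionsI[of _ K] smooth_mult assms) auto
qed

lemma test_functions_partial:
  assumes "\<phi> \<in> test_functions \<Omega>"
  shows "partial i \<phi> \<in> test_functions \<Omega>"
proof -
  obtain K where K: "smooth \<phi>" "compact K" "K \<subseteq> \<Omega>" "\<And>x. x \<notin> K \<Longrightarrow> \<phi> x = 0"
    using test_functionsE[OF assms(1)] by metis
  have "partial i \<phi> x = 0" if "x \<notin> K" for x
  proof -
    have "(\<phi> has_derivative (\<lambda>h. 0)) (at x)"
      by (rule has_derivative_transform_within_open[of "\<lambda>x. 0" _ _ _ "- K"])
         (use K that compact_imp_closed in auto)
    from frechet_derivative_at[OF this, symmetric] show ?thesis by (simp add: partial_def)
  qed
  with K show ?thesis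
    by (intro test_functionsI[of _ K] smooth_partial) auto
qed

lemma continuous_compact_support_bounded:
  fixes f :: "'a::euclidean_space \<Rightarrow> real"
  assumes "continuous_on UNIV f" "compact K" "\<And>x. x \<notin> K \<Longrightarrow> f x = 0"
  obtains B where "B > 0" "\<And>x. \<bar>f x\<bar> \<le> B"
proof -
  have "bounded (f ` K)"
    by (intro compact_imp_bounded compact_continuous_image continuous_on_subset[OF assms(1)] assms) auto
  then obtain B where "\<And>x. x \<in> K \<Longrightarrow> \<bar>f x\<bar> \<le> B"
    unfolding bounded_iff by auto
  then have "\<bar>f x\<bar> \<le> max B 1" for x
    using assms(3)[of x] by (cases "x \<in> K") (auto simp: le_max_iff_disj)
  then show ?thesis using that[of "max B 1"] by simp
qed

lemma test_function_bounded:
  assumes "\<phi> \<in> test_functions \<Omega>"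
  obtains B where "B > 0" "\<And>x. \<bar>\<phi> x\<bar> \<le> B"
proof -
  obtain K where "smooth \<phi>" "compact K" "\<And>x. x \<notin> K \<Longrightarrow> \<phi> x = 0"
    using test_functionsE[OF assms] by metis
  then show ?thesis
    using continuous_compact_support_bounded[of \<phi> K] smooth_continuous[of \<phi> UNIV] that by blast
qed

section \<open>Growth of absolutely continuous functions\<close>

text \<open>A Lebesgue-type fundamental theorem of calculus in the form of an inequality. A tagged division of \<open>{a..b}\<close>
is chosen fine with respect to a gauge: at tags outside \<open>N\<close> the derivative controls the increment of \<open>g\<close>; the cells
with tags in \<open>N\<close> lie in an open set of small measure, so absolute continuity makes their
contribution small.\<close>

lemma absolutely_continuous_growth:
  fixes g :: "real \<Rightarrow> real"
  assumes ab: "a \<le> b"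
    and ac: "\<And>\<epsilon>. \<epsilon> > 0 \<Longrightarrow> \<exists>\<delta>>0. \<forall>(m::nat) l r.
        (\<forall>i<m. a \<le> l i \<and> l i \<le> r i \<and> r i \<le> b) \<and>
        (\<forall>i<m. \<forall>j<m. i \<noteq> j \<longrightarrow> r i \<le> l j \<or> r j \<le> l i) \<and>
        (\<Sum>i<m. r i - l i) < \<delta> \<longrightarrow>
        (\<Sum>i<m. \<bar>g (r i) - g (l i)\<bar>) < \<epsilon>"
    and N: "negligible N"
    and der: "\<And>x. x \<in> {a..b} - N \<Longrightarrow> \<exists>g'\<ge>c. (g has_real_derivative g') (at x)"
  shows "c * (b - a) \<le> g b - g a"
proof -
  have main: "g b - g a \<ge> (c - \<eta>) * (b - a) - \<eta> - (\<bar>c\<bar> + \<eta>) * \<eta>" if \<eta>: "\<eta> > 0" for \<eta>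
  proof -
    obtain \<delta>0 where \<delta>0: "\<delta>0 > 0" "\<And>(m::nat) l r.
        (\<forall>i<m. a \<le> l i \<and> l i \<le> r i \<and> r i \<le> b) \<Longrightarrow>
        (\<forall>i<m. \<forall>j<m. i \<noteq> j \<longrightarrow> r i \<le> l j \<or> r j \<le> l i) \<Longrightarrow>
        (\<Sum>i<m. r i - l i) < \<delta>0 \<Longrightarrow> (\<Sum>i<m. \<bar>g (r i) - g (l i)\<bar>) < \<eta>"
      using ac[OF \<eta>] by blast
    define \<delta> where "\<delta> = min \<delta>0 \<eta>"
    have \<delta>: "\<delta> > 0" "\<delta> \<le> \<delta>0" "\<delta> \<le> \<eta>" using \<delta>0 \<eta> by (auto simp: \<delta>_def)
    have Nn: "N \<in> null_sets lebesgue" using N by (simp add: negligible_iff_null_sets)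
    obtain T where T: "open T" "N \<subseteq> T" "T - N \<in> lmeasurable" "emeasure lebesgue (T - N) < ennreal \<delta>"
      using sets_lebesgue_outer_open[of N \<delta>] Nn \<delta> by auto
    have TN: "T = (T - N) \<union> N" using T by auto
    have Tm: "T \<in> lmeasurable"
      by (subst TN) (intro fmeasurable.Un T(3), use N negligible_imp_measurable in auto)
    have "emeasure lebesgue T = emeasure lebesgue (T - N)"
      using Nn Tm by (simp add: emeasure_Diff_null_set)
    then have "ennreal (measure lebesgue T) < ennreal \<delta>"
      using T(4) Tm by (simp add: emeasure_eq_measure2)
    then have Tmeas: "measure lebesgue T < \<delta>"
      using \<delta> by (simp add: ennreal_less_iff)
    have "\<exists>d>0. x \<in> {a..b} - N \<longrightarrow> (\<forall>u v. u \<le> x \<and> x \<le> v \<and> {u..v} \<subseteq> ball x d \<longrightarrow>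
              g v - g u \<ge> (c - \<eta>) * (v - u))" for x
    proof (cases "x \<in> {a..b} - N")
      case True
      obtain g' where g': "g' \<ge> c" "(g has_real_derivative g') (at x)" using der[OF True] by blast
      then obtain d where d: "d > 0" "\<And>y. norm (y - x) < d \<Longrightarrow> norm (g y - g x - g' * (y - x)) \<le> \<eta> * norm (y - x)"
        unfolding has_field_derivative_def has_derivative_at_alt using \<eta> by blast
      have "g v - g u \<ge> (c - \<eta>) * (v - u)" if "u \<le> x" "x \<le> v" "{u..v} \<subseteq> ball x d" for u v
      proof -
        have uv: "u \<in> ball x d" "v \<in> ball x d"
          by (rule subsetD[OF that(3)], use that(1,2) in simp)+
        have "g v - g x - g' * (v - x) \<ge> - \<eta> * (v - x)" "g u - g x - g' * (u - x) \<le> \<eta> * (x - u)"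
          using d(2)[of v] d(2)[of u] uv that by (auto simp: dist_real_def abs_minus_commute abs_le_iff)
        moreover have "g' * (v - u) \<ge> c * (v - u)"
          using g'(1) that by (intro mult_right_mono) auto
        ultimately show ?thesis by (simp add: algebra_simps)
      qed
      with d(1) show ?thesis by blast
    qed (auto intro: exI[of _ 1])
    then obtain d where d: "\<And>x. d x > 0" "\<And>x u v. x \<in> {a..b} - N \<Longrightarrow> u \<le> x \<Longrightarrow> x \<le> v \<Longrightarrow> {u..v} \<subseteq> ball x (d x) \<Longrightarrow>
              g v - g u \<ge> (c - \<eta>) * (v - u)"
      by metis
    define \<gamma> where "\<gamma> x = (if x \<in> N then T else ball x (d x))" for x
    have "gauge \<gamma>" using T d(1) by (auto simp: gauge_def \<gamma>_def)
    then obtain p where p: "p tagged_division_of {a..b}" "\<gamma> fine p"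
      using fine_division_exists_real by blast
    have finp: "finite p" using p(1) by (rule tagged_division_of_finite)
    define len :: "real set \<Rightarrow> real" where "len K = Sup K - Inf K" for K
    define inc where "inc K = g (Sup K) - g (Inf K)" for K
    have cell: "\<exists>u v. K = {u..v} \<and> u \<le> x \<and> x \<le> v \<and> a \<le> u \<and> v \<le> b \<and> Sup K = v \<and> Inf K = u"
      if "(x, K) \<in> p" for x K
    proof -
      have "x \<in> K" "K \<subseteq> {a..b}" "\<exists>u v. K = cbox u v"
        using tagged_division_ofD(2,3,4)[OF p(1) that] by auto
      then show ?thesis by fastforce
    qed
    (* Cells of length zero are left out: two distinct non-degenerate cells do not overlap, but
       a degenerate cell may lie inside another one. *)
    define p1 where "p1 = {(x, K) \<in> p. x \<in> N \<and> len K > 0}"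
    have p1p: "p1 \<subseteq> p" by (auto simp: p1_def)
    have fin1: "finite p1" using finp p1p finite_subset by blast
    have tot: "(\<Sum>(x,K)\<in>p. inc K) = g b - g a" "(\<Sum>(x,K)\<in>p. len K) = b - a"
      using additive_tagged_division_1[OF ab p(1), of g] additive_tagged_division_1[OF ab p(1), of "\<lambda>x. x"]
      by (simp_all add: inc_def len_def)
    obtain h where h: "bij_betw h {..<card p1} p1"
      using ex_bij_betw_nat_finite[OF fin1] by (auto simp: atLeast0LessThan)
    define l where "l i = Inf (snd (h i))" for i
    define r where "r i = Sup (snd (h i))" for i
    have hi: "h i \<in> p1" if "i < card p1" for i
      using bij_betwE[OF h] that by auto
    have lr: "a \<le> l i \<and> l i < r i \<and> r i \<le> b \<and> snd (h i) = {l i..r i} \<and> {l i..r i} \<subseteq> T" if "i < card p1" for i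
    proof -
      obtain x K where xK: "h i = (x, K)" by (cases "h i")
      then have "(x, K) \<in> p" "x \<in> N" "len K > 0" using hi[OF that] by (auto simp: p1_def)
      moreover from this have "K \<subseteq> T" using fineD[OF p(2), of x K] by (simp add: \<gamma>_def)
      ultimately show ?thesis using cell[of x K] xK by (auto simp: l_def r_def len_def)
    qed
    have disj: "{l i<..<r i} \<inter> {l j<..<r j} = {}" if "i < card p1" "j < card p1" "i \<noteq> j" for i j
    proof -
      have "h i \<noteq> h j" using h that by (auto simp: bij_betw_def inj_on_def)
      moreover obtain x K y L where "h i = (x, K)" "h j = (y, L)" by (cases "h i", cases "h j") auto
      ultimately have "interior (snd (h i)) \<inter> interior (snd (h j)) = {}"
        using tagged_division_ofD(5)[OF p(1), of x K y L] hi[OF that(1)] hi[OF that(2)] p1p by auto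
      then show ?thesis using lr[OF that(1)] lr[OF that(2)] by (simp add: interior_atLeastAtMost_real)
    qed
    have sep: "r i \<le> l j \<or> r j \<le> l i" if "i < card p1" "j < card p1" "i \<noteq> j" for i j
    proof (rule ccontr)
      assume "\<not> ?thesis"
      then have "max (l i) (l j) < min (r i) (r j)" using lr that by auto
      then obtain z where "max (l i) (l j) < z" "z < min (r i) (r j)" using dense by blast
      then show False using disj[OF that] by auto
    qed
    have sum1: "(\<Sum>(x,K)\<in>p1. F K) = (\<Sum>i<card p1. F (snd (h i)))" for F :: "real set \<Rightarrow> real"
      using sum.reindex_bij_betw[OF h, of "\<lambda>q. F (snd q)"] by (simp add: split_def)
    have len1: "(\<Sum>(x,K)\<in>p1. len K) = (\<Sum>i<card p1. r i - l i)"
      unfolding sum1 by (simp add: len_def l_def r_def)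
    have "(\<Sum>i<card p1. r i - l i) = (\<Sum>i<card p1. measure lebesgue {l i<..<r i})"
      using lr by (intro sum.cong) (auto simp: less_imp_le)
    also have "\<dots> = measure lebesgue (\<Union>i\<in>{..<card p1}. {l i<..<r i})"
      using disj by (intro measure_UNION'[symmetric]) (auto simp: pairwise_def disjnt_def)
    also have "\<dots> \<le> measure lebesgue T"
    proof (intro measure_mono_fmeasurable Tm)
      show "(\<Union>i\<in>{..<card p1}. {l i<..<r i}) \<subseteq> T" using lr by fastforce
    qed auto
    finally have small: "(\<Sum>i<card p1. r i - l i) < \<delta>" using Tmeas by simp
    have "(\<Sum>i<card p1. \<bar>g (r i) - g (l i)\<bar>) < \<eta>"
      by (rule \<delta>0(2)) (use lr sep small \<delta> in \<open>auto simp: less_imp_le\<close>)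
    moreover have "(\<Sum>(x,K)\<in>p1. inc K) \<ge> - (\<Sum>i<card p1. \<bar>g (r i) - g (l i)\<bar>)"
      unfolding sum1 sum_negf[symmetric] by (intro sum_mono) (auto simp: inc_def l_def r_def)
    ultimately have A: "(\<Sum>(x,K)\<in>p1. inc K) \<ge> - \<eta>" by simp
    have B: "(\<Sum>(x,K)\<in>p - p1. inc K) \<ge> (\<Sum>(x,K)\<in>p - p1. (c - \<eta>) * len K)"
    proof (intro sum_mono, clarify)
      fix x K assume xK: "(x, K) \<in> p" "(x, K) \<notin> p1"
      then obtain u v where uv: "K = {u..v}" "u \<le> x" "x \<le> v" "a \<le> u" "v \<le> b" "Sup K = v" "Inf K = u"
        using cell by blast
      show "(c - \<eta>) * len K \<le> inc K"
      proof (cases "x \<in> N")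
        case True
        then have "u = v" using xK uv by (auto simp: p1_def len_def)
        then show ?thesis using uv(6,7) unfolding len_def inc_def by simp
      next
        case False
        then have "K \<subseteq> ball x (d x)" using fineD[OF p(2), of x K] xK by (simp add: \<gamma>_def)
        then show ?thesis
          using d(2)[of x u v] uv False unfolding len_def inc_def by auto
      qed
    qed
    (* the lengths of the cells outside p1 add up to b - a up to the small total length of p1 *)
    have "g b - g a = (\<Sum>(x,K)\<in>p1. inc K) + (\<Sum>(x,K)\<in>p - p1. inc K)"
      using sum.subset_diff[OF p1p finp, of "\<lambda>(x,K). inc K"] tot by simp
    moreover have "(\<Sum>(x,K)\<in>p - p1. len K) = (b - a) - (\<Sum>(x,K)\<in>p1. len K)"
      using sum.subset_diff[OF p1p finp, of "\<lambda>(x,K). len K"] tot by simp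
    then have "(\<Sum>(x,K)\<in>p - p1. (c - \<eta>) * len K) = (c - \<eta>) * ((b - a) - (\<Sum>(x,K)\<in>p1. len K))"
      by (simp add: split_def flip: sum_distrib_left)
    moreover have "(c - \<eta>) * (\<Sum>(x,K)\<in>p1. len K) \<le> (\<bar>c\<bar> + \<eta>) * \<eta>"
    proof -
      have "0 \<le> (\<Sum>(x,K)\<in>p1. len K)" unfolding len1 using lr by (intro sum_nonneg) (auto simp: less_imp_le)
      then show ?thesis
        using small \<delta> \<eta> len1 mult_right_mono[of "c - \<eta>" "\<bar>c\<bar> + \<eta>" "\<Sum>(x,K)\<in>p1. len K"]
          mult_left_mono[of "\<Sum>(x,K)\<in>p1. len K" \<eta> "\<bar>c\<bar> + \<eta>"] by linarith
    qed
    ultimately show ?thesis using A B by (simp add: algebra_simps)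
  qed
  have "((\<lambda>\<eta>. (c - \<eta>) * (b - a) - \<eta> - (\<bar>c\<bar> + \<eta>) * \<eta>) \<longlongrightarrow> (c - 0) * (b - a) - 0 - (\<bar>c\<bar> + 0) * 0) (at_right 0)"
    by (intro tendsto_intros)
  then have "(c - 0) * (b - a) - 0 - (\<bar>c\<bar> + 0) * 0 \<le> g b - g a"
    by (rule tendsto_upperbound) (use main in \<open>auto simp: eventually_at_filter\<close>)
  then show ?thesis by simp
qed

section \<open>Square-integrable functions\<close>

text \<open>The Cauchy-Schwarz inequality for a semidefinite form, applied to \<open>x + t y\<close>.\<close>

lemma nonneg_quadratic_discriminant:
  fixes A B C :: real
  assumes "\<And>t. 0 \<le> A + 2 * t * B + t\<^sup>2 * C" and "0 \<le> C"
  shows "B\<^sup>2 \<le> A * C"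
proof (cases "C = 0")
  case True
  have "B = 0"
  proof (rule ccontr)
    assume "B \<noteq> 0"
    then show False
      (* this t makes the affine function of t equal to -1 *)
      using assms(1)[of "- (A + 1) / (2 * B)"] True by (simp add: field_simps)
  qed
  then show ?thesis using True by simp
next
  case False
  then show ?thesis
    using assms(1)[of "- B / C"] assms(2) by (simp add: field_simps power2_eq_square)
qed

lemma L2_measurable: "f \<in> L2_space \<Omega> \<Longrightarrow> f \<in> borel_measurable (lebesgue_on \<Omega>)"
  by (simp add: L2_space_def)

lemma L2_inner_integrable:
  assumes "f \<in> L2_space \<Omega>" "g \<in> L2_space \<Omega>"
  shows "integrable (lebesgue_on \<Omega>) (\<lambda>x. f x \<bullet> g x)"
proof (rule Bochner_Integration.integrable_bound)
  show "integrable (lebesgue_on \<Omega>) (\<lambda>x. (norm (f x))\<^sup>2 + (norm (g x))\<^sup>2)"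
    using assms by (simp add: L2_space_def)
  show "(\<lambda>x. f x \<bullet> g x) \<in> borel_measurable (lebesgue_on \<Omega>)"
    using assms by (intro borel_measurable_inner L2_measurable)
  have "norm (f x \<bullet> g x) \<le> norm ((norm (f x))\<^sup>2 + (norm (g x))\<^sup>2)" for x
  proof -
    have "\<bar>f x \<bullet> g x\<bar> \<le> norm (f x) * norm (g x)" by (rule Cauchy_Schwarz_ineq2)
    also have "\<dots> \<le> (norm (f x))\<^sup>2 + (norm (g x))\<^sup>2"
      using sum_squares_bound[of "norm (f x)" "norm (g x)"] zero_le_power2[of "norm (f x)"] zero_le_power2[of "norm (g x)"]
      by linarith
    finally show ?thesis by simp
  qed
  then show "AE x in lebesgue_on \<Omega>. norm (f x \<bullet> g x) \<le> norm ((norm (f x))\<^sup>2 + (norm (g x))\<^sup>2)" by simp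
qed

lemma L2_scale:
  assumes "f \<in> L2_space \<Omega>"
  shows "(\<lambda>x. c *\<^sub>R f x) \<in> L2_space \<Omega>"
  using assms by (auto simp: L2_space_def power_mult_distrib)

lemma L2_diff:
  assumes "f \<in> L2_space \<Omega>" "g \<in> L2_space \<Omega>"
  shows "(\<lambda>x. f x - g x) \<in> L2_space \<Omega>"
proof -
  have "integrable (lebesgue_on \<Omega>) (\<lambda>x. f x \<bullet> f x - 2 * (f x \<bullet> g x) + g x \<bullet> g x)"
    using assms by (intro Bochner_Integration.integrable_add Bochner_Integration.integrable_diff
        integrable_mult_right L2_inner_integrable)
  moreover have "(norm (f x - g x))\<^sup>2 = f x \<bullet> f x - 2 * (f x \<bullet> g x) + g x \<bullet> g x" for x
    by (simp add: power2_norm_eq_inner inner_diff_left inner_diff_right inner_commute)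
  ultimately show ?thesis
    using assms by (auto simp: L2_space_def)
qed

lemma L2_component: "g \<in> L2_space \<Omega> \<Longrightarrow> (\<lambda>x. (g x :: real^'m) $ i) \<in> L2_space \<Omega>"
proof -
  assume g: "g \<in> L2_space \<Omega>"
  have m: "(\<lambda>x. g x $ i) \<in> borel_measurable (lebesgue_on \<Omega>)"
    using borel_measurable_inner[OF L2_measurable[OF g] borel_measurable_const[of "axis i 1"]]
    by (simp add: inner_axis)
  have "integrable (lebesgue_on \<Omega>) (\<lambda>x. (norm (g x $ i))\<^sup>2)"
  proof (rule Bochner_Integration.integrable_bound)
    show "integrable (lebesgue_on \<Omega>) (\<lambda>x. (norm (g x))\<^sup>2)"
      using g by (simp add: L2_space_def)
    have "norm ((norm (g x $ i))\<^sup>2) \<le> norm ((norm (g x))\<^sup>2)" for x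
      using power_mono[OF component_le_norm_cart[of "g x" i], of 2] by simp
    then show "AE x in lebesgue_on \<Omega>. norm ((norm (g x $ i))\<^sup>2) \<le> norm ((norm (g x))\<^sup>2)" by simp
  qed (use m in measurable)
  with m show ?thesis by (simp add: L2_space_def)
qed

lemma L2_vector:
  assumes "\<And>i. (\<lambda>x. (g x :: real^'m) $ i) \<in> L2_space \<Omega>"
  shows "g \<in> L2_space \<Omega>"
proof -
  have "g \<in> borel_measurable (lebesgue_on \<Omega>)"
  proof (rule borel_measurable_euclidean_space[THEN iffD2], rule)
    fix b :: "real^'m" assume "b \<in> Basis"
    then obtain i where "b = axis i 1" by (auto simp: Basis_vec_def)
    then show "(\<lambda>x. g x \<bullet> b) \<in> borel_measurable (lebesgue_on \<Omega>)"
      using L2_measurable[OF assms(1)[of i]] by (simp add: inner_axis)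
  qed
  moreover have "(norm (g x))\<^sup>2 = (\<Sum>i\<in>UNIV. (norm (g x $ i))\<^sup>2)" for x
    by (simp only: power2_norm_eq_inner inner_vec_def)
  moreover have "integrable (lebesgue_on \<Omega>) (\<lambda>x. \<Sum>i\<in>UNIV. (norm (g x $ i))\<^sup>2)"
    using assms by (intro Bochner_Integration.integrable_sum) (simp add: L2_space_def)
  ultimately show ?thesis by (simp add: L2_space_def)
qed

lemma L2_inner_commute: "L2_inner \<Omega> f g = L2_inner \<Omega> g f"
  by (simp add: L2_inner_def inner_commute)

lemma L2_inner_diff_left:
  assumes "f \<in> L2_space \<Omega>" "g \<in> L2_space \<Omega>" "h \<in> L2_space \<Omega>"
  shows "L2_inner \<Omega> (\<lambda>x. f x - g x) h = L2_inner \<Omega> f h - L2_inner \<Omega> g h"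
  using assms by (simp add: L2_inner_def inner_diff_left L2_inner_integrable)

lemma L2_inner_diff_right:
  assumes "f \<in> L2_space \<Omega>" "g \<in> L2_space \<Omega>" "h \<in> L2_space \<Omega>"
  shows "L2_inner \<Omega> h (\<lambda>x. f x - g x) = L2_inner \<Omega> h f - L2_inner \<Omega> h g"
  using L2_inner_diff_left[OF assms] by (simp add: L2_inner_commute)

lemma L2_inner_scale_left: "L2_inner \<Omega> (\<lambda>x. c *\<^sub>R f x) h = c * L2_inner \<Omega> f h"
  by (simp add: L2_inner_def)

lemma L2_inner_scale_right: "L2_inner \<Omega> h (\<lambda>x. c *\<^sub>R f x) = c * L2_inner \<Omega> h f"
  by (simp add: L2_inner_def)

lemma L2_inner_cong_AE:
  assumes "AE x in lebesgue_on \<Omega>. f x = f' x" "AE x in lebesgue_on \<Omega>. g x = g' x"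
    and "f \<in> L2_space \<Omega>" "f' \<in> L2_space \<Omega>" "g \<in> L2_space \<Omega>" "g' \<in> L2_space \<Omega>"
  shows "L2_inner \<Omega> f g = L2_inner \<Omega> f' g'"
  unfolding L2_inner_def
  by (rule integral_cong_AE) (use assms L2_measurable in \<open>auto intro!: borel_measurable_inner\<close>)

lemma L2_inner_self_nonneg: "0 \<le> L2_inner \<Omega> f f"
  by (simp add: L2_inner_def)

lemma L2_norm_nonneg: "0 \<le> L2_norm \<Omega> f"
  by (simp add: L2_norm_def L2_inner_self_nonneg)

lemma L2_norm_power2: "(L2_norm \<Omega> f)\<^sup>2 = L2_inner \<Omega> f f"
  by (simp add: L2_norm_def L2_inner_self_nonneg)

lemma L2_norm_scale: "L2_norm \<Omega> (\<lambda>x. c *\<^sub>R f x) = \<bar>c\<bar> * L2_norm \<Omega> f"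
  by (simp add: L2_norm_def L2_inner_scale_left L2_inner_scale_right real_sqrt_mult
      flip: mult.assoc power2_eq_square)

lemma L2_Cauchy_Schwarz:
  assumes "f \<in> L2_space \<Omega>" "g \<in> L2_space \<Omega>"
  shows "\<bar>L2_inner \<Omega> f g\<bar> \<le> L2_norm \<Omega> f * L2_norm \<Omega> g"
proof -
  have q: "0 \<le> L2_inner \<Omega> f f + 2 * t * L2_inner \<Omega> f g + t\<^sup>2 * L2_inner \<Omega> g g" for t
  proof -
    note mem = assms L2_scale[OF assms(2), of "- t"]
    have "L2_inner \<Omega> (\<lambda>x. f x - (- t) *\<^sub>R g x) (\<lambda>x. f x - (- t) *\<^sub>R g x)
        = L2_inner \<Omega> f f + 2 * t * L2_inner \<Omega> f g + t\<^sup>2 * L2_inner \<Omega> g g"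
      using mem L2_diff[OF mem(1,3)]
      by (simp only: L2_inner_diff_left L2_inner_diff_right L2_inner_scale_left L2_inner_scale_right
          L2_inner_commute[of \<Omega> g f]) (simp add: algebra_simps power2_eq_square)
    then show ?thesis using L2_inner_self_nonneg by metis
  qed
  then have "(L2_inner \<Omega> f g)\<^sup>2 \<le> L2_inner \<Omega> f f * L2_inner \<Omega> g g"
    by (intro nonneg_quadratic_discriminant L2_inner_self_nonneg)
  from real_sqrt_le_mono[OF this] show ?thesis
    by (simp add: L2_norm_def real_sqrt_mult)
qed

lemma L2_norm_diff_triangle:
  assumes "f \<in> L2_space \<Omega>" "g \<in> L2_space \<Omega>"
  shows "L2_norm \<Omega> (\<lambda>x. f x - g x) \<le> L2_norm \<Omega> f + L2_norm \<Omega> g"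
proof -
  have "(L2_norm \<Omega> (\<lambda>x. f x - g x))\<^sup>2 = (L2_norm \<Omega> f)\<^sup>2 - 2 * L2_inner \<Omega> f g + (L2_norm \<Omega> g)\<^sup>2"
    using assms L2_diff[OF assms]
    by (simp add: L2_norm_power2 L2_inner_diff_left L2_inner_diff_right L2_inner_commute[of \<Omega> g f])
  also have "\<dots> \<le> (L2_norm \<Omega> f + L2_norm \<Omega> g)\<^sup>2"
    using L2_Cauchy_Schwarz[OF assms] by (simp add: power2_sum abs_le_iff)
  finally show ?thesis
    by (rule power2_le_imp_le) (intro add_nonneg_nonneg L2_norm_nonneg)
qed

lemma L2_norm_cong_AE:
  assumes "AE x in lebesgue_on \<Omega>. f x = g x" "f \<in> L2_space \<Omega>" "g \<in> L2_space \<Omega>"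
  shows "L2_norm \<Omega> f = L2_norm \<Omega> g"
  using L2_inner_cong_AE[OF assms(1,1)] assms by (simp add: L2_norm_def)

lemma L2_tendsto_inner:
  assumes "\<And>k. f k \<in> L2_space \<Omega>" "g \<in> L2_space \<Omega>" "h \<in> L2_space \<Omega>"
    and "(\<lambda>k. L2_norm \<Omega> (\<lambda>x. f k x - g x)) \<longlonglongrightarrow> 0"
  shows "(\<lambda>k. L2_inner \<Omega> h (f k)) \<longlonglongrightarrow> L2_inner \<Omega> h g"
proof -
  have "(\<lambda>k. L2_inner \<Omega> h (f k) - L2_inner \<Omega> h g) \<longlonglongrightarrow> 0"
  proof (rule Lim_null_comparison)
    show "\<forall>\<^sub>F k in sequentially. norm (L2_inner \<Omega> h (f k) - L2_inner \<Omega> h g)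
        \<le> L2_norm \<Omega> h * L2_norm \<Omega> (\<lambda>x. f k x - g x)"
      using L2_Cauchy_Schwarz[OF assms(3) L2_diff[OF assms(1,2)]] assms
      by (simp add: L2_inner_diff_right)
    show "(\<lambda>k. L2_norm \<Omega> h * L2_norm \<Omega> (\<lambda>x. f k x - g x)) \<longlonglongrightarrow> 0"
      using tendsto_mult_right_zero[OF assms(4)] .
  qed
  then show ?thesis by (rule Lim_null[THEN iffD2])
qed

lemma L2_norm_mono:
  assumes "f \<in> L2_space \<Omega>" "g \<in> L2_space \<Omega>" and "\<And>x. x \<in> \<Omega> \<Longrightarrow> norm (f x) \<le> norm (g x)"
  shows "L2_norm \<Omega> f \<le> L2_norm \<Omega> g"
proof -
  have "L2_inner \<Omega> f f \<le> L2_inner \<Omega> g g"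
    unfolding L2_inner_def
    by (intro integral_mono L2_inner_integrable assms(1,2))
       (use assms(3) in \<open>simp add: power_mono flip: power2_norm_eq_inner\<close>)
  then show ?thesis by (simp add: L2_norm_def)
qed

lemma bounded_L2:
  assumes "open \<Omega>" "bounded \<Omega>" and "f \<in> borel_measurable borel" and "\<And>x. \<bar>f x :: real\<bar> \<le> B"
  shows "f \<in> L2_space \<Omega>"
proof -
  have fin: "finite_measure (lebesgue_on \<Omega>)"
    using assms bounded_set_imp_lmeasurable[of \<Omega>] by (intro finite_measure_lebesgue_on) auto
  have m: "f \<in> borel_measurable (lebesgue_on \<Omega>)"
    using assms(3) by (intro measurable_restrict_space1 measurable_completion) simp
  have "(f x)\<^sup>2 \<le> B\<^sup>2" for x using assms(4)[of x] by (simp add: abs_le_square_iff[symmetric])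
  then have "integrable (lebesgue_on \<Omega>) (\<lambda>x. (norm (f x))\<^sup>2)"
    using m by (intro finite_measure.integrable_const_bound[OF fin, of _ "B\<^sup>2"]) auto
  with m show ?thesis by (simp add: L2_space_def)
qed

lemma L2_integrable:
  assumes "open \<Omega>" "bounded \<Omega>" and "f \<in> L2_space \<Omega>"
  shows "integrable (lebesgue_on \<Omega>) (f :: _ \<Rightarrow> real)"
  using L2_inner_integrable[OF assms(3) bounded_L2[OF assms(1,2), of "\<lambda>x. 1" 1]] by simp

lemma test_functions_L2:
  assumes "open \<Omega>" "bounded \<Omega>" "\<phi> \<in> test_functions \<Omega>"
  shows "\<phi> \<in> L2_space \<Omega>"
proof -
  obtain B where "\<And>x. \<bar>\<phi> x\<bar> \<le> B" using test_function_bounded[OF assms(3)] by blast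
  moreover have "\<phi> \<in> borel_measurable borel"
    using assms(3) smooth_continuous by (intro borel_measurable_continuous_onI) (auto simp: test_functions_def)
  ultimately show ?thesis using bounded_L2[OF assms(1,2)] by blast
qed

section \<open>The fundamental lemma of the calculus of variations\<close>

context
  fixes \<Omega> :: "(real^'n) set"
  assumes dom: "open \<Omega>" "bounded \<Omega>"
begin

lemma Omega_sets: "\<Omega> \<in> sets lebesgue" "\<Omega> \<inter> space lebesgue \<in> sets lebesgue"
  using dom by auto

text \<open>By dominated convergence along the bumps, the integral of \<open>g\<close> over every box inside \<open>\<Omega>\<close> vanishes, and almost
everywhere \<open>g\<close> is the limit of its averages over shrinking boxes.\<close>

lemma orthogonal_to_test_functions_imp_zero:
  assumes g: "g \<in> L2_space \<Omega>"
    and orth: "\<And>\<phi>. \<phi> \<in> test_functions \<Omega> \<Longrightarrow> (LINT x|lebesgue_on \<Omega>. g x * \<phi> x) = (0::real)"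
  shows "AE x in lebesgue_on \<Omega>. g x = 0"
proof -
  define f where "f x = indicator \<Omega> x *\<^sub>R g x" for x
  have f: "integrable lebesgue f"
    using L2_integrable[OF dom g] integrable_restrict_space[OF Omega_sets(2), of g]
    by (simp add: f_def[abs_def])
  then have fI: "f absolutely_integrable_on S" if "S \<in> sets lebesgue" for S
    using integrable_mult_indicator[OF that f] by (simp add: set_integrable_def)
  have box0: "integral (cbox a b) f = 0" if ab: "cbox a b \<subseteq> \<Omega>" for a b
  proof -
    have "(\<lambda>m. LINT x|lebesgue_on \<Omega>. g x * box_bump a b m x)
        \<longlonglongrightarrow> (LINT x|lebesgue_on \<Omega>. g x * indicator (box a b) x)"
    proof (rule integral_dominated_convergence)
      show "integrable (lebesgue_on \<Omega>) (\<lambda>x. \<bar>g x\<bar>)"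
        using L2_integrable[OF dom g] by simp
      show "AE x in lebesgue_on \<Omega>. (\<lambda>m. g x * box_bump a b m x) \<longlonglongrightarrow> g x * indicator (box a b) x"
        by (intro AE_I2 tendsto_intros box_bump_tendsto)
      have "norm (g x * box_bump a b m x) \<le> \<bar>g x\<bar>" for m x
        using box_bump_bound[of a b m x] by (simp add: abs_mult mult_left_le)
      then show "AE x in lebesgue_on \<Omega>. norm (g x * box_bump a b m x) \<le> \<bar>g x\<bar>" for m by simp
      show "(\<lambda>x. g x * box_bump a b m x) \<in> borel_measurable (lebesgue_on \<Omega>)" for m
        using L2_measurable[OF g] L2_measurable[OF test_functions_L2[OF dom box_bump_test[OF ab]]]
        by (intro borel_measurable_times)
      have "indicator (box a b) \<in> borel_measurable (lebesgue_on \<Omega>)"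
        by (intro measurable_restrict_space1 borel_measurable_indicator) simp
      then show "(\<lambda>x. g x * indicator (box a b) x) \<in> borel_measurable (lebesgue_on \<Omega>)"
        using L2_measurable[OF g] by (intro borel_measurable_times)
    qed
    then have "(LINT x|lebesgue_on \<Omega>. g x * indicator (box a b) x) = 0"
      using orth[OF box_bump_test[OF ab]] by (simp add: LIMSEQ_const_iff)
    moreover have "(LINT x|lebesgue_on \<Omega>. g x * indicator (box a b) x) = (LINT x:box a b|lebesgue. f x)"
      unfolding set_lebesgue_integral_def integral_restrict_space[OF Omega_sets(2)]
      by (rule Bochner_Integration.integral_cong) (auto simp: f_def split: split_indicator)
    moreover have "(LINT x:box a b|lebesgue. f x) = integral (box a b) f"
      by (rule set_lebesgue_integral_eq_integral(2)) (simp add: fI)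
    ultimately show ?thesis by (simp add: integral_open_interval)
  qed
  have "f integrable_on cbox a b" for a b
    using fI[of "cbox a b"] by (simp add: set_lebesgue_integral_eq_integral(1))
  then obtain N where N: "negligible N"
    "\<And>x e. \<lbrakk>x \<notin> N; 0 < e\<rbrakk> \<Longrightarrow> \<exists>d>0. \<forall>h. 0 < h \<and> h < d \<longrightarrow>
        norm (integral (cbox x (x + h *\<^sub>R One)) f /\<^sub>R h ^ DIM(real^'n) - f x) < e"
    using integrable_ccontinuous_explicit[of f] by blast
  have "g x = 0" if x: "x \<in> \<Omega>" "x \<notin> N" for x
  proof (rule ccontr)
    assume "g x \<noteq> 0"
    then obtain d where d: "d > 0" "\<And>h. 0 < h \<Longrightarrow> h < d \<Longrightarrow>
        norm (integral (cbox x (x + h *\<^sub>R One)) f /\<^sub>R h ^ DIM(real^'n) - f x) < \<bar>g x\<bar>"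
      using N(2)[OF x(2), of "\<bar>g x\<bar>"] by auto
    obtain r where r: "r > 0" "ball x r \<subseteq> \<Omega>" using dom x(1) open_contains_ball by blast
    define D where "D = real DIM(real^'n)"
    have D: "D > 0" by (simp add: D_def)
    (* small enough for the differentiation theorem and for the box to stay in the ball of radius r *)
    define h where "h = min (d / 2) (r / (2 * D))"
    have h: "h > 0" "h < d" "h * D < r" using d r D by (auto simp: h_def min_def field_simps)
    have "cbox x (x + h *\<^sub>R One) \<subseteq> ball x r"
    proof
      fix y assume y: "y \<in> cbox x (x + h *\<^sub>R One)"
      have "norm (y - x) \<le> (\<Sum>b\<in>Basis. \<bar>(y - x) \<bullet> b\<bar>)" by (rule norm_le_l1)
      also have "\<dots> \<le> (\<Sum>b\<in>(Basis :: (real^'n) set). h)"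
      proof (rule sum_mono)
        fix b :: "real^'n" assume b: "b \<in> Basis"
        then have "x \<bullet> b \<le> y \<bullet> b" "y \<bullet> b \<le> x \<bullet> b + h"
          using y by (auto simp: mem_box inner_add_left)
        then show "\<bar>(y - x) \<bullet> b\<bar> \<le> h" by (simp add: inner_diff_left)
      qed
      also have "\<dots> = h * D" by (simp add: D_def)
      finally show "y \<in> ball x r" using h(3) by (simp add: dist_norm norm_minus_commute)
    qed
    then have "integral (cbox x (x + h *\<^sub>R One)) f = 0" using box0 r(2) by blast
    then show False using d(2)[OF h(1,2)] x(1) by (simp add: f_def)
  qed
  moreover have "AE x in lebesgue. x \<notin> N"
    using N(1) by (simp add: negligible_iff_null_sets AE_not_in)
  ultimately show ?thesis
    unfolding AE_restrict_space_iff[OF Omega_sets(2)] by (auto elim: eventually_mono)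
qed

lemma integral_test_function_lborel:
  assumes "\<phi> \<in> test_functions \<Omega>"
  shows "(LINT x|lebesgue_on \<Omega>. \<phi> x) = (LINT x|lborel. \<phi> x)"
proof -
  obtain K where K: "smooth \<phi>" "K \<subseteq> \<Omega>" "\<And>x. x \<notin> K \<Longrightarrow> \<phi> x = 0"
    using test_functionsE[OF assms] by metis
  have "(LINT x|lebesgue_on \<Omega>. \<phi> x) = (LINT x|lebesgue. \<phi> x)"
    unfolding integral_restrict_space[OF Omega_sets(2)]
    by (rule Bochner_Integration.integral_cong) (use K in \<open>auto split: split_indicator\<close>)
  also have "\<dots> = (LINT x|lborel. \<phi> x)"
    using K(1) by (intro integral_completion) (simp add: borel_measurable_continuous_onI smooth_continuous)
  finally show ?thesis .
qed

end

section \<open>Integration by parts and weak gradients\<close>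

lemma smooth_has_directional_derivative:
  assumes "smooth \<phi>"
  shows "((\<lambda>t. \<phi> (x + t *\<^sub>R axis i 1)) has_real_derivative partial i \<phi> (x + t *\<^sub>R axis i 1)) (at t)"
proof -
  have "((\<lambda>t. x + t *\<^sub>R axis i 1) has_derivative (\<lambda>h. h *\<^sub>R axis i 1)) (at t)"
    by (auto intro!: derivative_eq_intros)
  from has_derivative_compose[OF this smooth_has_derivative[OF assms]]
  have "((\<lambda>t. \<phi> (x + t *\<^sub>R axis i 1)) has_derivative
      (\<lambda>h. frechet_derivative \<phi> (at (x + t *\<^sub>R axis i 1)) (h *\<^sub>R axis i 1))) (at t)" .
  moreover have "frechet_derivative \<phi> (at y) (h *\<^sub>R axis i 1) = partial i \<phi> y * h" for y h
    using linear_scale[OF has_derivative_linear[OF smooth_has_derivative[OF assms]]]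
    by (simp add: partial_def mult.commute)
  ultimately show ?thesis by (simp add: has_field_derivative_def)
qed

text \<open>The difference quotients of \<open>\<phi>\<close> have integral \<open>0\<close> by translation invariance of Lebesgue measure, and
converge boundedly, with supports in a fixed ball, to the partial derivative.\<close>

lemma integral_partial_eq_0:
  fixes \<phi> :: "real^'n \<Rightarrow> real"
  assumes \<phi>: "smooth \<phi>" and K: "compact K" "\<And>x. x \<notin> K \<Longrightarrow> \<phi> x = 0"
  shows "(LINT x|lborel. partial i \<phi> x) = 0"
proof -
  let ?e = "axis i 1 :: real^'n"
  define s where "s m x = (\<phi> (x + inverse (real (Suc m)) *\<^sub>R ?e) - \<phi> x) / inverse (real (Suc m))" for m x
  have cont: "continuous_on UNIV \<phi>" using \<phi> by (rule smooth_continuous)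
  have meas: "\<phi> \<in> borel_measurable borel" using cont by (rule borel_measurable_continuous_onI)
  have "integrable lborel (\<lambda>x. indicator K x *\<^sub>R \<phi> x)"
    by (rule borel_integrable_compact[OF K(1) continuous_on_subset[OF cont subset_UNIV]])
  moreover have "indicator K x *\<^sub>R \<phi> x = \<phi> x" for x using K(2)[of x] by (auto split: split_indicator)
  ultimately have int: "integrable lborel \<phi>" by (simp only:)
  have shift: "integrable lborel (\<lambda>x. \<phi> (x + c)) \<and> (LINT x|lborel. \<phi> (x + c)) = (LINT x|lborel. \<phi> x)" for c
  proof -
    have "integrable (distr lborel borel ((+) c)) \<phi>" using int by (simp add: lborel_distr_plus)
    then have "integrable lborel (\<lambda>x. \<phi> (c + x))"
      by (subst (asm) integrable_distr_eq) (use meas in auto)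
    moreover have "integral\<^sup>L (distr lborel borel ((+) c)) \<phi> = (LINT x|lborel. \<phi> (c + x))"
      by (subst integral_distr) (use meas in auto)
    ultimately show ?thesis by (simp add: lborel_distr_plus add.commute)
  qed
  have s0: "(LINT x|lborel. s m x) = 0" for m
    unfolding s_def using shift int by simp
  obtain B where B: "\<And>x. \<bar>partial i \<phi> x\<bar> \<le> B"
  proof -
    have "\<phi> \<in> test_functions UNIV" using \<phi> K by (intro test_functionsI[of _ K]) auto
    from test_function_bounded[OF test_functions_partial[OF this]] that show thesis by metis
  qed
  obtain R where R: "K \<subseteq> ball 0 R" using compact_imp_bounded[OF K(1)] bounded_subset_ballD by blast
  have "(\<lambda>m. LINT x|lborel. s m x) \<longlonglongrightarrow> (LINT x|lborel. partial i \<phi> x)"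
  proof (rule integral_dominated_convergence)
    (* the steps are at most 1, hence the supports grow by at most 1 *)
    have "emeasure lborel (cball 0 (R + 1) :: (real^'n) set) < \<infinity>"
      by (intro emeasure_bounded_finite) simp
    then show "integrable lborel (\<lambda>x. B * indicator (cball 0 (R + 1) :: (real^'n) set) x)"
      by (intro integrable_mult_right integrable_real_indicator) auto
    show "AE x in lborel. (\<lambda>m. s m x) \<longlonglongrightarrow> partial i \<phi> x"
    proof (rule AE_I2)
      fix x
      have "((\<lambda>h. (\<phi> (x + h *\<^sub>R ?e) - \<phi> x) / h) \<longlongrightarrow> partial i \<phi> x) (at 0)"
        using smooth_has_directional_derivative[OF \<phi>, of x i 0] by (simp add: has_field_derivative_iff)
      moreover have "filterlim (\<lambda>m. inverse (real (Suc m))) (at 0) sequentially"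
        unfolding filterlim_at using LIMSEQ_inverse_real_of_nat by auto
      ultimately show "(\<lambda>m. s m x) \<longlonglongrightarrow> partial i \<phi> x"
        unfolding s_def by (rule filterlim_compose)
    qed
    show "AE x in lborel. norm (s m x) \<le> B * indicator (cball 0 (R + 1)) x" for m
    proof (rule AE_I2)
      fix x
      let ?h = "inverse (real (Suc m))"
      have h: "0 < ?h" "?h \<le> 1" by (simp_all add: divide_simps)
      show "norm (s m x) \<le> B * indicator (cball 0 (R + 1)) x"
      proof (cases "x \<in> cball 0 (R + 1)")
        case True
        obtain z where "\<phi> (x + ?h *\<^sub>R ?e) - \<phi> (x + 0 *\<^sub>R ?e) = (?h - 0) * partial i \<phi> (x + z *\<^sub>R ?e)"
          using MVT2[OF h(1) smooth_has_directional_derivative[OF \<phi>]] by metis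
        then have "s m x = partial i \<phi> (x + z *\<^sub>R ?e)" using h by (simp add: s_def)
        then show ?thesis using True B by simp
      next
        case False
        have "norm x \<le> norm (x + ?h *\<^sub>R ?e) + norm (?h *\<^sub>R ?e)"
          using norm_triangle_ineq4[of "x + ?h *\<^sub>R ?e" "?h *\<^sub>R ?e"] by simp
        moreover have "norm (?h *\<^sub>R ?e) \<le> 1" using h by simp
        ultimately have "x + ?h *\<^sub>R ?e \<notin> ball 0 R" "x \<notin> ball 0 R" using False by auto
        then have "\<phi> (x + ?h *\<^sub>R ?e) = 0" "\<phi> x = 0" using R K(2) by blast+
        then show ?thesis using False by (simp add: s_def)
      qed
    qed
    show "partial i \<phi> \<in> borel_measurable lborel"
      by (simp add: borel_measurable_continuous_onI smooth_continuous smooth_partial \<phi>)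
    show "s m \<in> borel_measurable lborel" for m
      unfolding s_def using borel_measurable_integrable int shift by (intro borel_measurable_divide borel_measurable_diff) auto
  qed
  then show ?thesis by (simp add: s0 LIMSEQ_const_iff)
qed

definition classical_gradient :: "(real^'n \<Rightarrow> real) \<Rightarrow> real^'n \<Rightarrow> real^'n" where
  "classical_gradient \<phi> x = (\<chi> i. partial i \<phi> x)"

lemma grad_weak_gradient: "u \<in> H1_space \<Omega> \<Longrightarrow> weak_gradient \<Omega> u (grad \<Omega> u)"
proof -
  assume "u \<in> H1_space \<Omega>"
  then have "\<exists>g. weak_gradient \<Omega> u g" by (simp add: H1_space_def)
  then show ?thesis unfolding grad_def by (rule someI_ex)
qed

lemma H1_L2: "u \<in> H1_space \<Omega> \<Longrightarrow> u \<in> L2_space \<Omega>"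
  by (simp add: H1_space_def)

lemma grad_L2: "u \<in> H1_space \<Omega> \<Longrightarrow> grad \<Omega> u \<in> L2_space \<Omega>"
  by (drule grad_weak_gradient) (simp add: weak_gradient_def)

lemma H1_spaceI: "u \<in> L2_space \<Omega> \<Longrightarrow> weak_gradient \<Omega> u g \<Longrightarrow> u \<in> H1_space \<Omega>"
  by (auto simp: H1_space_def)

lemma weak_gradient_scale:
  assumes "weak_gradient \<Omega> u g"
  shows "weak_gradient \<Omega> (\<lambda>x. c * u x) (\<lambda>x. c *\<^sub>R g x)"
  using assms L2_scale[of g \<Omega> c] by (simp add: weak_gradient_def mult.assoc)

lemma H01_H1: "u \<in> H01_space \<Omega> \<Longrightarrow> u \<in> H1_space \<Omega>"
  by (simp add: H01_space_def)

lemma H01_L2: "u \<in> H01_space \<Omega> \<Longrightarrow> u \<in> L2_space \<Omega>"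
  by (simp add: H01_H1 H1_L2)

lemma H01_grad_L2: "u \<in> H01_space \<Omega> \<Longrightarrow> grad \<Omega> u \<in> L2_space \<Omega>"
  by (simp add: H01_H1 grad_L2)

context
  fixes \<Omega> :: "(real^'n) set"
  assumes dom: "open \<Omega>" "bounded \<Omega>"
begin

lemmas test_L2 = test_functions_L2[OF dom]

text \<open>The divergence form: the integral of the derivative of \<open>f \<phi>\<close> vanishes.\<close>

lemma integral_mult_partial:
  assumes \<phi>: "\<phi> \<in> test_functions \<Omega>" and f: "smooth f"
  shows "(LINT x|lebesgue_on \<Omega>. f x * partial i \<phi> x) = - (LINT x|lebesgue_on \<Omega>. partial i f x * \<phi> x)"
proof -
  let ?\<psi> = "\<lambda>x. f x * \<phi> x"
  have sm: "smooth \<phi>" using \<phi> by (simp add: test_functions_def)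
  have \<psi>: "?\<psi> \<in> test_functions \<Omega>" using test_functions_mult[OF \<phi> f] .
  obtain K where "smooth ?\<psi>" "compact K" "\<And>x. x \<notin> K \<Longrightarrow> ?\<psi> x = 0"
    using test_functionsE[OF \<psi>] by metis
  from integral_partial_eq_0[OF this] have "(LINT x|lebesgue_on \<Omega>. partial i ?\<psi> x) = 0"
    by (simp add: integral_test_function_lborel[OF dom test_functions_partial[OF \<psi>]])
  moreover have "integrable (lebesgue_on \<Omega>) (\<lambda>x. f x * partial i \<phi> x)"
    by (rule L2_integrable[OF dom test_L2[OF test_functions_mult[OF test_functions_partial[OF \<phi>] f]]])
  moreover have "integrable (lebesgue_on \<Omega>) (\<lambda>x. partial i f x * \<phi> x)"
    by (rule L2_integrable[OF dom test_L2[OF test_functions_mult[OF \<phi> smooth_partial[OF f]]]])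
  ultimately show ?thesis by (simp add: partial_mult[OF f sm])
qed

lemma weak_gradient_unique:
  assumes "weak_gradient \<Omega> u g" "weak_gradient \<Omega> u g'"
  shows "AE x in lebesgue_on \<Omega>. g x = g' x"
proof -
  have L2: "g \<in> L2_space \<Omega>" "g' \<in> L2_space \<Omega>" using assms by (auto simp: weak_gradient_def)
  have "AE x in lebesgue_on \<Omega>. g x $ i - g' x $ i = 0" for i
  proof (rule orthogonal_to_test_functions_imp_zero[OF dom])
    show "(\<lambda>x. g x $ i - g' x $ i) \<in> L2_space \<Omega>" by (intro L2_diff L2_component L2)
    fix \<phi> assume \<phi>: "\<phi> \<in> test_functions \<Omega>"
    have "integrable (lebesgue_on \<Omega>) (\<lambda>x. g x $ i * \<phi> x)" "integrable (lebesgue_on \<Omega>) (\<lambda>x. g' x $ i * \<phi> x)"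
      using L2_inner_integrable[OF L2_component[OF L2(1)] test_L2[OF \<phi>]]
        L2_inner_integrable[OF L2_component[OF L2(2)] test_L2[OF \<phi>]] by simp_all
    then show "(LINT x|lebesgue_on \<Omega>. (g x $ i - g' x $ i) * \<phi> x) = 0"
      using assms \<phi> by (simp add: weak_gradient_def left_diff_distrib)
  qed
  then have "AE x in lebesgue_on \<Omega>. \<forall>i. g x $ i - g' x $ i = 0"
    by (intro AE_all_countable[THEN iffD2]) simp
  then show ?thesis by (auto simp: vec_eq_iff)
qed

lemma grad_AE_eq:
  assumes "weak_gradient \<Omega> u g"
  shows "AE x in lebesgue_on \<Omega>. grad \<Omega> u x = g x"
  by (rule weak_gradient_unique[OF _ assms]) (metis assms grad_def someI)

lemma L2_mult_test_integrable:
  assumes "u \<in> L2_space \<Omega>" "\<phi> \<in> test_functions \<Omega>"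
  shows "integrable (lebesgue_on \<Omega>) (\<lambda>x. u x * \<phi> x :: real)"
  using L2_inner_integrable[OF assms(1) test_L2[OF assms(2)]] by simp

lemma weak_gradient_diff:
  assumes "u \<in> L2_space \<Omega>" "v \<in> L2_space \<Omega>" "weak_gradient \<Omega> u g" "weak_gradient \<Omega> v h"
  shows "weak_gradient \<Omega> (\<lambda>x. u x - v x) (\<lambda>x. g x - h x)"
  unfolding weak_gradient_def
proof (intro conjI ballI allI)
  have L2: "g \<in> L2_space \<Omega>" "h \<in> L2_space \<Omega>" using assms by (auto simp: weak_gradient_def)
  then show "(\<lambda>x. g x - h x) \<in> L2_space \<Omega>" by (rule L2_diff)
  fix \<phi> i assume \<phi>: "\<phi> \<in> test_functions \<Omega>"
  show "(LINT x|lebesgue_on \<Omega>. (u x - v x) * partial i \<phi> x) = - (LINT x|lebesgue_on \<Omega>. (g x - h x) $ i * \<phi> x)"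
    using assms(3,4) \<phi> L2_mult_test_integrable[OF assms(1) test_functions_partial[OF \<phi>]]
      L2_mult_test_integrable[OF assms(2) test_functions_partial[OF \<phi>]]
      L2_mult_test_integrable[OF L2_component[OF L2(1)] \<phi>] L2_mult_test_integrable[OF L2_component[OF L2(2)] \<phi>]
    by (simp add: weak_gradient_def left_diff_distrib)
qed

lemma weak_gradient_classical:
  assumes "\<phi> \<in> test_functions \<Omega>"
  shows "weak_gradient \<Omega> \<phi> (classical_gradient \<phi>)"
  unfolding weak_gradient_def
proof (intro conjI ballI allI)
  show "classical_gradient \<phi> \<in> L2_space \<Omega>"
    using assms by (intro L2_vector) (simp add: classical_gradient_def test_L2 test_functions_partial)
  fix \<psi> i assume "\<psi> \<in> test_functions \<Omega>"
  then show "(LINT x|lebesgue_on \<Omega>. \<phi> x * partial i \<psi> x) = - (LINT x|lebesgue_on \<Omega>. classical_gradient \<phi> x $ i * \<psi> x)"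
    using integral_mult_partial[of \<psi> \<phi> i] assms by (simp add: classical_gradient_def test_functions_def)
qed

lemma test_functions_H1: "\<phi> \<in> test_functions \<Omega> \<Longrightarrow> \<phi> \<in> H1_space \<Omega>"
  by (rule H1_spaceI[OF test_L2 weak_gradient_classical])

lemma classical_gradient_L2: "\<phi> \<in> test_functions \<Omega> \<Longrightarrow> classical_gradient \<phi> \<in> L2_space \<Omega>"
  using weak_gradient_classical by (simp add: weak_gradient_def)

lemma H1_diff:
  assumes "u \<in> H1_space \<Omega>" "v \<in> H1_space \<Omega>"
  shows "(\<lambda>x. u x - v x) \<in> H1_space \<Omega>"
    and "AE x in lebesgue_on \<Omega>. grad \<Omega> (\<lambda>x. u x - v x) x = grad \<Omega> u x - grad \<Omega> v x"
  using weak_gradient_diff[OF H1_L2 H1_L2 grad_weak_gradient grad_weak_gradient, OF assms assms]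
    H1_spaceI[OF L2_diff[OF H1_L2 H1_L2, OF assms]] grad_AE_eq by blast+

lemma H1_scale:
  assumes "u \<in> H1_space \<Omega>"
  shows "(\<lambda>x. c * u x) \<in> H1_space \<Omega>"
    and "AE x in lebesgue_on \<Omega>. grad \<Omega> (\<lambda>x. c * u x) x = c *\<^sub>R grad \<Omega> u x"
  using weak_gradient_scale[OF grad_weak_gradient[OF assms], of c]
    H1_spaceI[OF L2_scale[OF H1_L2[OF assms], of c]] grad_AE_eq by auto

text \<open>An equality of functions and not just almost everywhere: both gradients are the same choice from the same set of
weak gradients.\<close>

lemma grad_cong_AE:
  assumes "u \<in> L2_space \<Omega>" "v \<in> L2_space \<Omega>" "AE x in lebesgue_on \<Omega>. u x = v x"
  shows "grad \<Omega> u = grad \<Omega> v"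
proof -
  have "(LINT x|lebesgue_on \<Omega>. u x * partial i \<phi> x) = (LINT x|lebesgue_on \<Omega>. v x * partial i \<phi> x)"
    if "\<phi> \<in> test_functions \<Omega>" for \<phi> i
    using assms borel_measurable_integrable[OF L2_mult_test_integrable[OF _ test_functions_partial[OF that]]]
    by (intro integral_cong_AE) auto
  then have "weak_gradient \<Omega> u = weak_gradient \<Omega> v"
    by (auto simp: weak_gradient_def fun_eq_iff)
  then show ?thesis by (simp add: grad_def)
qed

section \<open>The space of functions vanishing on the boundary\<close>

text \<open>The defining convergence in the \<open>H\<^sup>1\<close> norm involves the chosen gradient of the difference \<open>\<phi>\<^sub>k - u\<close>. By
uniqueness this is the classical gradient of \<open>\<phi>\<^sub>k\<close> minus the chosen gradient of \<open>u\<close>, which is the form in which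
limits can be taken.\<close>

lemma H01_space_iff:
  "u \<in> H01_space \<Omega> \<longleftrightarrow> u \<in> H1_space \<Omega> \<and> (\<exists>\<phi>. (\<forall>k::nat. \<phi> k \<in> test_functions \<Omega>) \<and>
     (\<lambda>k. L2_norm \<Omega> (\<lambda>x. \<phi> k x - u x)) \<longlonglongrightarrow> 0 \<and>
     (\<lambda>k. L2_norm \<Omega> (\<lambda>x. classical_gradient (\<phi> k) x - grad \<Omega> u x)) \<longlonglongrightarrow> 0)"
proof -
  have key: "((\<lambda>k. H1_norm \<Omega> (\<lambda>x. \<phi> k x - u x)) \<longlonglongrightarrow> 0) \<longleftrightarrow>
     ((\<lambda>k. L2_norm \<Omega> (\<lambda>x. \<phi> k x - u x)) \<longlonglongrightarrow> 0) \<and>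
     ((\<lambda>k. L2_norm \<Omega> (\<lambda>x. classical_gradient (\<phi> k) x - grad \<Omega> u x)) \<longlonglongrightarrow> 0)"
    if u: "u \<in> H1_space \<Omega>" and \<phi>: "\<And>k. \<phi> k \<in> test_functions \<Omega>" for \<phi> :: "nat \<Rightarrow> _"
  proof -
    define p where "p k = L2_norm \<Omega> (\<lambda>x. \<phi> k x - u x)" for k
    define q where "q k = L2_norm \<Omega> (\<lambda>x. classical_gradient (\<phi> k) x - grad \<Omega> u x)" for k
    have "L2_norm \<Omega> (grad \<Omega> (\<lambda>x. \<phi> k x - u x)) = q k" for k
      unfolding q_def
    proof (rule L2_norm_cong_AE)
      have w: "weak_gradient \<Omega> (\<lambda>x. \<phi> k x - u x) (\<lambda>x. classical_gradient (\<phi> k) x - grad \<Omega> u x)"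
        by (rule weak_gradient_diff[OF test_L2 H1_L2 weak_gradient_classical grad_weak_gradient]) (rule \<phi> u)+
      show "AE x in lebesgue_on \<Omega>. grad \<Omega> (\<lambda>x. \<phi> k x - u x) x = classical_gradient (\<phi> k) x - grad \<Omega> u x"
        by (rule grad_AE_eq[OF w])
      show "(\<lambda>x. classical_gradient (\<phi> k) x - grad \<Omega> u x) \<in> L2_space \<Omega>"
        using w by (simp add: weak_gradient_def)
      show "grad \<Omega> (\<lambda>x. \<phi> k x - u x) \<in> L2_space \<Omega>"
        by (intro grad_L2 H1_diff(1) test_functions_H1 \<phi> u)
    qed
    then have H: "H1_norm \<Omega> (\<lambda>x. \<phi> k x - u x) = sqrt ((p k)\<^sup>2 + (q k)\<^sup>2)" for k
      by (simp add: H1_norm_def p_def)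
    have pq: "p k \<ge> 0" "q k \<ge> 0" for k by (simp_all add: p_def q_def L2_norm_nonneg)
    have "((\<lambda>k. sqrt ((p k)\<^sup>2 + (q k)\<^sup>2)) \<longlonglongrightarrow> 0) \<longleftrightarrow> (p \<longlonglongrightarrow> 0) \<and> (q \<longlonglongrightarrow> 0)"
    proof (intro iffI conjI)
      assume *: "(\<lambda>k. sqrt ((p k)\<^sup>2 + (q k)\<^sup>2)) \<longlonglongrightarrow> 0"
      show "p \<longlonglongrightarrow> 0" by (rule Lim_null_comparison[OF _ *]) (simp add: pq real_le_rsqrt)
      show "q \<longlonglongrightarrow> 0" by (rule Lim_null_comparison[OF _ *]) (simp add: pq real_le_rsqrt)
    next
      assume "p \<longlonglongrightarrow> 0 \<and> q \<longlonglongrightarrow> 0"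
      then have "(\<lambda>k. sqrt ((p k)\<^sup>2 + (q k)\<^sup>2)) \<longlonglongrightarrow> sqrt (0\<^sup>2 + 0\<^sup>2)" by (intro tendsto_intros) auto
      then show "(\<lambda>k. sqrt ((p k)\<^sup>2 + (q k)\<^sup>2)) \<longlonglongrightarrow> 0" by simp
    qed
    then show ?thesis by (simp add: H p_def[abs_def] q_def[abs_def])
  qed
  show ?thesis unfolding H01_space_def using key by auto
qed

lemma test_functions_diff:
  assumes "\<phi> \<in> test_functions \<Omega>" "\<psi> \<in> test_functions \<Omega>"
  shows "(\<lambda>x. \<phi> x - \<psi> x) \<in> test_functions \<Omega>"
proof -
  obtain K where K: "smooth \<phi>" "compact K" "K \<subseteq> \<Omega>" "\<And>x. x \<notin> K \<Longrightarrow> \<phi> x = 0"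
    using test_functionsE[OF assms(1)] by metis
  obtain L where L: "smooth \<psi>" "compact L" "L \<subseteq> \<Omega>" "\<And>x. x \<notin> L \<Longrightarrow> \<psi> x = 0"
    using test_functionsE[OF assms(2)] by metis
  have "smooth (\<lambda>x. \<phi> x + (-1) * \<psi> x)" by (intro smooth_add smooth_mult smooth_const K L)
  then show ?thesis
    using K L by (intro test_functionsI[of _ "K \<union> L"]) (auto intro: compact_Un)
qed

lemma test_functions_scale:
  assumes "\<phi> \<in> test_functions \<Omega>"
  shows "(\<lambda>x. c * \<phi> x) \<in> test_functions \<Omega>"
  by (rule test_functions_mult[OF assms smooth_const])

lemma H01_diff:
  assumes "u \<in> H01_space \<Omega>" "v \<in> H01_space \<Omega>"
  shows "(\<lambda>x. u x - v x) \<in> H01_space \<Omega>"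
proof -
  have H1: "u \<in> H1_space \<Omega>" "v \<in> H1_space \<Omega>" using assms H01_H1 by auto
  obtain \<phi> where \<phi>: "\<And>k::nat. \<phi> k \<in> test_functions \<Omega>" "(\<lambda>k. H1_norm \<Omega> (\<lambda>x. \<phi> k x - u x)) \<longlonglongrightarrow> 0"
    using assms(1) by (auto simp: H01_space_def)
  obtain \<psi> where \<psi>: "\<And>k::nat. \<psi> k \<in> test_functions \<Omega>" "(\<lambda>k. H1_norm \<Omega> (\<lambda>x. \<psi> k x - v x)) \<longlonglongrightarrow> 0"
    using assms(2) by (auto simp: H01_space_def)
  have parts: "L2_norm \<Omega> w \<le> H1_norm \<Omega> w" "L2_norm \<Omega> (grad \<Omega> w) \<le> H1_norm \<Omega> w"
    "H1_norm \<Omega> w \<le> L2_norm \<Omega> w + L2_norm \<Omega> (grad \<Omega> w)" for w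
    unfolding H1_norm_def by (auto intro!: real_le_rsqrt sqrt_sum_squares_le_sum simp: L2_norm_nonneg)
  have "H1_norm \<Omega> (\<lambda>x. (\<phi> k x - \<psi> k x) - (u x - v x))
      \<le> 2 * (H1_norm \<Omega> (\<lambda>x. \<phi> k x - u x) + H1_norm \<Omega> (\<lambda>x. \<psi> k x - v x))" for k
  proof -
    let ?a = "\<lambda>x. \<phi> k x - u x" and ?b = "\<lambda>x. \<psi> k x - v x"
    have a: "?a \<in> H1_space \<Omega>" and b: "?b \<in> H1_space \<Omega>"
      by (intro H1_diff(1) test_functions_H1 \<phi> \<psi> H1)+
    have "L2_norm \<Omega> (grad \<Omega> (\<lambda>x. ?a x - ?b x)) = L2_norm \<Omega> (\<lambda>x. grad \<Omega> ?a x - grad \<Omega> ?b x)"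
      by (rule L2_norm_cong_AE[OF H1_diff(2)[OF a b] grad_L2[OF H1_diff(1)[OF a b]] L2_diff[OF grad_L2[OF a] grad_L2[OF b]]])
    also have "\<dots> \<le> H1_norm \<Omega> ?a + H1_norm \<Omega> ?b"
      by (rule order_trans[OF L2_norm_diff_triangle[OF grad_L2[OF a] grad_L2[OF b]]]) (intro add_mono parts)
    finally have "L2_norm \<Omega> (grad \<Omega> (\<lambda>x. ?a x - ?b x)) \<le> H1_norm \<Omega> ?a + H1_norm \<Omega> ?b" .
    moreover have "L2_norm \<Omega> (\<lambda>x. ?a x - ?b x) \<le> H1_norm \<Omega> ?a + H1_norm \<Omega> ?b"
      by (rule order_trans[OF L2_norm_diff_triangle[OF H1_L2[OF a] H1_L2[OF b]]]) (intro add_mono parts)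
    ultimately have "H1_norm \<Omega> (\<lambda>x. ?a x - ?b x) \<le> 2 * (H1_norm \<Omega> ?a + H1_norm \<Omega> ?b)"
      using order_trans[OF parts(3) add_mono] unfolding mult_2 by blast
    moreover have "(\<lambda>x. (\<phi> k x - \<psi> k x) - (u x - v x)) = (\<lambda>x. ?a x - ?b x)" by auto
    ultimately show ?thesis by simp
  qed
  then have "norm (H1_norm \<Omega> (\<lambda>x. (\<phi> k x - \<psi> k x) - (u x - v x)))
      \<le> 2 * (H1_norm \<Omega> (\<lambda>x. \<phi> k x - u x) + H1_norm \<Omega> (\<lambda>x. \<psi> k x - v x))" for k
    by (simp add: H1_norm_def)
  then have "(\<lambda>k. H1_norm \<Omega> (\<lambda>x. (\<phi> k x - \<psi> k x) - (u x - v x))) \<longlonglongrightarrow> 0"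
    by (rule Lim_null_comparison[OF always_eventually[OF allI]
        tendsto_mult_right_zero[OF tendsto_add_zero[OF \<phi>(2) \<psi>(2)]]])
  then show ?thesis
    unfolding H01_space_def
    by (intro CollectI conjI exI[of _ "\<lambda>k x. \<phi> k x - \<psi> k x"] allI H1_diff(1)[OF H1] test_functions_diff[OF \<phi>(1) \<psi>(1)])
qed

lemma H01_scale:
  assumes "u \<in> H01_space \<Omega>"
  shows "(\<lambda>x. c * u x) \<in> H01_space \<Omega>"
proof -
  have H1: "u \<in> H1_space \<Omega>" using assms H01_H1 by auto
  obtain \<phi> where \<phi>: "\<And>k::nat. \<phi> k \<in> test_functions \<Omega>" "(\<lambda>k. H1_norm \<Omega> (\<lambda>x. \<phi> k x - u x)) \<longlonglongrightarrow> 0"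
    using assms(1) by (auto simp: H01_space_def)
  have "H1_norm \<Omega> (\<lambda>x. c * \<phi> k x - c * u x) = \<bar>c\<bar> * H1_norm \<Omega> (\<lambda>x. \<phi> k x - u x)" for k
  proof -
    let ?a = "\<lambda>x. \<phi> k x - u x"
    have a: "?a \<in> H1_space \<Omega>" by (intro H1_diff(1) test_functions_H1 \<phi> H1)
    have "L2_norm \<Omega> (grad \<Omega> (\<lambda>x. c * ?a x)) = L2_norm \<Omega> (\<lambda>x. c *\<^sub>R grad \<Omega> ?a x)"
      by (rule L2_norm_cong_AE[OF H1_scale(2)[OF a] grad_L2[OF H1_scale(1)[OF a]] L2_scale[OF grad_L2[OF a]]])
    moreover have "L2_norm \<Omega> (\<lambda>x. c * ?a x) = \<bar>c\<bar> * L2_norm \<Omega> ?a"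
      using L2_norm_scale[of \<Omega> c ?a] by simp
    ultimately have "H1_norm \<Omega> (\<lambda>x. c * ?a x) = \<bar>c\<bar> * H1_norm \<Omega> ?a"
      by (simp add: H1_norm_def L2_norm_scale power_mult_distrib real_sqrt_mult flip: distrib_left)
    then show ?thesis by (simp add: right_diff_distrib)
  qed
  then have "(\<lambda>k. H1_norm \<Omega> (\<lambda>x. c * \<phi> k x - c * u x)) \<longlonglongrightarrow> 0"
    using tendsto_mult_right_zero[OF \<phi>(2), of "\<bar>c\<bar>"] by simp
  then show ?thesis
    unfolding H01_space_def
    by (intro CollectI conjI exI[of _ "\<lambda>k x. c * \<phi> k x"] allI H1_scale(1)[OF H1] test_functions_scale[OF \<phi>(1)])
qed

section \<open>The Poincare inequality\<close>

text \<open>Integrate \<open>\<phi>\<^sup>2 = \<phi>\<^sup>2 \<partial>\<^sub>i x\<^sub>i\<close> by parts, with any coordinate \<open>i\<close>: the result is \<open>- 2 (\<phi>, x\<^sub>i \<partial>\<^sub>i \<phi>)\<close>, and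
\<open>\<bar>x\<^sub>i\<bar> \<le> R\<close>.\<close>

lemma Poincare_test_function:
  assumes \<phi>: "\<phi> \<in> test_functions \<Omega>" and R: "\<And>x. x \<in> \<Omega> \<Longrightarrow> norm x \<le> R" "0 \<le> R"
  shows "L2_norm \<Omega> \<phi> \<le> 2 * R * L2_norm \<Omega> (classical_gradient \<phi>)"
proof -
  obtain i :: 'n where True by simp
  have sm: "smooth \<phi>" using \<phi> by (simp add: test_functions_def)
  let ?d = "\<lambda>x. x $ i * partial i \<phi> x"
  have d: "?d \<in> L2_space \<Omega>"
    by (intro test_L2 test_functions_mult test_functions_partial \<phi> smooth_component)
  have L: "\<phi> \<in> L2_space \<Omega>" by (rule test_L2[OF \<phi>])
  have "(LINT x|lebesgue_on \<Omega>. (x $ i * \<phi> x) * partial i \<phi> x)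
      = - (LINT x|lebesgue_on \<Omega>. partial i (\<lambda>x. x $ i * \<phi> x) x * \<phi> x)"
    by (rule integral_mult_partial[OF \<phi> smooth_mult[OF smooth_component sm]])
  also have "(\<lambda>x. partial i (\<lambda>x. x $ i * \<phi> x) x * \<phi> x) = (\<lambda>x. \<phi> x * ?d x + \<phi> x * \<phi> x)"
    unfolding partial_mult[OF smooth_component sm] partial_component by (simp add: algebra_simps)
  also have "(LINT x|lebesgue_on \<Omega>. \<phi> x * ?d x + \<phi> x * \<phi> x) = L2_inner \<Omega> \<phi> ?d + L2_inner \<Omega> \<phi> \<phi>"
    using L2_inner_integrable[OF L d] L2_inner_integrable[OF L L] by (simp add: L2_inner_def)
  finally have "(L2_norm \<Omega> \<phi>)\<^sup>2 = - 2 * L2_inner \<Omega> \<phi> ?d"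
    by (simp add: L2_norm_power2 L2_inner_def mult.assoc mult.left_commute)
  also have "\<dots> \<le> 2 * (L2_norm \<Omega> \<phi> * L2_norm \<Omega> ?d)"
    using L2_Cauchy_Schwarz[OF L d] by (simp add: abs_le_iff)
  also have "L2_norm \<Omega> ?d \<le> L2_norm \<Omega> (\<lambda>x. R *\<^sub>R classical_gradient \<phi> x)"
  proof (rule L2_norm_mono[OF d L2_scale[OF classical_gradient_L2[OF \<phi>]]])
    fix x assume "x \<in> \<Omega>"
    then have "\<bar>x $ i\<bar> \<le> R" using R(1) component_le_norm_cart[of x i] by fastforce
    moreover have "\<bar>partial i \<phi> x\<bar> \<le> norm (classical_gradient \<phi> x)"
      using component_le_norm_cart[of "classical_gradient \<phi> x" i] by (simp add: classical_gradient_def)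
    ultimately show "norm (?d x) \<le> norm (R *\<^sub>R classical_gradient \<phi> x)"
      using R(2) by (simp add: abs_mult mult_mono)
  qed
  then have "2 * (L2_norm \<Omega> \<phi> * L2_norm \<Omega> ?d) \<le> 2 * (L2_norm \<Omega> \<phi> * (R * L2_norm \<Omega> (classical_gradient \<phi>)))"
    using R(2) by (intro mult_left_mono) (simp_all add: L2_norm_scale L2_norm_nonneg)
  finally have fin: "L2_norm \<Omega> \<phi> * L2_norm \<Omega> \<phi> \<le> L2_norm \<Omega> \<phi> * (2 * R * L2_norm \<Omega> (classical_gradient \<phi>))"
    by (simp add: power2_eq_square algebra_simps)
  then show ?thesis
  proof (cases "L2_norm \<Omega> \<phi> = 0")
    case False
    then show ?thesis
      using fin L2_norm_nonneg[of \<Omega> \<phi>] by (simp add: mult_le_cancel_left)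
  qed (simp add: R(2) L2_norm_nonneg)
qed

lemma Poincare:
  obtains c where "c > 0" and "\<And>u. u \<in> H01_space \<Omega> \<Longrightarrow> L2_norm \<Omega> u \<le> c * L2_norm \<Omega> (grad \<Omega> u)"
proof -
  obtain R where R: "R > 0" "\<And>x. x \<in> \<Omega> \<Longrightarrow> norm x \<le> R"
    using dom(2) bounded_pos by blast
  have "L2_norm \<Omega> u \<le> (2 * R) * L2_norm \<Omega> (grad \<Omega> u)" if u: "u \<in> H01_space \<Omega>" for u
  proof -
    obtain \<phi> where \<phi>: "\<And>k::nat. \<phi> k \<in> test_functions \<Omega>"
      "(\<lambda>k. L2_norm \<Omega> (\<lambda>x. \<phi> k x - u x)) \<longlonglongrightarrow> 0"
      "(\<lambda>k. L2_norm \<Omega> (\<lambda>x. classical_gradient (\<phi> k) x - grad \<Omega> u x)) \<longlonglongrightarrow> 0"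
      using u H01_space_iff by blast
    have tri: "L2_norm \<Omega> a \<le> L2_norm \<Omega> b + L2_norm \<Omega> (\<lambda>x. b x - a x)"
      "L2_norm \<Omega> b \<le> L2_norm \<Omega> a + L2_norm \<Omega> (\<lambda>x. b x - a x)"
      if "a \<in> L2_space \<Omega>" "b \<in> L2_space \<Omega>" for a b :: "real^'n \<Rightarrow> 'c::euclidean_space"
      using L2_norm_diff_triangle[OF that(2) L2_diff[OF that(2,1)]]
        L2_norm_diff_triangle[OF L2_diff[OF that(2,1)] L2_scale[OF that(1), of "-1"]]
        L2_norm_scale[of \<Omega> "-1" a] by simp_all
    have "L2_norm \<Omega> u \<le> 2 * R * (L2_norm \<Omega> (grad \<Omega> u) + L2_norm \<Omega> (\<lambda>x. classical_gradient (\<phi> k) x - grad \<Omega> u x))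
        + L2_norm \<Omega> (\<lambda>x. \<phi> k x - u x)" for k
    proof -
      let ?e = "L2_norm \<Omega> (\<lambda>x. classical_gradient (\<phi> k) x - grad \<Omega> u x)"
      have "L2_norm \<Omega> u \<le> L2_norm \<Omega> (\<phi> k) + L2_norm \<Omega> (\<lambda>x. \<phi> k x - u x)"
        by (rule tri(1)[OF H01_L2[OF u] test_L2[OF \<phi>(1)]])
      also have "L2_norm \<Omega> (\<phi> k) \<le> 2 * R * L2_norm \<Omega> (classical_gradient (\<phi> k))"
        using Poincare_test_function[OF \<phi>(1) R(2)] R(1) by simp
      also have "\<dots> \<le> 2 * R * (L2_norm \<Omega> (grad \<Omega> u) + ?e)"
        by (rule mult_left_mono[OF tri(2)[OF H01_grad_L2[OF u] classical_gradient_L2[OF \<phi>(1)]]]) (use R(1) in simp)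
      finally show ?thesis by simp
    qed
    moreover have "(\<lambda>k. 2 * R * (L2_norm \<Omega> (grad \<Omega> u) + L2_norm \<Omega> (\<lambda>x. classical_gradient (\<phi> k) x - grad \<Omega> u x))
        + L2_norm \<Omega> (\<lambda>x. \<phi> k x - u x)) \<longlonglongrightarrow> 2 * R * (L2_norm \<Omega> (grad \<Omega> u) + 0) + 0"
      by (intro tendsto_intros \<phi>)
    ultimately show ?thesis by (intro LIMSEQ_le_const) auto
  qed
  then show thesis using R(1) by (intro that[of "2 * R"]) auto
qed

section \<open>The weak form of the operator\<close>

lemma integral_laplacian:
  assumes u: "u \<in> H1_space \<Omega>" and \<phi>: "\<phi> \<in> test_functions \<Omega>"
  shows "(LINT x|lebesgue_on \<Omega>. u x * laplacian \<phi> x) = - L2_inner \<Omega> (grad \<Omega> u) (classical_gradient \<phi>)"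
proof -
  have p: "partial i \<phi> \<in> test_functions \<Omega>" for i using \<phi> by (rule test_functions_partial)
  have "(LINT x|lebesgue_on \<Omega>. u x * laplacian \<phi> x) = (\<Sum>i\<in>UNIV. LINT x|lebesgue_on \<Omega>. u x * partial i (partial i \<phi>) x)"
    unfolding laplacian_def sum_distrib_left
    by (rule Bochner_Integration.integral_sum) (rule L2_mult_test_integrable[OF H1_L2[OF u] test_functions_partial[OF p]])
  also have "\<dots> = (\<Sum>i\<in>UNIV. - (LINT x|lebesgue_on \<Omega>. grad \<Omega> u x $ i * partial i \<phi> x))"
    using grad_weak_gradient[OF u] p by (simp add: weak_gradient_def)
  also have "\<dots> = - (LINT x|lebesgue_on \<Omega>. (\<Sum>i\<in>UNIV. grad \<Omega> u x $ i * partial i \<phi> x))"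
    by (subst Bochner_Integration.integral_sum)
       (simp_all add: L2_mult_test_integrable[OF L2_component[OF grad_L2[OF u]] p] sum_negf)
  also have "(LINT x|lebesgue_on \<Omega>. (\<Sum>i\<in>UNIV. grad \<Omega> u x $ i * partial i \<phi> x))
      = L2_inner \<Omega> (grad \<Omega> u) (classical_gradient \<phi>)"
    by (simp add: L2_inner_def inner_vec_def classical_gradient_def)
  finally show ?thesis .
qed

text \<open>The distributional definition of \<open>\<Delta>u + \<parallel>\<nabla>v\<parallel>\<^sup>2 \<Delta>v\<close> tests with smooth functions only; both sides are continuous in the
\<open>H\<^sup>1\<close> norm of the test function, so density allows every \<open>w\<close> that vanishes on the boundary.\<close>

lemma A_value_weak_form:
  assumes uv: "u \<in> H1_space \<Omega>" "v \<in> H1_space \<Omega>" and f: "A_value \<Omega> (u, v) f" and w: "w \<in> H01_space \<Omega>"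
  shows "L2_inner \<Omega> (grad \<Omega> u) (grad \<Omega> w) + (L2_norm \<Omega> (grad \<Omega> v))\<^sup>2 * L2_inner \<Omega> (grad \<Omega> v) (grad \<Omega> w)
    = - L2_inner \<Omega> f w"
proof -
  let ?a = "(L2_norm \<Omega> (grad \<Omega> v))\<^sup>2"
  obtain \<phi> where \<phi>: "\<And>k::nat. \<phi> k \<in> test_functions \<Omega>"
    "(\<lambda>k. L2_norm \<Omega> (\<lambda>x. \<phi> k x - w x)) \<longlonglongrightarrow> 0"
    "(\<lambda>k. L2_norm \<Omega> (\<lambda>x. classical_gradient (\<phi> k) x - grad \<Omega> w x)) \<longlonglongrightarrow> 0"
    using w H01_space_iff by blast
  have fL2: "f \<in> L2_space \<Omega>" using f by (simp add: A_value_def)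
  have "L2_inner \<Omega> (grad \<Omega> u) (classical_gradient (\<phi> k)) + ?a * L2_inner \<Omega> (grad \<Omega> v) (classical_gradient (\<phi> k))
      = - L2_inner \<Omega> f (\<phi> k)" for k
  proof -
    have "- L2_inner \<Omega> (grad \<Omega> u) (classical_gradient (\<phi> k))
        + ?a * (- L2_inner \<Omega> (grad \<Omega> v) (classical_gradient (\<phi> k))) = L2_inner \<Omega> f (\<phi> k)"
      using f \<phi>(1)[of k] by (simp add: A_value_def integral_laplacian uv L2_inner_def)
    then show ?thesis by simp
  qed
  moreover have "(\<lambda>k. L2_inner \<Omega> (grad \<Omega> u) (classical_gradient (\<phi> k)) + ?a * L2_inner \<Omega> (grad \<Omega> v) (classical_gradient (\<phi> k)))
     \<longlonglongrightarrow> L2_inner \<Omega> (grad \<Omega> u) (grad \<Omega> w) + ?a * L2_inner \<Omega> (grad \<Omega> v) (grad \<Omega> w)"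
    by (intro tendsto_intros L2_tendsto_inner \<phi>(3) classical_gradient_L2 \<phi>(1) grad_L2 uv H01_H1[OF w])
  moreover have "(\<lambda>k. - L2_inner \<Omega> f (\<phi> k)) \<longlonglongrightarrow> - L2_inner \<Omega> f w"
    by (intro tendsto_intros L2_tendsto_inner \<phi>(2) test_L2 \<phi>(1) fL2 H01_L2[OF w])
  ultimately show ?thesis using LIMSEQ_unique by auto
qed

end

section \<open>The energy space\<close>

text \<open>The symmetric form whose diagonal is the multiplier \<open>\<integral> u v\<close>.\<close>

definition cross_form :: "(real^'n) set \<Rightarrow> 'n state \<Rightarrow> 'n state \<Rightarrow> real" where
  "cross_form \<Omega> U V = (L2_inner \<Omega> (fst U) (snd V) + L2_inner \<Omega> (snd U) (fst V)) / 2"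

text \<open>Differentiating along a curve uses the same rules for the inner product and for the
form \<open>cross_form\<close>; both are bounded symmetric bilinear forms on the energy space. Additivity is stated for
differences, the operation that the definitions of limit and derivative use.\<close>

definition bounded_form :: "(real^'n) set \<Rightarrow> real \<Rightarrow> ('n state \<Rightarrow> 'n state \<Rightarrow> real) \<Rightarrow> bool" where
  "bounded_form \<Omega> M B \<longleftrightarrow> 0 \<le> M \<and>
     (\<forall>U\<in>H_space \<Omega>. \<forall>V\<in>H_space \<Omega>. B U V = B V U \<and> \<bar>B U V\<bar> \<le> M * H_norm \<Omega> U * H_norm \<Omega> V \<and>
        (\<forall>c. B (scale c U) V = c * B U V) \<and>
        (\<forall>X\<in>H_space \<Omega>. B (diff U X) V = B U V - B X V))"

text \<open>The common setting for the two notions of solution. With \<open>V = J\<^sub>\<alpha> W\<close> the Yosida equation reads \<open>W' = AV\<close> and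
\<open>W = V - \<alpha> AV\<close>; for \<open>\<alpha> = 0\<close> this is the equation \<open>W' = AW\<close>.\<close>

definition approximate_solution :: "(real^'n) set \<Rightarrow> real \<Rightarrow> (real \<Rightarrow> 'n state) \<Rightarrow> bool" where
  "approximate_solution \<Omega> \<alpha> W \<longleftrightarrow> H_continuous \<Omega> W \<and>
     (\<forall>a b. 0 < a \<and> a \<le> b \<longrightarrow> H_absolutely_continuous_on \<Omega> a b W) \<and>
     (AE t in lebesgue_on {0..}. \<exists>V\<in>dom_A \<Omega>. H_has_derivative \<Omega> W (op_A \<Omega> V) t \<and>
        H_eq \<Omega> (W t) (diff V (scale \<alpha> (op_A \<Omega> V))))"

lemma H_norm_nonneg: "0 \<le> H_norm \<Omega> U"
  by (simp add: H_norm_def H_inner_def L2_inner_self_nonneg)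

lemma H_norm_power2: "(H_norm \<Omega> U)\<^sup>2 = H_inner \<Omega> U U"
  by (simp add: H_norm_def H_inner_def L2_inner_self_nonneg)

lemma H_norm_components:
  "L2_norm \<Omega> (grad \<Omega> (fst U)) \<le> H_norm \<Omega> U" "L2_norm \<Omega> (snd U) \<le> H_norm \<Omega> U"
  by (auto simp: H_norm_def H_inner_def L2_norm_def L2_inner_self_nonneg)

lemma at_within_atLeast_0: "(0::real) < t \<Longrightarrow> at t within {0..} = at t"
  by (rule at_within_interior) (simp add: interior_real_atLeast)

lemma eventually_atLeast_0: "eventually (\<lambda>s. 0 \<le> s) (at (t::real) within {0..})"
  by (simp add: eventually_at_filter)

context
  fixes \<Omega> :: "(real^'n) set"
  assumes dom: "open \<Omega>" "bounded \<Omega>"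
begin

lemma H_spaceD:
  assumes "U \<in> H_space \<Omega>"
  shows "fst U \<in> H01_space \<Omega>" "snd U \<in> L2_space \<Omega>" "fst U \<in> H1_space \<Omega>" "fst U \<in> L2_space \<Omega>"
    "grad \<Omega> (fst U) \<in> L2_space \<Omega>"
  using assms H01_H1 H01_L2 H01_grad_L2 by (auto simp: H_space_def)

lemma H_space_diff:
  assumes "U \<in> H_space \<Omega>" "V \<in> H_space \<Omega>"
  shows "diff U V \<in> H_space \<Omega>"
  using assms H01_diff[OF dom] L2_diff by (auto simp: H_space_def diff_def)

lemma H_space_scale:
  assumes "U \<in> H_space \<Omega>"
  shows "scale c U \<in> H_space \<Omega>"
  using assms H01_scale[OF dom] L2_scale[of "snd U" \<Omega> c] by (auto simp: H_space_def scale_def)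

lemma bounded_form_H_inner: "bounded_form \<Omega> 1 (H_inner \<Omega>)"
  unfolding bounded_form_def
proof (intro conjI ballI allI)
  fix U V X assume U: "U \<in> H_space \<Omega>" and V: "V \<in> H_space \<Omega>"
  note [simp] = H_spaceD[OF U] H_spaceD[OF V]
  show comm: "H_inner \<Omega> U V = H_inner \<Omega> V U"
    by (simp add: H_inner_def L2_inner_commute)
  have sc: "H_inner \<Omega> (scale c U) V = c * H_inner \<Omega> U V" if U: "U \<in> H_space \<Omega>" for c U
  proof -
    note u = H_spaceD[OF U]
    have "L2_inner \<Omega> (grad \<Omega> (\<lambda>x. c * fst U x)) (grad \<Omega> (fst V)) = L2_inner \<Omega> (\<lambda>x. c *\<^sub>R grad \<Omega> (fst U) x) (grad \<Omega> (fst V))"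
      by (rule L2_inner_cong_AE[OF H1_scale(2)[OF dom]])
         (auto intro!: u L2_scale grad_L2 H1_scale(1)[OF dom])
    then show ?thesis
      using L2_inner_scale_left[of \<Omega> c "snd U"]
      by (simp add: H_inner_def scale_def L2_inner_scale_left distrib_left)
  qed
  then show "H_inner \<Omega> (scale c U) V = c * H_inner \<Omega> U V" for c using U by simp
  have df: "H_inner \<Omega> (diff U X) V = H_inner \<Omega> U V - H_inner \<Omega> X V"
    if U: "U \<in> H_space \<Omega>" and X: "X \<in> H_space \<Omega>" and V: "V \<in> H_space \<Omega>" for U X V
  proof -
    note u = H_spaceD[OF U] H_spaceD[OF X] H_spaceD[OF V]
    have "L2_inner \<Omega> (grad \<Omega> (\<lambda>x. fst U x - fst X x)) (grad \<Omega> (fst V))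
        = L2_inner \<Omega> (\<lambda>x. grad \<Omega> (fst U) x - grad \<Omega> (fst X) x) (grad \<Omega> (fst V))"
      by (rule L2_inner_cong_AE[OF H1_diff(2)[OF dom]])
         (auto intro!: u L2_diff grad_L2 H1_diff(1)[OF dom])
    then show ?thesis
      using u by (simp add: H_inner_def diff_def L2_inner_diff_left)
  qed
  show "H_inner \<Omega> (diff U X) V = H_inner \<Omega> U V - H_inner \<Omega> X V" if "X \<in> H_space \<Omega>" for X
    using df[OF U that V] .
  have "\<bar>H_inner \<Omega> U V\<bar>\<le> L2_norm \<Omega> (grad \<Omega> (fst U)) * L2_norm \<Omega> (grad \<Omega> (fst V)) + L2_norm \<Omega> (snd U) * L2_norm \<Omega> (snd V)"
    unfolding H_inner_def by (intro order_trans[OF abs_triangle_ineq] add_mono L2_Cauchy_Schwarz) simp_all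
  also have "\<dots> \<le> H_norm \<Omega> U * H_norm \<Omega> V"
  proof (rule power2_le_imp_le)
    have cs: "(a * b + c * d)\<^sup>2 \<le> (a\<^sup>2 + c\<^sup>2) * (b\<^sup>2 + d\<^sup>2)" for a b c d :: real
      using zero_le_power2[of "a * d - c * b"] by (simp add: power2_eq_square algebra_simps)
    show "(L2_norm \<Omega> (grad \<Omega> (fst U)) * L2_norm \<Omega> (grad \<Omega> (fst V)) + L2_norm \<Omega> (snd U) * L2_norm \<Omega> (snd V))\<^sup>2
        \<le> (H_norm \<Omega> U * H_norm \<Omega> V)\<^sup>2"
      unfolding power_mult_distrib H_norm_power2 H_inner_def L2_norm_power2[symmetric] by (rule cs)
  qed (simp add: H_norm_nonneg)
  finally show "\<bar>H_inner \<Omega> U V\<bar> \<le> 1 * H_norm \<Omega> U * H_norm \<Omega> V" by simp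
qed simp

text \<open>Boundedness is the Poincare inequality, as the energy norm only sees the gradient of the first component.\<close>

lemma bounded_form_cross_form:
  assumes c: "c > 0" "\<And>u. u \<in> H01_space \<Omega> \<Longrightarrow> L2_norm \<Omega> u \<le> c * L2_norm \<Omega> (grad \<Omega> u)"
  shows "bounded_form \<Omega> c (cross_form \<Omega>)"
  unfolding bounded_form_def
proof (intro conjI ballI allI)
  fix U V X k assume U: "U \<in> H_space \<Omega>" and V: "V \<in> H_space \<Omega>"
  note [simp] = H_spaceD[OF U] H_spaceD[OF V]
  show "cross_form \<Omega> U V = cross_form \<Omega> V U"
    by (simp add: cross_form_def L2_inner_commute)
  show "cross_form \<Omega> (scale k U) V = k * cross_form \<Omega> U V"
    using L2_inner_scale_left[of \<Omega> k "snd U"] L2_inner_scale_left[of \<Omega> k "fst U"]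
    by (simp add: cross_form_def scale_def algebra_simps)
  show "cross_form \<Omega> (diff U X) V = cross_form \<Omega> U V - cross_form \<Omega> X V" if "X \<in> H_space \<Omega>" for X
    using H_spaceD[OF that] by (simp add: cross_form_def diff_def L2_inner_diff_left field_simps)
  have b: "L2_norm \<Omega> (fst Z) \<le> c * H_norm \<Omega> Z" if "Z \<in> H_space \<Omega>" for Z
    using c(2)[OF H_spaceD(1)[OF that]] mult_left_mono[OF H_norm_components(1)[of \<Omega> Z], of c] c(1) by linarith
  have "\<bar>L2_inner \<Omega> (fst U) (snd V)\<bar> \<le> c * H_norm \<Omega> U * H_norm \<Omega> V"
    by (rule order_trans[OF L2_Cauchy_Schwarz mult_mono])
       (auto simp: U V b L2_norm_nonneg H_norm_nonneg H_norm_components c(1) less_imp_le)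
  moreover have "\<bar>L2_inner \<Omega> (snd U) (fst V)\<bar> \<le> H_norm \<Omega> U * (c * H_norm \<Omega> V)"
    by (rule order_trans[OF L2_Cauchy_Schwarz mult_mono])
       (auto simp: U V b L2_norm_nonneg H_norm_nonneg H_norm_components c(1))
  ultimately show "\<bar>cross_form \<Omega> U V\<bar> \<le> c * H_norm \<Omega> U * H_norm \<Omega> V"
    unfolding cross_form_def by (simp add: mult.left_commute mult.assoc)
qed (use c in simp)

lemma bounded_formD:
  assumes "bounded_form \<Omega> M B" "U \<in> H_space \<Omega>" "V \<in> H_space \<Omega>"
  shows "B U V = B V U" "\<bar>B U V\<bar> \<le> M * H_norm \<Omega> U * H_norm \<Omega> V" "B (scale c U) V = c * B U V"
    "X \<in> H_space \<Omega> \<Longrightarrow> B (diff U X) V = B U V - B X V"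
    "B V (scale c U) = c * B V U"
    "X \<in> H_space \<Omega> \<Longrightarrow> B V (diff U X) = B V U - B V X" and "0 \<le> M"
proof -
  note * = assms(1)[unfolded bounded_form_def]
  show 1: "B U V = B V U" "\<bar>B U V\<bar> \<le> M * H_norm \<Omega> U * H_norm \<Omega> V" "B (scale c U) V = c * B U V" and "0 \<le> M"
    using * assms(2,3) by auto
  show 2: "B (diff U X) V = B U V - B X V" if "X \<in> H_space \<Omega>"
    using * assms(2,3) that by auto
  show "B V (scale c U) = c * B V U"
    using * assms(2,3) H_space_scale[OF assms(2), of c] by metis
  show "B V (diff U X) = B V U - B V X" if "X \<in> H_space \<Omega>"
    using * assms(2,3) that H_space_diff[OF assms(2) that] by metis
qed

text \<open>The quadratic form as a function of the increment \<open>U - V\<close>: continuity, Lipschitz bounds and derivatives along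
curves all start from this identity.\<close>

lemma form_increment:
  assumes "bounded_form \<Omega> M B" "U \<in> H_space \<Omega>" "V \<in> H_space \<Omega>"
  shows "B U U - B V V = B (diff U V) U + B (diff U V) V"
  using bounded_formD[OF assms] assms bounded_formD(4)[OF assms(1)] by simp

lemma H_norm_cong:
  assumes "U \<in> H_space \<Omega>" "V \<in> H_space \<Omega>" "H_eq \<Omega> U V"
  shows "H_norm \<Omega> U = H_norm \<Omega> V"
proof -
  have "AE x in lebesgue_on \<Omega>. fst U x = fst V x" and s: "AE x in lebesgue_on \<Omega>. snd U x = snd V x"
    using assms(3) unfolding H_eq_def by (auto elim: eventually_mono)
  then have "grad \<Omega> (fst U) = grad \<Omega> (fst V)"
    using assms(1,2) by (intro grad_cong_AE[OF dom]) (auto dest: H_spaceD)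
  moreover have "L2_inner \<Omega> (snd U) (snd U) = L2_inner \<Omega> (snd V) (snd V)"
    using s assms(1,2) by (intro L2_inner_cong_AE) (auto dest: H_spaceD)
  ultimately show ?thesis by (simp add: H_norm_def H_inner_def)
qed

lemma H_norm_diff_eq_0: "H_eq \<Omega> U V \<Longrightarrow> U \<in> H_space \<Omega> \<Longrightarrow> V \<in> H_space \<Omega> \<Longrightarrow> H_norm \<Omega> (diff U V) = 0"
proof -
  assume *: "H_eq \<Omega> U V" "U \<in> H_space \<Omega>" "V \<in> H_space \<Omega>"
  have "H_norm \<Omega> (diff U V) = H_norm \<Omega> (scale 0 U)"
    by (rule H_norm_cong[OF H_space_diff[OF *(2,3)] H_space_scale[OF *(2)]])
       (use *(1) in \<open>auto simp: H_eq_def diff_def scale_def elim: eventually_mono\<close>)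
  then show ?thesis
    using bounded_formD(3)[OF bounded_form_H_inner *(2) H_space_scale[OF *(2)], of 0 0] by (simp add: H_norm_def)
qed

lemma form_cong:
  assumes B: "bounded_form \<Omega> M B" and "H_eq \<Omega> U V" "U \<in> H_space \<Omega>" "V \<in> H_space \<Omega>" "X \<in> H_space \<Omega>"
  shows "B U X = B V X"
proof -
  have "\<bar>B (diff U V) X\<bar> \<le> M * H_norm \<Omega> (diff U V) * H_norm \<Omega> X"
    by (rule bounded_formD(2)[OF B]) (use assms H_space_diff in auto)
  then show ?thesis
    using H_norm_diff_eq_0 assms bounded_formD(4)[OF B] by simp
qed

text \<open>The energy space consists of representatives, with a seminorm and no topology of its own; pairing with a fixed state
carries limits over to the reals.\<close>

lemma form_tendsto_left:
  assumes B: "bounded_form \<Omega> M B" and "H_tendsto \<Omega> W L F" "eventually (\<lambda>s. W s \<in> H_space \<Omega>) F"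
    and "L \<in> H_space \<Omega>" "X \<in> H_space \<Omega>"
  shows "((\<lambda>s. B (W s) X) \<longlongrightarrow> B L X) F"
proof -
  have "((\<lambda>s. B (W s) X - B L X) \<longlongrightarrow> 0) F"
  proof (rule Lim_null_comparison)
    show "((\<lambda>s. M * H_norm \<Omega> X * H_norm \<Omega> (diff (W s) L)) \<longlongrightarrow> 0) F"
      using assms(2) unfolding H_tendsto_def by (rule tendsto_mult_right_zero)
    show "\<forall>\<^sub>F s in F. norm (B (W s) X - B L X) \<le> M * H_norm \<Omega> X * H_norm \<Omega> (diff (W s) L)"
      using assms(3)
    proof eventually_elim
      case (elim s)
      show ?case
        using bounded_formD(2)[OF B H_space_diff[OF elim assms(4)] assms(5)]
          bounded_formD(4)[OF B elim assms(5,4)] by (simp add: mult.commute mult.left_commute)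
    qed
  qed
  then show ?thesis by (rule Lim_null[THEN iffD2])
qed

lemma form_tendsto:
  assumes B: "bounded_form \<Omega> M B" and W: "H_tendsto \<Omega> W L F" "eventually (\<lambda>s. W s \<in> H_space \<Omega>) F"
    and W': "H_tendsto \<Omega> W' L' F" "eventually (\<lambda>s. W' s \<in> H_space \<Omega>) F"
    and L: "L \<in> H_space \<Omega>" "L' \<in> H_space \<Omega>"
  shows "((\<lambda>s. B (W s) (W' s)) \<longlongrightarrow> B L L') F"
proof -
  have "((\<lambda>s. B (diff (W s) L) (diff (W' s) L')) \<longlongrightarrow> 0) F"
  proof (rule Lim_null_comparison)
    have "((\<lambda>s. H_norm \<Omega> (diff (W s) L) * H_norm \<Omega> (diff (W' s) L')) \<longlongrightarrow> 0) F"
      using W(1) W'(1) unfolding H_tendsto_def by (rule tendsto_mult_zero)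
    then show "((\<lambda>s. M * (H_norm \<Omega> (diff (W s) L) * H_norm \<Omega> (diff (W' s) L'))) \<longlongrightarrow> 0) F"
      by (rule tendsto_mult_right_zero)
    show "\<forall>\<^sub>F s in F. norm (B (diff (W s) L) (diff (W' s) L')) \<le> M * (H_norm \<Omega> (diff (W s) L) * H_norm \<Omega> (diff (W' s) L'))"
      using W(2) W'(2)
    proof eventually_elim
      case (elim s)
      show ?case
        using bounded_formD(2)[OF B H_space_diff[OF elim(1) L(1)] H_space_diff[OF elim(2) L(2)]] by (simp add: mult.assoc)
    qed
  qed
  moreover have "((\<lambda>s. B (W s) L' + B (W' s) L - B L L') \<longlongrightarrow> B L L' + B L' L - B L L') F"
    by (intro tendsto_intros form_tendsto_left[OF B]) fact+
  ultimately have "((\<lambda>s. B (diff (W s) L) (diff (W' s) L') + (B (W s) L' + B (W' s) L - B L L')) \<longlongrightarrow> 0 + (B L L' + B L' L - B L L')) F"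
    by (rule tendsto_add)
  moreover have "\<forall>\<^sub>F s in F. B (diff (W s) L) (diff (W' s) L') + (B (W s) L' + B (W' s) L - B L L') = B (W s) (W' s)"
    using W(2) W'(2)
  proof eventually_elim
    case (elim s)
    show ?case
      using L elim H_space_diff[OF elim(2) L(2)]
      by (simp add: bounded_formD(4,6)[OF B] bounded_formD(1)[OF B elim(2) L(1)])
  qed
  ultimately show ?thesis
    using bounded_formD(1)[OF B L] by (simp add: tendsto_cong)
qed

lemma form_has_derivative_left:
  assumes B: "bounded_form \<Omega> M B" and H: "\<And>t. t \<ge> 0 \<Longrightarrow> W t \<in> H_space \<Omega>" and t: "t > 0"
    and D: "H_has_derivative \<Omega> W D t" and X: "X \<in> H_space \<Omega>"
  shows "((\<lambda>s. B (W s) X) has_real_derivative B D X) (at t)"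
proof -
  let ?R = "\<lambda>s. scale (1 / (s - t)) (diff (W s) (W t))"
  have Wt: "W t \<in> H_space \<Omega>" using H t by simp
  have ev: "eventually (\<lambda>s. W s \<in> H_space \<Omega>) (at t within {0..})"
    using eventually_atLeast_0 by (rule eventually_mono) (rule H)
  have "((\<lambda>s. B (?R s) X) \<longlongrightarrow> B D X) (at t within {0..})"
    using D ev unfolding H_has_derivative_def
    by (intro form_tendsto_left[OF B _ _ _ X]) (auto elim!: eventually_mono intro: H_space_scale H_space_diff Wt)
  moreover have "\<forall>\<^sub>F s in at t within {0..}. B (?R s) X = (B (W s) X - B (W t) X) / (s - t)"
    using ev by eventually_elim (simp add: bounded_formD(3)[OF B H_space_diff X] bounded_formD(4)[OF B] Wt X)
  ultimately show ?thesis
    unfolding has_field_derivative_iff at_within_atLeast_0[OF t] by (simp add: tendsto_cong)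
qed

lemma form_has_derivative:
  assumes B: "bounded_form \<Omega> M B" and W: "H_continuous \<Omega> W" and t: "t > 0"
    and D: "H_has_derivative \<Omega> W D t"
  shows "((\<lambda>s. B (W s) (W s)) has_real_derivative 2 * B D (W t)) (at t)"
proof -
  have H: "\<And>t. t \<ge> 0 \<Longrightarrow> W t \<in> H_space \<Omega>" and Wc: "H_tendsto \<Omega> W (W t) (at t within {0..})"
    using W t by (auto simp: H_continuous_def)
  let ?R = "\<lambda>s. scale (1 / (s - t)) (diff (W s) (W t))"
  have Wt: "W t \<in> H_space \<Omega>" using H t by simp
  have D': "D \<in> H_space \<Omega>" "H_tendsto \<Omega> ?R D (at t within {0..})"
    using D by (auto simp: H_has_derivative_def)
  have ev: "eventually (\<lambda>s. W s \<in> H_space \<Omega>) (at t within {0..})"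
    using eventually_atLeast_0 by (rule eventually_mono) (rule H)
  then have ev': "eventually (\<lambda>s. ?R s \<in> H_space \<Omega>) (at t within {0..})"
    by (rule eventually_mono) (intro H_space_scale H_space_diff Wt)
  have "((\<lambda>s. B (?R s) (W s) + B (?R s) (W t)) \<longlongrightarrow> B D (W t) + B D (W t)) (at t within {0..})"
    by (intro tendsto_add form_tendsto[OF B D'(2) ev' Wc ev D'(1) Wt] form_tendsto_left[OF B D'(2) ev' D'(1) Wt])
  moreover have "\<forall>\<^sub>F s in at t within {0..}. B (?R s) (W s) + B (?R s) (W t) = (B (W s) (W s) - B (W t) (W t)) / (s - t)"
    using ev
  proof eventually_elim
    case (elim s)
    show ?case
      using bounded_formD(3)[OF B H_space_diff[OF elim Wt]] form_increment[OF B elim Wt] elim Wt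
      by (simp add: add_divide_distrib)
  qed
  ultimately show ?thesis
    unfolding has_field_derivative_iff at_within_atLeast_0[OF t] by (simp add: tendsto_cong)
qed

lemma form_Lipschitz:
  assumes B: "bounded_form \<Omega> M B" and "U \<in> H_space \<Omega>" "V \<in> H_space \<Omega>" "H_norm \<Omega> U \<le> R" "H_norm \<Omega> V \<le> R"
  shows "\<bar>B U U - B V V\<bar> \<le> 2 * M * R * H_norm \<Omega> (diff U V)"
proof -
  have "\<bar>B (diff U V) X\<bar> \<le> M * H_norm \<Omega> (diff U V) * R" if "X \<in> H_space \<Omega>" "H_norm \<Omega> X \<le> R" for X
    by (rule order_trans[OF bounded_formD(2)[OF B H_space_diff[OF assms(2,3)] that(1)]])
       (intro mult_left_mono that mult_nonneg_nonneg H_norm_nonneg bounded_formD(7)[OF assms(1-3)])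
  from this[OF assms(2,4)] this[OF assms(3,5)] show ?thesis
    unfolding form_increment[OF assms(1-3)] by (simp add: algebra_simps)
qed

lemma form_continuous_on:
  assumes B: "bounded_form \<Omega> M B" and W: "H_continuous \<Omega> W"
  shows "continuous_on {0..} (\<lambda>t. B (W t) (W t))"
  unfolding continuous_on_def
proof
  fix t :: real assume t: "t \<in> {0..}"
  have ev: "eventually (\<lambda>s. W s \<in> H_space \<Omega>) (at t within {0..})"
    using eventually_atLeast_0 by (rule eventually_mono) (use W in \<open>simp add: H_continuous_def\<close>)
  show "((\<lambda>t. B (W t) (W t)) \<longlongrightarrow> B (W t) (W t)) (at t within {0..})"
    using W t by (intro form_tendsto[OF B _ ev _ ev]) (auto simp: H_continuous_def)
qed

end

section \<open>Two real inequalities\<close>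

text \<open>Here \<open>e = \<parallel>W\<parallel>\<^sup>2\<close>, \<open>N = \<parallel>V\<parallel>\<^sup>2\<close>, \<open>d = \<parallel>AV\<parallel>\<^sup>2\<close> and \<open>q\<close> is the derivative of the multiplier. Every term of
\<open>q\<close> other than \<open>- e\<close> has a factor that the dissipation \<open>a^4 + \<alpha> d\<close> controls; Young's inequality splits its
product with \<open>e\<close>. The losses \<open>1/4\<close>, \<open>1/8\<close> and \<open>1/4\<close> of \<open>e\<^sup>2\<close> leave the factor \<open>3/8\<close>.\<close>

lemma energy_multiplier_inequality:
  fixes \<alpha> a c d e e0 G N p q :: real
  assumes \<alpha>: "0 \<le> \<alpha>" "\<alpha> \<le> 1" and e: "0 \<le> e" "e \<le> e0" and a: "0 \<le> a" and d: "a\<^sup>2 \<le> d"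
    and N: "0 \<le> N" and eN: "e = N + 2 * \<alpha> * a ^ 4 + \<alpha>\<^sup>2 * d"
    and p: "\<bar>p\<bar> \<le> a * sqrt N" and G: "G \<le> c\<^sup>2 * a\<^sup>2"
    and q: "q = 2 * G - N - a\<^sup>2 * p + 2 * \<alpha> * p + 2 * \<alpha> * a ^ 4"
  shows "e * q \<le> - (3 / 8) * e\<^sup>2 + (4 * c ^ 4 + e0\<^sup>2 / 2 + 19 / 2 * e0) * (a ^ 4 + \<alpha> * d)"
proof -
  have d0: "0 \<le> d" using d zero_le_power2[of a] by linarith
  have a4: "0 \<le> a ^ 4" using a by simp
  have a4': "a ^ 4 = a\<^sup>2 * a\<^sup>2" by (simp add: power2_eq_square power4_eq_xxxx)
  have "N \<le> e" using eN \<alpha> a4 d0 by simp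
  define s where "s = sqrt e"
  have s: "0 \<le> s" "s\<^sup>2 = e" using e by (simp_all add: s_def)
  have ps: "\<bar>p\<bar> \<le> a * s"
    using p mult_left_mono[of "sqrt N" s a] \<open>N \<le> e\<close> a by (simp add: s_def)
  (* of a^2 p only the factor p, which is at most a * s, is split *)
  have young1: "2 * (a * s) \<le> a\<^sup>2 + e"
    using zero_le_power2[of "a - s"] s by (simp add: power2_eq_square algebra_simps)
  have young2: "2 * \<alpha> * (a * s) \<le> e / 4 + 4 * \<alpha>\<^sup>2 * a\<^sup>2"
    using zero_le_power2[of "s / 2 - 2 * \<alpha> * a"] s by (simp add: power2_eq_square algebra_simps)
  have p1: "- p \<le> (a\<^sup>2 + e) / 2"
    using ps young1 by (simp add: abs_le_iff)
  have p2: "2 * \<alpha> * p \<le> e / 4 + 4 * \<alpha>\<^sup>2 * a\<^sup>2"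
    by (rule order_trans[OF mult_left_mono young2]) (use ps \<alpha> in \<open>auto simp: abs_le_iff\<close>)
  have \<alpha>2: "\<alpha>\<^sup>2 \<le> \<alpha>" using \<alpha> by (simp add: power2_eq_square mult_left_le)
  (* the kinetic energy, through the Poincare constant *)
  have A: "e * (2 * G) \<le> e\<^sup>2 / 4 + 4 * c ^ 4 * a ^ 4"
  proof -
    have "e * (2 * G) \<le> e * (2 * (c\<^sup>2 * a\<^sup>2))" using G e by (intro mult_left_mono) auto
    moreover have "0 \<le> (e / 2 - 2 * (c\<^sup>2 * a\<^sup>2))\<^sup>2" by simp
    moreover have "(c\<^sup>2 * a\<^sup>2)\<^sup>2 = c ^ 4 * a ^ 4" by (simp add: power_mult_distrib flip: power_mult)
    ultimately show ?thesis by (simp add: power2_diff power_mult_distrib field_simps)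
  qed
  (* half of the first term and all of the second come from writing N in terms of e *)
  have B: "e * (4 * \<alpha> * a ^ 4 + \<alpha>\<^sup>2 * d) \<le> e0 * (4 * a ^ 4 + \<alpha> * d)"
    using e \<alpha> \<alpha>2 d0 a4 by (intro mult_mono add_mono mult_right_mono) auto
  (* the damping term *)
  have C: "e * (a\<^sup>2 * (- p)) \<le> e\<^sup>2 / 8 + (e0 / 2 + e0\<^sup>2 / 2) * a ^ 4"
  proof -
    have "e * (a\<^sup>2 * (- p)) \<le> e * (a\<^sup>2 * ((a\<^sup>2 + e) / 2))"
      using p1 e by (intro mult_left_mono) auto
    also have "\<dots> = e * a ^ 4 / 2 + e * (e * a\<^sup>2) / 2" unfolding a4' by (simp add: field_simps)
    also have "\<dots> \<le> e0 * a ^ 4 / 2 + e0 * (e * a\<^sup>2) / 2"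
      using e a4 by (intro add_mono divide_right_mono mult_right_mono) auto
    also have "e0 * (e * a\<^sup>2) / 2 \<le> e\<^sup>2 / 8 + e0\<^sup>2 / 2 * a ^ 4"
      using zero_le_power2[of "e / 2 - e0 * a\<^sup>2"] unfolding a4' by (simp add: power2_eq_square field_simps)
    finally show ?thesis by (simp add: algebra_simps)
  qed
  (* from the first component alpha v of alpha AV; by a^2 <= d, alpha^2 a^2 is part of the
     Yosida dissipation *)
  have D: "e * (2 * \<alpha> * p) \<le> e\<^sup>2 / 4 + 4 * e0 * (\<alpha> * d)"
  proof -
    have "\<alpha>\<^sup>2 * a\<^sup>2 \<le> \<alpha> * d" using \<alpha>2 d \<alpha> by (intro mult_mono) auto
    then have "2 * \<alpha> * p \<le> e / 4 + 4 * (\<alpha> * d)" using p2 by simp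
    then have "e * (2 * \<alpha> * p) \<le> e * (e / 4 + 4 * (\<alpha> * d))" using e by (intro mult_left_mono) auto
    also have "\<dots> = e\<^sup>2 / 4 + 4 * (e * (\<alpha> * d))" by (simp add: power2_eq_square algebra_simps)
    also have "e * (\<alpha> * d) \<le> e0 * (\<alpha> * d)" using e \<alpha> d0 by (intro mult_right_mono) auto
    finally show ?thesis by simp
  qed
  have "e * q = - e\<^sup>2 + e * (2 * G) + e * (4 * \<alpha> * a ^ 4 + \<alpha>\<^sup>2 * d) + e * (a\<^sup>2 * (- p)) + e * (2 * \<alpha> * p)"
    unfolding q using eN by (simp add: power2_eq_square algebra_simps)
  also have "\<dots> \<le> - (3 / 8) * e\<^sup>2 + 4 * c ^ 4 * a ^ 4 + e0 * (4 * a ^ 4 + \<alpha> * d) + (e0 / 2 + e0\<^sup>2 / 2) * a ^ 4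
      + 4 * e0 * (\<alpha> * d)"
    using A B C D by linarith
  also have "\<dots> \<le> - (3 / 8) * e\<^sup>2 + (4 * c ^ 4 + e0\<^sup>2 / 2 + 19 / 2 * e0) * (a ^ 4 + \<alpha> * d)"
  proof -
    have "0 \<le> 4 * c ^ 4 * (\<alpha> * d) + e0\<^sup>2 / 2 * (\<alpha> * d) + 5 * e0 * a ^ 4 + 9 / 2 * e0 * (\<alpha> * d)"
      using \<alpha> d0 e a4 zero_le_even_power[of 4 c] by (intro add_nonneg_nonneg mult_nonneg_nonneg) auto
    then show ?thesis by (simp add: field_simps)
  qed
  finally show ?thesis .
qed

text \<open>With \<open>F = e (1 + \<epsilon> P)\<close> the left-hand side is \<open>F'\<close>. At least half of the dissipation \<open>2 S\<close> survives
the factor \<open>1 + \<epsilon> P \<ge> 1/2\<close>, which pays for \<open>\<epsilon> K S\<close>; and \<open>F\<^sup>2 \<le> (9/4) e\<^sup>2\<close> turns \<open>3/8\<close> into \<open>1/6\<close>.\<close>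

lemma Lyapunov_inequality:
  fixes e P e' P' S \<epsilon> K :: real
  assumes e: "0 \<le> e" and P: "\<bar>\<epsilon> * P\<bar> \<le> 1 / 2" and e': "e' = - 2 * S" and S: "0 \<le> S"
    and eP': "e * P' \<le> - (3 / 8) * e\<^sup>2 + K * S" and \<epsilon>: "0 < \<epsilon>" "\<epsilon> * K \<le> 1"
  shows "e' * (1 + \<epsilon> * P) + e * (\<epsilon> * P') \<le> - (\<epsilon> / 6) * (e * (1 + \<epsilon> * P))\<^sup>2"
proof -
  have "- 2 * S * (1 + \<epsilon> * P) \<le> - S"
    using mult_left_mono[of "1 / 2" "1 + \<epsilon> * P" "2 * S"] P S by (simp add: abs_le_iff)
  moreover have "e * (\<epsilon> * P') \<le> - (3 / 8) * (\<epsilon> * e\<^sup>2) + S"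
    using mult_left_mono[OF eP', of \<epsilon>] mult_right_mono[OF \<epsilon>(2) S] \<epsilon>(1) by (simp add: algebra_simps)
  moreover have "(1 + \<epsilon> * P)\<^sup>2 \<le> (3 / 2)\<^sup>2" using P by (intro power_mono) (auto simp: abs_le_iff)
  then have "\<epsilon> / 6 * (e\<^sup>2 * (1 + \<epsilon> * P)\<^sup>2) \<le> \<epsilon> / 6 * (e\<^sup>2 * (3 / 2)\<^sup>2)"
    using \<epsilon>(1) by (intro mult_left_mono) auto
  then have "\<epsilon> / 6 * (e * (1 + \<epsilon> * P))\<^sup>2 \<le> 3 / 8 * (\<epsilon> * e\<^sup>2)"
    by (simp add: power_mult_distrib power2_eq_square)
  ultimately show ?thesis unfolding e' by linarith
qed

section \<open>The operator\<close>

lemma dom_A_H_space: "V \<in> dom_A \<Omega> \<Longrightarrow> V \<in> H_space \<Omega>"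
  by (simp add: dom_A_def)

lemma op_A_A_value:
  assumes "V \<in> dom_A \<Omega>"
  shows "A_value \<Omega> V (snd (op_A \<Omega> V))"
proof -
  have "\<exists>f. A_value \<Omega> V f" using assms by (simp add: dom_A_def)
  then show ?thesis unfolding op_A_def snd_conv by (rule someI_ex)
qed

lemma op_A_H_space:
  assumes "V \<in> dom_A \<Omega>"
  shows "op_A \<Omega> V \<in> H_space \<Omega>"
proof -
  have "snd (op_A \<Omega> V) \<in> L2_space \<Omega>"
    using op_A_A_value[OF assms] by (simp add: A_value_def)
  moreover have "fst (op_A \<Omega> V) \<in> H01_space \<Omega>"
    using assms by (simp add: op_A_def dom_A_def)
  ultimately show ?thesis by (simp add: H_space_def mem_Times_iff)
qed

context
  fixes \<Omega> :: "(real^'n) set"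
  assumes dom: "open \<Omega>" "bounded \<Omega>"
begin

text \<open>Everything follows from testing \<open>f = \<Delta>u + a\<^sup>2 \<Delta>v\<close>, the second component of \<open>AV\<close>, with \<open>v\<close> and with \<open>u\<close>, which gives
the values of the two forms at \<open>(AV, V)\<close> and \<open>(AV, AV)\<close>; the rest is expansion of \<open>W = V - \<alpha> AV\<close>.\<close>

lemma op_A_energy_identities:
  assumes V: "V \<in> dom_A \<Omega>" and W: "W \<in> H_space \<Omega>" "H_eq \<Omega> W (diff V (scale \<alpha> (op_A \<Omega> V)))"
    and cross_form: "bounded_form \<Omega> c (cross_form \<Omega>)"
  defines "a \<equiv> L2_norm \<Omega> (grad \<Omega> (snd V))" and "d \<equiv> H_inner \<Omega> (op_A \<Omega> V) (op_A \<Omega> V)"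
    and "p \<equiv> L2_inner \<Omega> (grad \<Omega> (fst V)) (grad \<Omega> (snd V))"
  shows "H_inner \<Omega> (op_A \<Omega> V) W = - (a ^ 4 + \<alpha> * d)"
    and "H_inner \<Omega> W W = H_inner \<Omega> V V + 2 * \<alpha> * a ^ 4 + \<alpha>\<^sup>2 * d"
    and "2 * cross_form \<Omega> (op_A \<Omega> V) W = 2 * (L2_norm \<Omega> (snd V))\<^sup>2 - H_inner \<Omega> V V - a\<^sup>2 * p + 2 * \<alpha> * p + 2 * \<alpha> * a ^ 4"
    and "a\<^sup>2 \<le> d" and "\<bar>p\<bar> \<le> a * sqrt (H_inner \<Omega> V V)"
proof -
  define f where "f = snd (op_A \<Omega> V)"
  define D where "D = op_A \<Omega> V"
  have fst_D: "fst D = snd V" and snd_D: "snd D = f" by (simp_all add: D_def f_def op_A_def)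
  have VH: "V \<in> H_space \<Omega>" and DH: "D \<in> H_space \<Omega>" using dom_A_H_space[OF V] op_A_H_space[OF V] by (simp_all add: D_def)
  have v: "snd V \<in> H01_space \<Omega>" using V by (simp add: dom_A_def)
  have a2: "a\<^sup>2 = L2_inner \<Omega> (grad \<Omega> (snd V)) (grad \<Omega> (snd V))" by (simp add: a_def L2_norm_power2)
  have a4: "a ^ 4 = a\<^sup>2 * a\<^sup>2" by (simp add: power2_eq_square power4_eq_xxxx)
  have f: "A_value \<Omega> (fst V, snd V) f" using op_A_A_value[OF V] by (simp add: f_def)
  have weak: "L2_inner \<Omega> (grad \<Omega> (fst V)) (grad \<Omega> w) + a\<^sup>2 * L2_inner \<Omega> (grad \<Omega> (snd V)) (grad \<Omega> w) = - L2_inner \<Omega> f w"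
    if "w \<in> H01_space \<Omega>" for w
    unfolding a_def by (rule A_value_weak_form[OF dom _ _ f that]) (use H_spaceD[OF dom VH] H01_H1[OF v] in auto)
  have weak_v: "L2_inner \<Omega> f (snd V) = - (p + a ^ 4)"
    using weak[OF v] unfolding a4 by (simp add: p_def a2)
  have weak_u: "L2_inner \<Omega> f (fst V) = - (L2_inner \<Omega> (grad \<Omega> (fst V)) (grad \<Omega> (fst V)) + a\<^sup>2 * p)"
    using weak[OF H_spaceD(1)[OF dom VH]] by (simp add: p_def L2_inner_commute)
  have DV: "H_inner \<Omega> D V = - (a ^ 4)"
    unfolding H_inner_def fst_D snd_D weak_v by (simp add: p_def L2_inner_commute)
  have cDV: "2 * cross_form \<Omega> D V = 2 * (L2_norm \<Omega> (snd V))\<^sup>2 - H_inner \<Omega> V V - a\<^sup>2 * p"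
    unfolding cross_form_def fst_D snd_D weak_u H_inner_def by (simp add: L2_norm_power2)
  have cDD: "cross_form \<Omega> D D = - (p + a ^ 4)"
    unfolding cross_form_def fst_D snd_D using weak_v by (simp add: L2_inner_commute)
  let ?Z = "diff V (scale \<alpha> D)"
  have sD: "scale \<alpha> D \<in> H_space \<Omega>" and Z: "?Z \<in> H_space \<Omega>"
    using VH DH H_space_scale[OF dom] H_space_diff[OF dom] by auto
  have eq: "H_eq \<Omega> W ?Z" using W(2) by (simp add: D_def)
  have expand: "B D W = B D V - \<alpha> * B D D" if B: "bounded_form \<Omega> M B" for M B
  proof -
    have "B D W = B W D" using bounded_formD(1)[OF dom B DH W(1)] .
    also have "\<dots> = B ?Z D" by (rule form_cong[OF dom B eq W(1) Z DH])
    also have "\<dots> = B V D - \<alpha> * B D D"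
      by (simp add: bounded_formD(4)[OF dom B VH DH sD] bounded_formD(3)[OF dom B DH DH])
    finally show ?thesis using bounded_formD(1)[OF dom B DH VH] by simp
  qed
  show "H_inner \<Omega> (op_A \<Omega> V) W = - (a ^ 4 + \<alpha> * d)"
    using expand[OF bounded_form_H_inner[OF dom]] DV by (simp add: d_def D_def)
  show "2 * cross_form \<Omega> (op_A \<Omega> V) W = 2 * (L2_norm \<Omega> (snd V))\<^sup>2 - H_inner \<Omega> V V - a\<^sup>2 * p + 2 * \<alpha> * p + 2 * \<alpha> * a ^ 4"
    unfolding D_def[symmetric] expand[OF cross_form] right_diff_distrib cDV mult.left_commute[of 2] cDD
    by (simp add: algebra_simps)
  have "H_inner \<Omega> W W = H_inner \<Omega> ?Z W" by (rule form_cong[OF dom bounded_form_H_inner[OF dom] eq W(1) Z W(1)])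
  also have "\<dots> = H_inner \<Omega> V W - \<alpha> * H_inner \<Omega> D W"
    by (simp add: bounded_formD(4)[OF dom bounded_form_H_inner[OF dom] VH W(1) sD] bounded_formD(3)[OF dom bounded_form_H_inner[OF dom] DH W(1)])
  also have "H_inner \<Omega> V W = H_inner \<Omega> ?Z V"
    using bounded_formD(1)[OF dom bounded_form_H_inner[OF dom] VH W(1)] form_cong[OF dom bounded_form_H_inner[OF dom] eq W(1) Z VH] by simp
  also have "\<dots> = H_inner \<Omega> V V - \<alpha> * H_inner \<Omega> D V"
    by (simp add: bounded_formD(4)[OF dom bounded_form_H_inner[OF dom] VH VH sD] bounded_formD(3)[OF dom bounded_form_H_inner[OF dom] DH VH])
  finally show "H_inner \<Omega> W W = H_inner \<Omega> V V + 2 * \<alpha> * a ^ 4 + \<alpha>\<^sup>2 * d"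
    unfolding expand[OF bounded_form_H_inner[OF dom]] DV by (simp add: d_def D_def power2_eq_square algebra_simps)
  show "a\<^sup>2 \<le> d"
    unfolding d_def D_def[symmetric] H_inner_def fst_D a2 by (simp add: L2_inner_self_nonneg)
  have "\<bar>p\<bar> \<le> L2_norm \<Omega> (grad \<Omega> (fst V)) * a"
    unfolding p_def a_def by (rule L2_Cauchy_Schwarz) (use H_spaceD[OF dom VH] H01_grad_L2[OF v] in auto)
  also have "\<dots> \<le> H_norm \<Omega> V * a"
    by (intro mult_right_mono H_norm_components) (simp add: a_def L2_norm_nonneg)
  finally show "\<bar>p\<bar> \<le> a * sqrt (H_inner \<Omega> V V)" by (simp add: H_norm_def mult.commute)
qed

end

section \<open>Regular solutions and Yosida approximations\<close>

text \<open>For \<open>\<alpha> = 0\<close> take \<open>V = W\<close>.\<close>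

lemma regular_solution_approximate:
  assumes "regular_solution \<Omega> U0 U"
  shows "approximate_solution \<Omega> 0 U"
proof -
  have "AE t in lebesgue_on {0..}. U t \<in> dom_A \<Omega> \<and> H_has_derivative \<Omega> U (op_A \<Omega> (U t)) t"
    using assms by (simp add: regular_solution_def)
  then have "AE t in lebesgue_on {0..}. \<exists>V\<in>dom_A \<Omega>. H_has_derivative \<Omega> U (op_A \<Omega> V) t \<and>
        H_eq \<Omega> (U t) (diff V (scale 0 (op_A \<Omega> V)))"
  proof (rule eventually_mono, elim conjE)
    fix t assume t: "U t \<in> dom_A \<Omega>" "H_has_derivative \<Omega> U (op_A \<Omega> (U t)) t"
    show "\<exists>V\<in>dom_A \<Omega>. H_has_derivative \<Omega> U (op_A \<Omega> V) t \<and> H_eq \<Omega> (U t) (diff V (scale 0 (op_A \<Omega> V)))"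
      by (rule bexI[OF _ t(1)]) (simp add: t(2) H_eq_def diff_def scale_def)
  qed
  then show ?thesis
    using assms by (auto simp: regular_solution_def approximate_solution_def)
qed

context
  fixes \<Omega> :: "(real^'n) set"
  assumes dom: "open \<Omega>" "bounded \<Omega>"
begin

lemma H_has_derivative_cong:
  assumes W: "\<And>t. 0 \<le> t \<Longrightarrow> W t \<in> H_space \<Omega>" and "0 \<le> t" and D: "H_has_derivative \<Omega> W D t"
    and D': "D' \<in> H_space \<Omega>" "H_eq \<Omega> D D'"
  shows "H_has_derivative \<Omega> W D' t"
proof -
  let ?R = "\<lambda>s. scale (1 / (s - t)) (diff (W s) (W t))"
  have DH: "D \<in> H_space \<Omega>" using D by (simp add: H_has_derivative_def)
  have "\<forall>\<^sub>F s in at t within {0..}. H_norm \<Omega> (diff (?R s) D) = H_norm \<Omega> (diff (?R s) D')"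
    using eventually_atLeast_0
  proof (rule eventually_mono)
    fix s :: real assume "0 \<le> s"
    then have R: "?R s \<in> H_space \<Omega>" using W \<open>0 \<le> t\<close> H_space_scale[OF dom] H_space_diff[OF dom] by blast
    show "H_norm \<Omega> (diff (?R s) D) = H_norm \<Omega> (diff (?R s) D')"
      by (rule H_norm_cong[OF dom H_space_diff[OF dom R DH] H_space_diff[OF dom R D'(1)]])
         (use D'(2) in \<open>auto simp: H_eq_def diff_def elim: eventually_mono\<close>)
  qed
  then show ?thesis
    using D D'(1) unfolding H_has_derivative_def H_tendsto_def by (simp add: tendsto_cong)
qed

text \<open>The derivative is bounded in norm on \<open>{a..b}\<close>, so the curve is Lipschitz. The mean value inequality for the norm
is the scalar mean value theorem for \<open>s \<mapsto> \<langle>W s, X\<rangle>\<close> with \<open>X = W r - W l\<close>.\<close>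

lemma C1_absolutely_continuous:
  assumes W: "H_continuous \<Omega> W" and D: "H_continuous \<Omega> D" and der: "\<And>t. t \<ge> 0 \<Longrightarrow> H_has_derivative \<Omega> W (D t) t"
    and ab: "0 < a" "a \<le> b"
  shows "H_absolutely_continuous_on \<Omega> a b W"
proof -
  have WH: "W t \<in> H_space \<Omega>" "D t \<in> H_space \<Omega>" if "0 \<le> t" for t using W D that by (auto simp: H_continuous_def)
  have "compact ((\<lambda>t. H_inner \<Omega> (D t) (D t)) ` {a..b})"
    by (intro compact_continuous_image continuous_on_subset[OF form_continuous_on[OF dom bounded_form_H_inner[OF dom] D]]) (use ab in auto)
  then obtain B where B: "\<And>t. t \<in> {a..b} \<Longrightarrow> \<bar>H_inner \<Omega> (D t) (D t)\<bar> \<le> B" "B > 0"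
    using compact_imp_bounded bounded_pos by (metis (no_types, lifting) imageI real_norm_def)
  have Dn: "H_norm \<Omega> (D t) \<le> sqrt B" if "t \<in> {a..b}" for t
    using B(1)[OF that] by (simp add: H_norm_def)
  have Lip: "H_norm \<Omega> (diff (W r) (W l)) \<le> sqrt B * (r - l)" if lr: "a \<le> l" "l \<le> r" "r \<le> b" for l r
  proof (cases "l = r")
    case True
    then show ?thesis
      using H_norm_diff_eq_0[OF dom _ WH(1) WH(1), of r r] lr ab by (simp add: H_eq_def)
  next
    case False
    let ?X = "diff (W r) (W l)"
    have X: "?X \<in> H_space \<Omega>" using lr ab by (intro H_space_diff[OF dom] WH) auto
    have "((\<lambda>s. H_inner \<Omega> (W s) ?X) has_real_derivative H_inner \<Omega> (D s) ?X) (at s)" if "l \<le> s" for s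
      by (rule form_has_derivative_left[OF dom bounded_form_H_inner[OF dom] WH(1) _ der X]) (use that lr ab in auto)
    then obtain z where z: "l < z" "z < r" "H_inner \<Omega> (W r) ?X - H_inner \<Omega> (W l) ?X = (r - l) * H_inner \<Omega> (D z) ?X"
      using MVT2[of l r "\<lambda>s. H_inner \<Omega> (W s) ?X" "\<lambda>s. H_inner \<Omega> (D s) ?X"] False lr by fastforce
    have "H_norm \<Omega> ?X * H_norm \<Omega> ?X = (r - l) * H_inner \<Omega> (D z) ?X"
      using z(3) bounded_formD(4)[OF dom bounded_form_H_inner[OF dom] WH(1) X WH(1), of r l] lr ab
      by (simp flip: H_norm_power2 power2_eq_square)
    also have "H_inner \<Omega> (D z) ?X \<le> sqrt B * H_norm \<Omega> ?X"
    proof (rule order_trans)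
      show "H_inner \<Omega> (D z) ?X \<le> H_norm \<Omega> (D z) * H_norm \<Omega> ?X"
        using bounded_formD(2)[OF dom bounded_form_H_inner[OF dom] WH(2) X, of z] z lr ab by simp
      show "H_norm \<Omega> (D z) * H_norm \<Omega> ?X \<le> sqrt B * H_norm \<Omega> ?X"
        using Dn[of z] z lr by (intro mult_right_mono H_norm_nonneg) auto
    qed
    then have "(r - l) * H_inner \<Omega> (D z) ?X \<le> (r - l) * (sqrt B * H_norm \<Omega> ?X)"
      using lr by (intro mult_left_mono) auto
    finally have "H_norm \<Omega> ?X * H_norm \<Omega> ?X \<le> sqrt B * (r - l) * H_norm \<Omega> ?X"
      by (simp only: mult_ac)
    then show ?thesis
      using H_norm_nonneg[of \<Omega> ?X] lr B(2) by (cases "H_norm \<Omega> ?X = 0") auto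
  qed
  show ?thesis
    unfolding H_absolutely_continuous_on_def
  proof (intro allI impI)
    fix \<epsilon> :: real assume \<epsilon>: "\<epsilon> > 0"
    show "\<exists>\<delta>>0. \<forall>(m::nat) l r. (\<forall>i<m. a \<le> l i \<and> l i \<le> r i \<and> r i \<le> b) \<and>
        (\<forall>i<m. \<forall>j<m. i \<noteq> j \<longrightarrow> r i \<le> l j \<or> r j \<le> l i) \<and> (\<Sum>i<m. r i - l i) < \<delta> \<longrightarrow>
        (\<Sum>i<m. H_norm \<Omega> (diff (W (r i)) (W (l i)))) < \<epsilon>"
    proof (intro exI[of _ "\<epsilon> / sqrt B"] conjI allI impI, goal_cases)
      case (2 m l r)
      then have "(\<Sum>i<m. H_norm \<Omega> (diff (W (r i)) (W (l i)))) \<le> sqrt B * (\<Sum>i<m. r i - l i)"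
        unfolding sum_distrib_left by (intro sum_mono Lip) auto
      also have "\<dots> < \<epsilon>"
        using 2 B(2) by (simp add: pos_less_divide_eq mult.commute)
      finally show ?case .
    qed (use \<epsilon> B(2) in simp)
  qed
qed

text \<open>Solving \<open>D = (V - W) / \<alpha>\<close> and \<open>W = V - \<alpha> AV\<close> for \<open>D\<close> gives \<open>D = AV\<close> almost everywhere.\<close>

lemma yosida_solution_approximate:
  assumes Y: "yosida_solution \<Omega> \<alpha> U0 W" and \<alpha>: "\<alpha> > 0"
  shows "approximate_solution \<Omega> \<alpha> W"
proof -
  obtain D where D: "H_continuous \<Omega> D" "\<And>t. t \<ge> 0 \<Longrightarrow> H_has_derivative \<Omega> W (D t) t \<and> yosida \<Omega> \<alpha> (W t) (D t)"
    and W: "H_continuous \<Omega> W"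
    using Y by (auto simp: yosida_solution_def)
  have WH: "W t \<in> H_space \<Omega>" if "0 \<le> t" for t using W that by (auto simp: H_continuous_def)
  have "\<exists>V\<in>dom_A \<Omega>. H_has_derivative \<Omega> W (op_A \<Omega> V) t \<and> H_eq \<Omega> (W t) (diff V (scale \<alpha> (op_A \<Omega> V)))" if t: "t \<ge> 0" for t
  proof -
    obtain V where V: "V \<in> dom_A \<Omega>" "H_eq \<Omega> (diff V (scale \<alpha> (op_A \<Omega> V))) (W t)"
      "H_eq \<Omega> (D t) (scale (1 / \<alpha>) (diff V (W t)))"
      using D(2)[OF t] by (auto simp: yosida_def resolvent_def)
    have "H_eq \<Omega> (D t) (op_A \<Omega> V)"
      using V(2,3) unfolding H_eq_def
      by eventually_elim (use \<alpha> in \<open>auto simp: diff_def scale_def field_simps\<close>)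
    then have "H_has_derivative \<Omega> W (op_A \<Omega> V) t"
      using H_has_derivative_cong[of W t "D t" "op_A \<Omega> V"] WH t D(2)[OF t] op_A_H_space[OF V(1)] by simp
    moreover have "H_eq \<Omega> (W t) (diff V (scale \<alpha> (op_A \<Omega> V)))"
      using V(2) unfolding H_eq_def by (auto elim: eventually_mono)
    ultimately show ?thesis using V(1) by blast
  qed
  then have "AE t in lebesgue_on {0..}. \<exists>V\<in>dom_A \<Omega>. H_has_derivative \<Omega> W (op_A \<Omega> V) t \<and> H_eq \<Omega> (W t) (diff V (scale \<alpha> (op_A \<Omega> V)))"
    by (intro AE_I2) simp
  then show ?thesis
    unfolding approximate_solution_def
    using W C1_absolutely_continuous[OF W D(1)] D(2) by simp
qed

end

section \<open>Decay of the energy\<close>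

context
  fixes \<Omega> :: "(real^'n) set"
  assumes dom: "open \<Omega>" "bounded \<Omega>"
begin

text \<open>A function of time that is Lipschitz in the state inherits absolute continuity from the curve, so an
almost everywhere bound on its derivative can be integrated. This serves both for the energy and for \<open>1 / F\<close>.\<close>

lemma approximate_solution_growth:
  assumes W: "approximate_solution \<Omega> \<alpha> W" and ab: "0 < a" "a \<le> b"
    and Lip: "\<And>l r. l \<in> {a..b} \<Longrightarrow> r \<in> {a..b} \<Longrightarrow> \<bar>\<Phi> r - \<Phi> l\<bar> \<le> L * H_norm \<Omega> (diff (W r) (W l))"
    and der: "\<And>t V. t \<in> {a..b} \<Longrightarrow> V \<in> dom_A \<Omega> \<Longrightarrow> H_has_derivative \<Omega> W (op_A \<Omega> V) t \<Longrightarrow>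
        H_eq \<Omega> (W t) (diff V (scale \<alpha> (op_A \<Omega> V))) \<Longrightarrow> \<exists>\<Phi>'\<ge>k. (\<Phi> has_real_derivative \<Phi>') (at t)"
  shows "k * (b - a) \<le> \<Phi> b - \<Phi> a"
proof -
  let ?good = "\<lambda>t. \<exists>V\<in>dom_A \<Omega>. H_has_derivative \<Omega> W (op_A \<Omega> V) t \<and> H_eq \<Omega> (W t) (diff V (scale \<alpha> (op_A \<Omega> V)))"
  have "AE t in lebesgue_on {0..}. ?good t"
    using W by (simp add: approximate_solution_def)
  then have "AE t in lebesgue. t \<in> {0..} \<longrightarrow> ?good t"
    by (subst (asm) AE_restrict_space_iff) auto
  then obtain N where N: "N \<in> null_sets lebesgue" "{t \<in> space lebesgue. \<not> (t \<in> {0..} \<longrightarrow> ?good t)} \<subseteq> N"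
    unfolding eventually_ae_filter by blast
  show ?thesis
  proof (rule absolutely_continuous_growth[OF ab(2), where N = N])
    show "negligible N" using N(1) by (simp add: negligible_iff_null_sets)
    fix t assume t: "t \<in> {a..b} - N"
    have "t \<in> space lebesgue" "t \<in> {0..}" using t ab by auto
    then have "?good t" using N(2) t by blast
    then obtain V where V: "V \<in> dom_A \<Omega>" "H_has_derivative \<Omega> W (op_A \<Omega> V) t"
      "H_eq \<Omega> (W t) (diff V (scale \<alpha> (op_A \<Omega> V)))"
      by (elim bexE conjE)
    have "t \<in> {a..b}" using t by (rule DiffD1)
    then show "\<exists>\<Phi>'\<ge>k. (\<Phi> has_real_derivative \<Phi>') (at t)" by (rule der) (rule V)+
  next
    fix \<epsilon> :: real assume \<epsilon>: "\<epsilon> > 0"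
    (* a strictly positive Lipschitz constant, to divide by *)
    define L' where "L' = max L 1"
    have L': "L' > 0" by (simp add: L'_def)
    have "H_absolutely_continuous_on \<Omega> a b W" using W ab by (simp add: approximate_solution_def)
    from this[unfolded H_absolutely_continuous_on_def, THEN spec, THEN mp, OF divide_pos_pos[OF \<epsilon> L']]
    obtain \<delta> where \<delta>: "\<delta> > 0" "\<forall>(m::nat) l r. (\<forall>i<m. a \<le> l i \<and> l i \<le> r i \<and> r i \<le> b) \<and>
        (\<forall>i<m. \<forall>j<m. i \<noteq> j \<longrightarrow> r i \<le> l j \<or> r j \<le> l i) \<and> (\<Sum>i<m. r i - l i) < \<delta> \<longrightarrow>
        (\<Sum>i<m. H_norm \<Omega> (diff (W (r i)) (W (l i)))) < \<epsilon> / L'"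
      by (elim exE conjE)
    show "\<exists>\<delta>>0. \<forall>(m::nat) l r. (\<forall>i<m. a \<le> l i \<and> l i \<le> r i \<and> r i \<le> b) \<and>
        (\<forall>i<m. \<forall>j<m. i \<noteq> j \<longrightarrow> r i \<le> l j \<or> r j \<le> l i) \<and> (\<Sum>i<m. r i - l i) < \<delta> \<longrightarrow>
        (\<Sum>i<m. \<bar>\<Phi> (r i) - \<Phi> (l i)\<bar>) < \<epsilon>"
    proof (intro exI[of _ \<delta>] conjI allI impI, rule \<delta>(1))
      fix m :: nat and l r
      assume *: "(\<forall>i<m. a \<le> l i \<and> l i \<le> r i \<and> r i \<le> b) \<and>
        (\<forall>i<m. \<forall>j<m. i \<noteq> j \<longrightarrow> r i \<le> l j \<or> r j \<le> l i) \<and> (\<Sum>i<m. r i - l i) < \<delta>"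
      have "(\<Sum>i<m. \<bar>\<Phi> (r i) - \<Phi> (l i)\<bar>) \<le> (\<Sum>i<m. L' * H_norm \<Omega> (diff (W (r i)) (W (l i))))"
      proof (rule sum_mono)
        fix i assume "i \<in> {..<m}"
        then have "l i \<in> {a..b}" "r i \<in> {a..b}" using * by fastforce+
        then have "\<bar>\<Phi> (r i) - \<Phi> (l i)\<bar> \<le> L * H_norm \<Omega> (diff (W (r i)) (W (l i)))" by (rule Lip)
        also have "\<dots> \<le> L' * H_norm \<Omega> (diff (W (r i)) (W (l i)))"
          by (intro mult_right_mono H_norm_nonneg) (simp add: L'_def)
        finally show "\<bar>\<Phi> (r i) - \<Phi> (l i)\<bar> \<le> L' * H_norm \<Omega> (diff (W (r i)) (W (l i)))" .
      qed
      also have "\<dots> = L' * (\<Sum>i<m. H_norm \<Omega> (diff (W (r i)) (W (l i))))" by (simp add: sum_distrib_left)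
      also have "\<dots> < \<epsilon>" using \<delta>(2)[THEN spec, THEN spec, THEN spec, THEN mp, OF *] L' by (simp add: pos_less_divide_eq mult.commute)
      finally show "(\<Sum>i<m. \<bar>\<Phi> (r i) - \<Phi> (l i)\<bar>) < \<epsilon>" .
    qed
  qed
qed

text \<open>On compact intervals inside \<open>(0, \<infinity>)\<close> this is \<open>e' = - 2 (a^4 + \<alpha> d) \<le> 0\<close>; the endpoint \<open>0\<close>, which
absolute continuity does not reach, follows from continuity of the curve.\<close>

lemma approximate_solution_energy_decreasing:
  assumes W: "approximate_solution \<Omega> \<alpha> W" and \<alpha>: "0 \<le> \<alpha>" and cross_form: "bounded_form \<Omega> c (cross_form \<Omega>)"
    and st: "0 \<le> s" "s \<le> t"
  shows "H_inner \<Omega> (W t) (W t) \<le> H_inner \<Omega> (W s) (W s)"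
proof -
  define e where "e t = H_inner \<Omega> (W t) (W t)" for t
  have Wc: "H_continuous \<Omega> W" using W by (simp add: approximate_solution_def)
  have WH: "W t \<in> H_space \<Omega>" if "0 \<le> t" for t using Wc that by (auto simp: H_continuous_def)
  have cont: "continuous_on {0..} e" unfolding e_def by (rule form_continuous_on[OF dom bounded_form_H_inner[OF dom] Wc])
  have pos: "e b \<le> e a" if ab: "0 < a" "a \<le> b" for a b
  proof -
    have "compact (e ` {a..b})"
      by (intro compact_continuous_image continuous_on_subset[OF cont]) (use ab in auto)
    then obtain B where B: "\<And>t. t \<in> {a..b} \<Longrightarrow> \<bar>e t\<bar> \<le> B"
      using compact_imp_bounded bounded_pos by (metis (no_types, lifting) imageI real_norm_def)
    have n: "H_norm \<Omega> (W t) \<le> sqrt B" if "t \<in> {a..b}" for t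
      using B[OF that] by (simp add: H_norm_def e_def)
    have "0 * (b - a) \<le> (- e b) - (- e a)"
    proof (rule approximate_solution_growth[OF W ab, where L = "2 * 1 * sqrt B"])
      fix l r assume lr: "l \<in> {a..b}" "r \<in> {a..b}"
      show "\<bar>- e r - - e l\<bar> \<le> 2 * 1 * sqrt B * H_norm \<Omega> (diff (W r) (W l))"
        using form_Lipschitz[OF dom bounded_form_H_inner[OF dom] WH WH n[OF lr(2)] n[OF lr(1)]] lr ab by (simp add: e_def abs_minus_commute)
    next
      fix t V assume t: "t \<in> {a..b}" and V: "V \<in> dom_A \<Omega>" "H_has_derivative \<Omega> W (op_A \<Omega> V) t"
        "H_eq \<Omega> (W t) (diff V (scale \<alpha> (op_A \<Omega> V)))"
      have t0: "0 < t" using t ab by simp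
      note id = op_A_energy_identities[OF dom V(1) WH V(3) cross_form]
      have "(e has_real_derivative 2 * H_inner \<Omega> (op_A \<Omega> V) (W t)) (at t)"
        unfolding e_def by (rule form_has_derivative[OF dom bounded_form_H_inner[OF dom] Wc t0 V(2)])
      then have "((\<lambda>t. - e t) has_real_derivative - (2 * H_inner \<Omega> (op_A \<Omega> V) (W t))) (at t)"
        by (rule DERIV_minus)
      moreover have "0 \<le> \<alpha> * H_inner \<Omega> (op_A \<Omega> V) (op_A \<Omega> V)"
        using \<alpha> H_norm_power2[of \<Omega> "op_A \<Omega> V"] zero_le_power2 by (metis mult_nonneg_nonneg)
      then have "0 \<le> - (2 * H_inner \<Omega> (op_A \<Omega> V) (W t))"
        using id(1) t0 by simp
      ultimately show "\<exists>\<Phi>'\<ge>0. ((\<lambda>t. - e t) has_real_derivative \<Phi>') (at t)" by blast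
    qed
    then show ?thesis by simp
  qed
  have zero: "e b \<le> e 0" if b: "0 < b" for b
  proof -
    have "(e \<longlongrightarrow> e 0) (at 0 within {0..})" using cont by (auto simp: continuous_on_def)
    then have "(e \<longlongrightarrow> e 0) (at_right 0)" by (rule tendsto_within_subset) auto
    moreover have "\<forall>\<^sub>F a in at_right 0. e b \<le> e a"
      using eventually_at_right_less[of 0] eventually_at_right_field[of "\<lambda>a. a < b" 0] b
      by (auto simp: eventually_at_right_field intro!: exI[of _ b] pos)
    ultimately show ?thesis by (rule tendsto_lowerbound) simp
  qed
  show ?thesis
    using pos[of s t] zero[of t] st unfolding e_def[symmetric] by (cases "s = 0"; cases "t = 0") auto
qed

text \<open>The growth lemma is applied to \<open>1 / F\<close> on \<open>{b/2..b}\<close>, which keeps away from \<open>0\<close>. If \<open>e b > 0\<close>, then by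
monotonicity \<open>F \<ge> e b / 2\<close> on this interval, hence \<open>1 / F\<close> is Lipschitz in the state. The conditions
on \<open>\<epsilon>\<close> make \<open>\<bar>\<epsilon> P\<bar> \<le> 1/2\<close> and let the dissipation absorb
the error in the bound for \<open>e P'\<close>.\<close>

lemma approximate_solution_decay:
  assumes c: "c > 0" "\<And>u. u \<in> H01_space \<Omega> \<Longrightarrow> L2_norm \<Omega> u \<le> c * L2_norm \<Omega> (grad \<Omega> u)"
    and W: "approximate_solution \<Omega> \<alpha> W" and \<alpha>: "0 \<le> \<alpha>" "\<alpha> \<le> 1"
    and e0: "H_inner \<Omega> (W 0) (W 0) \<le> e0"
    and \<epsilon>: "0 < \<epsilon>" "\<epsilon> * (c * e0) \<le> 1 / 2" "\<epsilon> * (4 * c ^ 4 + e0\<^sup>2 / 2 + 19 / 2 * e0) \<le> 1"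
    and b: "0 < b"
  shows "H_inner \<Omega> (W b) (W b) \<le> 24 / (\<epsilon> * b)"
proof -
  note cross_form = bounded_form_cross_form[OF dom c]
  define e where "e t = H_inner \<Omega> (W t) (W t)" for t
  define P where "P t = cross_form \<Omega> (W t) (W t)" for t
  define F where "F t = e t * (1 + \<epsilon> * P t)" for t
  have Wc: "H_continuous \<Omega> W" using W by (simp add: approximate_solution_def)
  have WH: "W t \<in> H_space \<Omega>" if "0 \<le> t" for t using Wc that by (auto simp: H_continuous_def)
  have e_mono: "e t \<le> e s" if "0 \<le> s" "s \<le> t" for s t
    unfolding e_def by (rule approximate_solution_energy_decreasing[OF W \<alpha>(1) cross_form that])
  have e_nonneg: "0 \<le> e t" for t unfolding e_def by (metis H_norm_power2 zero_le_power2)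
  have e_le: "e t \<le> e0" if "0 \<le> t" for t using e_mono[of 0 t] e0 that by (simp add: e_def)
  have e0_nonneg: "0 \<le> e0" using e_le[of 0] e_nonneg[of 0] by simp
  have P_le: "\<bar>\<epsilon> * P t\<bar> \<le> 1 / 2" if "0 \<le> t" for t
  proof -
    have "\<bar>P t\<bar> \<le> c * e t"
      using bounded_formD(2)[OF dom cross_form WH WH, of t t] that
      by (simp add: P_def e_def flip: H_norm_power2 power2_eq_square mult.assoc) (simp add: power2_eq_square mult.assoc)
    also have "\<dots> \<le> c * e0" using c e_le[OF that] by simp
    finally have "\<epsilon> * \<bar>P t\<bar> \<le> \<epsilon> * (c * e0)" using \<epsilon>(1) by (intro mult_left_mono) auto
    also note \<epsilon>(2)
    finally show ?thesis using \<epsilon>(1) by (simp add: abs_mult)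
  qed
  have F_bounds: "e t / 2 \<le> F t" if "0 \<le> t" for t
    using mult_left_mono[of "1 / 2" "1 + \<epsilon> * P t" "e t"] P_le[OF that] e_nonneg[of t]
    by (simp add: F_def abs_le_iff)
  show ?thesis
  proof (cases "e b = 0")
    case True
    then show ?thesis using \<epsilon>(1) b by (simp add: e_def)
  next
    case False
    then have eb: "0 < e b" using e_nonneg[of b] by simp
    define a where "a = b / 2"
    have ab: "0 < a" "a \<le> b" using b by (auto simp: a_def)
    define m where "m = e b / 2"
    have m: "0 < m" using eb by (simp add: m_def)
    have Fm: "m \<le> F t" if "t \<in> {a..b}" for t
      using F_bounds[of t] e_mono[of t b] that ab by (simp add: m_def)
    define R where "R = sqrt e0"
    have R: "0 \<le> R" using e0_nonneg by (simp add: R_def)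
    have n: "H_norm \<Omega> (W t) \<le> R" if "0 \<le> t" for t
      using e_le[OF that] by (simp add: H_norm_def e_def R_def)
    (* with b - a = b / 2 and e <= 2 F the factor 1 / 6 becomes the constant 24 *)
    have "\<epsilon> / 6 * (b - a) \<le> 1 / F b - 1 / F a"
    proof (rule approximate_solution_growth[OF W ab, where L = "4 * R / (m * m)"])
      fix l r assume lr: "l \<in> {a..b}" "r \<in> {a..b}"
      define h where "h = H_norm \<Omega> (diff (W r) (W l))"
      have h: "0 \<le> h" by (simp add: h_def H_norm_nonneg)
      have lr0: "0 \<le> l" "0 \<le> r" using lr ab by auto
      have de: "\<bar>e r - e l\<bar> \<le> 2 * R * h"
        using form_Lipschitz[OF dom bounded_form_H_inner[OF dom] WH WH n n] lr0 by (simp add: e_def h_def)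
      have dP: "\<bar>P r - P l\<bar> \<le> 2 * c * R * h"
        using form_Lipschitz[OF dom cross_form WH WH n n] lr0 by (simp add: P_def h_def)
      have "F r - F l = (e r - e l) * (1 + \<epsilon> * P r) + e l * (\<epsilon> * (P r - P l))"
        by (simp add: F_def algebra_simps)
      then have "\<bar>F r - F l\<bar> \<le> \<bar>(e r - e l) * (1 + \<epsilon> * P r)\<bar> + \<bar>e l * (\<epsilon> * (P r - P l))\<bar>"
        by (simp only: abs_triangle_ineq)
      also have "\<dots> = \<bar>e r - e l\<bar> * \<bar>1 + \<epsilon> * P r\<bar> + e l * (\<epsilon> * \<bar>P r - P l\<bar>)"
        using e_nonneg[of l] \<epsilon>(1) by (simp add: abs_mult)
      also have "\<dots> \<le> 2 * R * h * (3 / 2) + e0 * (\<epsilon> * (2 * c * R * h))"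
        using de dP P_le[OF lr0(2)] e_le[OF lr0(1)] e_nonneg[of l] \<epsilon>(1) R h e0_nonneg
        by (intro add_mono mult_mono mult_nonneg_nonneg) (auto simp: abs_le_iff)
      also have "e0 * (\<epsilon> * (2 * c * R * h)) = (\<epsilon> * (c * e0)) * (2 * R * h)" by simp
      also have "\<dots> \<le> 1 / 2 * (2 * R * h)" using \<epsilon>(2) R h by (intro mult_right_mono) auto
      (* 3 R h from the first summand and R h from the second *)
      finally have dF: "\<bar>F r - F l\<bar> \<le> 4 * R * h" by simp
      have Fp: "0 < F r" "0 < F l" using Fm[OF lr(1)] Fm[OF lr(2)] m by auto
      have "\<bar>1 / F r - 1 / F l\<bar> = \<bar>F r - F l\<bar> / (F r * F l)"
        using Fp by (simp add: diff_frac_eq abs_minus_commute abs_mult)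
      also have "\<dots> \<le> 4 * R * h / (m * m)"
        using dF Fm[OF lr(1)] Fm[OF lr(2)] m by (intro frac_le mult_mono) auto
      finally show "\<bar>1 / F r - 1 / F l\<bar> \<le> 4 * R / (m * m) * H_norm \<Omega> (diff (W r) (W l))"
        by (simp add: h_def)
    next
      fix t V assume t: "t \<in> {a..b}" and V: "V \<in> dom_A \<Omega>" "H_has_derivative \<Omega> W (op_A \<Omega> V) t"
        "H_eq \<Omega> (W t) (diff V (scale \<alpha> (op_A \<Omega> V)))"
      have t0: "0 < t" using t ab by simp
      define z where "z = L2_norm \<Omega> (grad \<Omega> (snd V))"
      define d where "d = H_inner \<Omega> (op_A \<Omega> V) (op_A \<Omega> V)"
      define N where "N = H_inner \<Omega> V V"
      define p where "p = L2_inner \<Omega> (grad \<Omega> (fst V)) (grad \<Omega> (snd V))"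
      define S where "S = z ^ 4 + \<alpha> * d"
      define q where "q = 2 * cross_form \<Omega> (op_A \<Omega> V) (W t)"
      note id = op_A_energy_identities[OF dom V(1) WH V(3) cross_form, folded z_def d_def N_def p_def]
      have d0: "0 \<le> d" unfolding d_def by (metis H_norm_power2 zero_le_power2)
      have z0: "0 \<le> z" by (simp add: z_def L2_norm_nonneg)
      have de: "(e has_real_derivative - 2 * S) (at t)"
        using form_has_derivative[OF dom bounded_form_H_inner[OF dom] Wc t0 V(2)] id(1) t0 by (simp add: e_def[abs_def] S_def)
      have dP: "(P has_real_derivative q) (at t)"
        using form_has_derivative[OF dom cross_form Wc t0 V(2)] by (simp add: P_def[abs_def] q_def)
      have snd_V: "snd V \<in> H01_space \<Omega>" using V(1) by (simp add: dom_A_def)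
      have "(L2_norm \<Omega> (snd V))\<^sup>2 \<le> (c * z)\<^sup>2"
        unfolding z_def by (intro power_mono c(2)[OF snd_V] L2_norm_nonneg)
      then have G: "(L2_norm \<Omega> (snd V))\<^sup>2 \<le> c\<^sup>2 * z\<^sup>2" by (simp add: power_mult_distrib)
      have N0: "0 \<le> N" unfolding N_def by (metis H_norm_power2 zero_le_power2)
      have "e t * q \<le> - (3 / 8) * (e t)\<^sup>2 + (4 * c ^ 4 + e0\<^sup>2 / 2 + 19 / 2 * e0) * (z ^ 4 + \<alpha> * d)"
        by (rule energy_multiplier_inequality[OF \<alpha> e_nonneg e_le z0 _ N0 _ _ G])
           (use id t0 in \<open>simp_all add: e_def q_def\<close>)
      then have Fder_le: "- 2 * S * (1 + \<epsilon> * P t) + e t * (\<epsilon> * q) \<le> - (\<epsilon> / 6) * (e t * (1 + \<epsilon> * P t))\<^sup>2"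
        using P_le[of t] t0 \<alpha> d0 z0 \<epsilon>
        by (intro Lyapunov_inequality[where K = "4 * c ^ 4 + e0\<^sup>2 / 2 + 19 / 2 * e0"]) (auto simp: S_def e_nonneg)
      have Fp: "0 < F t" using Fm[OF t] m by simp
      have "(F has_real_derivative - 2 * S * (1 + \<epsilon> * P t) + e t * (\<epsilon> * q)) (at t)"
        unfolding F_def[abs_def] by (auto intro!: derivative_eq_intros de dP)
      then have "((\<lambda>t. 1 / F t) has_real_derivative - (- 2 * S * (1 + \<epsilon> * P t) + e t * (\<epsilon> * q)) / (F t)\<^sup>2) (at t)"
        using Fp by (auto intro!: derivative_eq_intros simp: power2_eq_square)
      moreover have "\<epsilon> / 6 \<le> - (- 2 * S * (1 + \<epsilon> * P t) + e t * (\<epsilon> * q)) / (F t)\<^sup>2"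
      proof (subst pos_le_divide_eq)
        show "0 < (F t)\<^sup>2" using Fp by simp
        show "\<epsilon> / 6 * (F t)\<^sup>2 \<le> - (- 2 * S * (1 + \<epsilon> * P t) + e t * (\<epsilon> * q))"
          using Fder_le unfolding F_def by linarith
      qed
      ultimately show "\<exists>\<Phi>'\<ge>\<epsilon> / 6. ((\<lambda>t. 1 / F t) has_real_derivative \<Phi>') (at t)" by blast
    qed
    moreover have Fp: "0 < F a" "0 < F b" using Fm[of a] Fm[of b] ab m by auto
    then have "0 < 1 / F a" by simp
    moreover have "\<epsilon> / 6 * (b - a) = \<epsilon> * b / 12" by (simp add: a_def)
    ultimately have "\<epsilon> * b / 12 \<le> 1 / F b" by linarith
    then have "F b \<le> 12 / (\<epsilon> * b)" using Fp \<epsilon>(1) b by (simp add: field_simps)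
    then show ?thesis using F_bounds[of b] b by (simp add: e_def)
  qed
qed

lemma H_inner_tendsto:
  assumes "H_tendsto \<Omega> W L F" "eventually (\<lambda>s. W s \<in> H_space \<Omega>) F" "L \<in> H_space \<Omega>"
  shows "((\<lambda>s. H_inner \<Omega> (W s) (W s)) \<longlongrightarrow> H_inner \<Omega> L L) F"
  by (intro form_tendsto[OF dom bounded_form_H_inner[OF dom]] assms)

text \<open>The number \<open>\<epsilon>\<close> depends only on the initial energy and the Poincare constant. All Yosida approximations start from the same
initial state, so the bound holds for all of them at once and survives the limit \<open>\<alpha> \<rightarrow> 0\<close> at each fixed time.\<close>

lemma solution_energy_decay:
  assumes "regular_solution \<Omega> U0 U \<or> mild_solution \<Omega> U0 U"
  shows "\<exists>\<kappa>>0. \<forall>t>0. H_inner \<Omega> (U t) (U t) \<le> H_inner \<Omega> (U 0) (U 0) \<and> H_inner \<Omega> (U t) (U t) \<le> \<kappa> / t"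
proof -
  obtain c where c: "c > 0" "\<And>u. u \<in> H01_space \<Omega> \<Longrightarrow> L2_norm \<Omega> u \<le> c * L2_norm \<Omega> (grad \<Omega> u)"
    using Poincare[OF dom] by blast
  note cross_form = bounded_form_cross_form[OF dom c]
  define e0 where "e0 = H_inner \<Omega> (U 0) (U 0)"
  have e0: "0 \<le> e0" unfolding e0_def by (metis H_norm_power2 zero_le_power2)
  define K where "K = 4 * c ^ 4 + e0\<^sup>2 / 2 + 19 / 2 * e0"
  have K: "0 \<le> K" using e0 c by (simp add: K_def)
  define \<epsilon> where "\<epsilon> = 1 / (2 * c * e0 + K + 1)"
  have D: "0 < 2 * c * e0 + K + 1" using e0 c K by (intro add_nonneg_pos add_nonneg_nonneg) auto
  have \<epsilon>: "0 < \<epsilon>" "\<epsilon> * (c * e0) \<le> 1 / 2" "\<epsilon> * K \<le> 1"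
    using D e0 c K by (auto simp: \<epsilon>_def divide_simps)
  have main: "H_inner \<Omega> (W t) (W t) \<le> e0 \<and> H_inner \<Omega> (W t) (W t) \<le> 24 / (\<epsilon> * t)"
    if "approximate_solution \<Omega> \<alpha> W" "0 \<le> \<alpha>" "\<alpha> \<le> 1" "H_inner \<Omega> (W 0) (W 0) \<le> e0" "0 < t" for \<alpha> W t
    using approximate_solution_energy_decreasing[OF that(1,2) cross_form, of 0 t]
      approximate_solution_decay[OF c that(1-4) \<epsilon>[unfolded K_def] that(5)] that by simp
  have "H_inner \<Omega> (U t) (U t) \<le> e0 \<and> H_inner \<Omega> (U t) (U t) \<le> 24 / (\<epsilon> * t)" if t: "0 < t" for t
    using assms
  proof
    assume "regular_solution \<Omega> U0 U"
    then show ?thesis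
      using main[OF regular_solution_approximate] t by (simp add: e0_def)
  next
    assume M: "mild_solution \<Omega> U0 U"
    then obtain T where T: "\<And>\<alpha>. \<alpha> > 0 \<Longrightarrow> yosida_solution \<Omega> \<alpha> U0 (T \<alpha>)"
      "\<And>t. t \<ge> 0 \<Longrightarrow> U t \<in> H_space \<Omega> \<and> H_tendsto \<Omega> (\<lambda>\<alpha>. T \<alpha> t) (U t) (at_right 0)" and U0: "U0 \<in> H_space \<Omega>"
      unfolding mild_solution_def by blast
    have TH: "T \<alpha> t \<in> H_space \<Omega>" if "\<alpha> > 0" "t \<ge> 0" for \<alpha> t
      using T(1)[OF that(1)] that(2) by (simp add: yosida_solution_def H_continuous_def)
    have lim: "((\<lambda>\<alpha>. H_inner \<Omega> (T \<alpha> t) (T \<alpha> t)) \<longlongrightarrow> H_inner \<Omega> (U t) (U t)) (at_right 0)" if "t \<ge> 0" for t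
      using T(2)[OF that] TH[OF _ that] by (intro H_inner_tendsto) (auto simp: eventually_at_filter)
    have init: "H_inner \<Omega> (T \<alpha> 0) (T \<alpha> 0) = H_inner \<Omega> U0 U0" if "\<alpha> > 0" for \<alpha>
      using H_norm_cong[OF dom TH[OF that] U0] T(1)[OF that] by (simp add: yosida_solution_def flip: H_norm_power2)
    have "((\<lambda>\<alpha>. H_inner \<Omega> (T \<alpha> 0) (T \<alpha> 0)) \<longlongrightarrow> H_inner \<Omega> U0 U0) (at_right 0)"
      by (rule tendsto_eventually) (simp add: eventually_at_filter init)
    then have e0_eq: "e0 = H_inner \<Omega> U0 U0"
      unfolding e0_def by (intro tendsto_unique[OF _ lim]) auto
    have ev: "\<forall>\<^sub>F \<alpha> in at_right 0. H_inner \<Omega> (T \<alpha> t) (T \<alpha> t) \<le> e0 \<and> H_inner \<Omega> (T \<alpha> t) (T \<alpha> t) \<le> 24 / (\<epsilon> * t)"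
      unfolding eventually_at_right_field
    proof (intro exI[of _ 1] conjI allI impI)
      fix \<alpha> :: real assume \<alpha>: "0 < \<alpha>" "\<alpha> < 1"
      have "H_inner \<Omega> (T \<alpha> t) (T \<alpha> t) \<le> e0 \<and> H_inner \<Omega> (T \<alpha> t) (T \<alpha> t) \<le> 24 / (\<epsilon> * t)"
        by (rule main[OF yosida_solution_approximate[OF dom T(1)]]) (use \<alpha> t init e0_eq in auto)
      then show "H_inner \<Omega> (T \<alpha> t) (T \<alpha> t) \<le> e0" "H_inner \<Omega> (T \<alpha> t) (T \<alpha> t) \<le> 24 / (\<epsilon> * t)" by auto
    qed simp
    show ?thesis
    proof
      show "H_inner \<Omega> (U t) (U t) \<le> e0"
        by (rule tendsto_upperbound[OF lim]) (use t ev in \<open>auto elim: eventually_mono\<close>)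
      show "H_inner \<Omega> (U t) (U t) \<le> 24 / (\<epsilon> * t)"
        by (rule tendsto_upperbound[OF lim]) (use t ev in \<open>auto elim: eventually_mono\<close>)
    qed
  qed
  then show ?thesis
    using \<epsilon>(1) unfolding e0_def by (intro exI[of _ "24 / \<epsilon>"]) auto
qed

end

theorem theorem3p2:
  fixes \<Omega> :: "(real^'n) set"
    and u0 u1 :: "real^'n \<Rightarrow> real"
    and u ut :: "real \<Rightarrow> real^'n \<Rightarrow> real"
  assumes "bounded_smooth_domain \<Omega>"
    and "regular_solution \<Omega> (u0, u1) (\<lambda>t. (u t, ut t)) \<or>
         mild_solution \<Omega> (u0, u1) (\<lambda>t. (u t, ut t))"
  shows "\<exists>C>0. \<forall>t\<ge>C.
    weak_energy \<Omega> u ut t \<le> weak_energy \<Omega> u ut 0 * (2 * C / (C + t))"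
proof -
  define E where "E = weak_energy \<Omega> u ut"
  have dom: "open \<Omega>" "bounded \<Omega>" using assms(1) by (auto simp: bounded_smooth_domain_def)
  have E_eq: "H_inner \<Omega> (u t, ut t) (u t, ut t) = 2 * E t" for t
    by (simp add: E_def weak_energy_def H_inner_def L2_norm_power2)
  obtain \<kappa> where \<kappa>: "\<kappa> > 0" "\<And>t. t > 0 \<Longrightarrow> E t \<le> E 0" "\<And>t. t > 0 \<Longrightarrow> 2 * E t \<le> \<kappa> / t"
    using solution_energy_decay[OF dom assms(2)] unfolding E_eq by auto
  have E0: "0 \<le> E 0" by (simp add: E_def weak_energy_def)
  show ?thesis
  (* a vanishing initial energy stays zero, and then kappa / E 0 is not available *)
  proof (cases "E 0 = 0")
    case True
    then have "E t \<le> E 0 * (2 * 1 / (1 + t))" if "t \<ge> 1" for t using \<kappa>(2)[of t] that by simp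
    then show ?thesis unfolding E_def by (intro exI[of _ 1]) auto
  next
    case False
    define C where "C = \<kappa> / E 0"
    have C: "C > 0" "C * E 0 = \<kappa>" using \<kappa>(1) E0 False by (auto simp: C_def)
    have "E t \<le> E 0 * (2 * C / (C + t))" if t: "t \<ge> C" for t
    proof -
      (* for t >= C one has C + t <= 2 t *)
      have "E t \<le> \<kappa> / t" using \<kappa>(3)[of t] divide_pos_pos[OF \<kappa>(1), of t] t C by simp
      also have "\<dots> = \<kappa> * (2 / (t + t))" using t C by simp
      also have "\<dots> \<le> \<kappa> * (2 / (C + t))" using t C \<kappa>(1) by (intro mult_left_mono divide_left_mono) auto
      also have "\<dots> = E 0 * (2 * C / (C + t))" unfolding C(2)[symmetric] by simp
      finally show ?thesis .
    qed
    then show ?thesis using C(1) unfolding E_def by blast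
  qed
qed

end
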